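(* Let $(M,\Delta,g)$ be a $C^{1,1}$ sub-Riemannian manifold of rank $m\ge 1$ (the distribution $\Delta$ is not assumed to be bracket-generating), and let $d$ be its Carnot-Carathéodory distance. Then for every $p\in M$ there exists a length-minimizing curve of positive length passing through $p$; that is, there exist an admissible curve $\gamma:[a,b]\to M$ and $t_0\in[a,b]$ such that $\gamma(t_0)=p$ and $0<L(\gamma)=d(\gamma(a),\gamma(b))$.
   Context: Regularity of functions, vector fields, etc. on a smooth manifold is understood in charts with respect to the usual (Euclidean) manifold structure; a $C^{1,1}$ object is a $C^1$ object whose first-order derivatives are, in charts, locally Lipschitz continuous. An $n$-dimensional $C^{1,1}$ sub-Riemannian manifold of rank $m$ is a triple $(M,\Delta,g)$ where: $M$ is a connected smooth manifold of dimension $n$; $\Delta=\sqcup_{p\in M}\Delta_p$ is a $C^{1,1}$ distribution, i.e. a map $p\mapsto\Delta_p$ assigning to each $p\in M$ an $m$-dimensional vector subspace $\Delta_p$ of $T_pM$, of class $C^{1,1}$ (locally spanned by $m$ vector fields of class $C^{1,1}$); $g$ is a $C^{1,1}$ metric on $\Delta$ (an inner product $g_p$ on each $\Delta_p$, depending on $p$ in a $C^{1,1}$ way). Equivalently, near every point there are $C^{1,1}$ vector fields $X_1,\dots,X_m$ forming a $g$-orthonormal frame of $\Delta$. For $v\in\Delta_p$ set $|v|_p=\sqrt{g_p(v,v)}$. No bracket-generating condition is imposed. An admissible curve joining $p$ and $q$ is an absolutely continuous curve $\gamma:[a,b]\to M$ with $\gamma(a)=p$, $\gamma(b)=q$ and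 $\dot\gamma(t)\in\Delta_{\gamma(t)}$ for a.e. $t\in[a,b]$. Its length is $L(\gamma)=\int_a^b|\dot\gamma(t)|_{\gamma(t)}\,dt$. The Carnot-Carathéodory distance is $d(p,q)=\inf\{L(\gamma):\gamma\text{ is an admissible curve joining }p\text{ and }q\}$, with $\inf\emptyset=+\infty$ (so $d$ takes values in $[0,+\infty]$). An admissible curve is length-minimizing if its length equals the Carnot-Carathéodory distance between its endpoints. *)

theory Defs
  imports "HOL-Analysis.Analysis" "HOL-Library.Function_Algebras"
begin

section \<open>Classes of differentiability between Euclidean spaces\<close>

text \<open>The set \<open>S\<close> is always meant to be open. Quantifying over all directions \<open>v\<close> is
  the same as asking for the regularity of the total derivative, since the source space is
  finite-dimensional.\<close>

fun Ck_on :: "nat \<Rightarrow> 'e::euclidean_space set \<Rightarrow> ('e \<Rightarrow> 'f::euclidean_space) \<Rightarrow> bool" where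
  "Ck_on 0 S f \<longleftrightarrow> continuous_on S f"
| "Ck_on (Suc k) S f \<longleftrightarrow>
     (\<forall>x\<in>S. f differentiable (at x)) \<and> (\<forall>v. Ck_on k S (\<lambda>x. frechet_derivative f (at x) v))"

definition smooth_on :: "'e::euclidean_space set \<Rightarrow> ('e \<Rightarrow> 'f::euclidean_space) \<Rightarrow> bool" where
  "smooth_on S f \<longleftrightarrow> (\<forall>k. Ck_on k S f)"

definition locally_Lipschitz_on :: "'e::metric_space set \<Rightarrow> ('e \<Rightarrow> 'f::metric_space) \<Rightarrow> bool" where
  "locally_Lipschitz_on S f \<longleftrightarrow> (\<forall>x\<in>S. \<exists>r>0. \<exists>L. L-lipschitz_on (ball x r \<inter> S) f)"

definition C11_on :: "'e::euclidean_space set \<Rightarrow> ('e \<Rightarrow> 'f::euclidean_space) \<Rightarrow> bool" where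
  "C11_on S f \<longleftrightarrow>
     Ck_on 1 S f \<and> (\<forall>v. locally_Lipschitz_on S (\<lambda>x. frechet_derivative f (at x) v))"

section \<open>Smooth manifolds\<close>

text \<open>A chart is a pair of its domain and its coordinate map; the values of the
  coordinate map outside the domain are irrelevant.\<close>

type_synonym ('a, 'e) chart = "'a set \<times> ('a \<Rightarrow> 'e)"

abbreviation chart_inv :: "('a, 'e) chart \<Rightarrow> 'e \<Rightarrow> 'a" where
  "chart_inv c \<equiv> inv_into (fst c) (snd c)"

definition is_chart :: "'a topology \<Rightarrow> ('a, 'e::euclidean_space) chart \<Rightarrow> bool" where
  "is_chart X c \<longleftrightarrow>
     openin X (fst c) \<and> open (snd c ` fst c) \<and>
     homeomorphic_map (subtopology X (fst c)) (top_of_set (snd c ` fst c)) (snd c)"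

text \<open>The smooth structure is given by an atlas, which need not be maximal. The dimension of the
  manifold is the dimension of the Euclidean space \<open>'e\<close>.\<close>

locale connected_smooth_manifold =
  fixes X :: "'a topology" and A :: "('a, 'e::euclidean_space) chart set"
  assumes Hausdorff: "Hausdorff_space X"
    and second_countable: "second_countable X"
    and connected: "connected_space X"
    and charts: "\<And>c. c \<in> A \<Longrightarrow> is_chart X c"
    and covering: "(\<Union>c\<in>A. fst c) = topspace X"
    and smooth_transition:
      "\<And>c c'. c \<in> A \<Longrightarrow> c' \<in> A \<Longrightarrow> smooth_on (snd c ` (fst c \<inter> fst c')) (snd c' \<circ> chart_inv c)"

section \<open>Tangent vectors\<close>

text \<open>A tangent vector at \<open>p\<close> is the family of its coordinate representations in the
  charts around \<open>p\<close>, related by the derivatives of the transition maps, and extended by \<open>0\<close>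
  to all other charts. The vector space operations are pointwise.\<close>

type_synonym ('a, 'e) tangent = "('a, 'e) chart \<Rightarrow> 'e"

instantiation "fun" :: (type, real_vector) real_vector
begin

definition scaleR_fun :: "real \<Rightarrow> ('a \<Rightarrow> 'b) \<Rightarrow> 'a \<Rightarrow> 'b" where
  "scaleR_fun r f = (\<lambda>x. r *\<^sub>R f x)"

instance
  by standard (simp_all add: scaleR_fun_def fun_eq_iff algebra_simps)

end

definition tangent_space ::
    "('a, 'e::euclidean_space) chart set \<Rightarrow> 'a \<Rightarrow> ('a, 'e) tangent set" where
  "tangent_space A p =
     {v. (\<forall>c. \<not> (c \<in> A \<and> p \<in> fst c) \<longrightarrow> v c = 0) \<and>
         (\<forall>c\<in>A. \<forall>c'\<in>A. p \<in> fst c \<inter> fst c' \<longrightarrow>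
            v c' = frechet_derivative (snd c' \<circ> chart_inv c) (at (snd c p)) (v c))}"

definition C11_function ::
    "('a, 'e::euclidean_space) chart set \<Rightarrow> 'a set \<Rightarrow> ('a \<Rightarrow> real) \<Rightarrow> bool" where
  "C11_function A W f \<longleftrightarrow> (\<forall>c\<in>A. C11_on (snd c ` (fst c \<inter> W)) (f \<circ> chart_inv c))"

definition C11_vector_field ::
    "('a, 'e::euclidean_space) chart set \<Rightarrow> 'a set \<Rightarrow> ('a \<Rightarrow> ('a, 'e) tangent) \<Rightarrow> bool" where
  "C11_vector_field A W V \<longleftrightarrow>
     (\<forall>q\<in>W. V q \<in> tangent_space A q) \<and>
     (\<forall>c\<in>A. C11_on (snd c ` (fst c \<inter> W)) (\<lambda>x. V (chart_inv c x) c))"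

section \<open>Sub-Riemannian structures\<close>

definition C11_distribution ::
    "'a topology \<Rightarrow> ('a, 'e::euclidean_space) chart set \<Rightarrow> nat \<Rightarrow> ('a \<Rightarrow> ('a, 'e) tangent set) \<Rightarrow> bool"
  where
  "C11_distribution X A m \<Delta> \<longleftrightarrow>
     (\<forall>p\<in>topspace X. subspace (\<Delta> p) \<and> \<Delta> p \<subseteq> tangent_space A p \<and> dim (\<Delta> p) = m) \<and>
     (\<forall>p\<in>topspace X. \<exists>W Y. openin X W \<and> p \<in> W \<and>
        (\<forall>i<m. C11_vector_field A W (Y i)) \<and>
        (\<forall>q\<in>W. \<Delta> q = span ((\<lambda>i. Y i q) ` {..<m})))"

definition inner_product_on :: "'v::real_vector set \<Rightarrow> ('v \<Rightarrow> 'v \<Rightarrow> real) \<Rightarrow> bool" where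
  "inner_product_on V g \<longleftrightarrow>
     (\<forall>u\<in>V. \<forall>v\<in>V. g u v = g v u) \<and>
     (\<forall>u\<in>V. \<forall>v\<in>V. \<forall>w\<in>V. g (u + v) w = g u w + g v w) \<and>
     (\<forall>r. \<forall>u\<in>V. \<forall>v\<in>V. g (r *\<^sub>R u) v = r * g u v) \<and>
     (\<forall>u\<in>V. u \<noteq> 0 \<longrightarrow> g u u > 0)"

text \<open>That the inner products depend on the point in a \<open>C\<^sup>1\<^sup>,\<^sup>1\<close> way is tested on local
  \<open>C\<^sup>1\<^sup>,\<^sup>1\<close> sections of the distribution, equivalently on local frames.\<close>

definition C11_metric ::
    "'a topology \<Rightarrow> ('a, 'e::euclidean_space) chart set \<Rightarrow> ('a \<Rightarrow> ('a, 'e) tangent set) \<Rightarrow>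
     ('a \<Rightarrow> ('a, 'e) tangent \<Rightarrow> ('a, 'e) tangent \<Rightarrow> real) \<Rightarrow> bool" where
  "C11_metric X A \<Delta> g \<longleftrightarrow>
     (\<forall>p\<in>topspace X. inner_product_on (\<Delta> p) (g p)) \<and>
     (\<forall>W Y Z. openin X W \<and> C11_vector_field A W Y \<and> C11_vector_field A W Z \<and>
        (\<forall>q\<in>W. Y q \<in> \<Delta> q \<and> Z q \<in> \<Delta> q) \<longrightarrow>
        C11_function A W (\<lambda>q. g q (Y q) (Z q)))"

locale C11_sub_Riemannian_manifold = connected_smooth_manifold X A
  for X :: "'a topology" and A :: "('a, 'e::euclidean_space) chart set" +
  fixes m :: nat
    and \<Delta> :: "'a \<Rightarrow> ('a, 'e) tangent set"
    and g :: "'a \<Rightarrow> ('a, 'e) tangent \<Rightarrow> ('a, 'e) tangent \<Rightarrow> real"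
  assumes distribution: "C11_distribution X A m \<Delta>"
    and metric: "C11_metric X A \<Delta> g"

section \<open>Admissible curves and the Carnot-Caratheodory distance\<close>

definition absolutely_continuous_on_interval ::
    "real \<Rightarrow> real \<Rightarrow> (real \<Rightarrow> 'f::real_normed_vector) \<Rightarrow> bool" where
  "absolutely_continuous_on_interval a b f \<longleftrightarrow>
     (\<forall>\<epsilon>>0. \<exists>\<delta>>0. \<forall>P. finite P \<and>
        (\<forall>(s, t)\<in>P. a \<le> s \<and> s \<le> t \<and> t \<le> b) \<and>
        pairwise (\<lambda>(s, t) (s', t'). {s<..<t} \<inter> {s'<..<t'} = {}) P \<and>
        (\<Sum>(s, t)\<in>P. t - s) < \<delta> \<longrightarrow>
        (\<Sum>(s, t)\<in>P. norm (f t - f s)) < \<epsilon>)"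

definition absolutely_continuous_curve ::
    "'a topology \<Rightarrow> ('a, 'e::euclidean_space) chart set \<Rightarrow> real \<Rightarrow> real \<Rightarrow> (real \<Rightarrow> 'a) \<Rightarrow> bool" where
  "absolutely_continuous_curve X A a b \<gamma> \<longleftrightarrow>
     continuous_map (top_of_set {a..b}) X \<gamma> \<and>
     (\<forall>c\<in>A. \<forall>s t. a \<le> s \<and> s \<le> t \<and> t \<le> b \<and> \<gamma> ` {s..t} \<subseteq> fst c \<longrightarrow>
        absolutely_continuous_on_interval s t (snd c \<circ> \<gamma>))"

definition velocity ::
    "('a, 'e::euclidean_space) chart set \<Rightarrow> real \<Rightarrow> real \<Rightarrow> (real \<Rightarrow> 'a) \<Rightarrow> real \<Rightarrow> ('a, 'e) tangent" where
  "velocity A a b \<gamma> t =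
     (\<lambda>c. if c \<in> A \<and> \<gamma> t \<in> fst c
          then vector_derivative (snd c \<circ> \<gamma>) (at t within {a..b}) else 0)"

definition differentiable_curve_at ::
    "('a, 'e::euclidean_space) chart set \<Rightarrow> real \<Rightarrow> real \<Rightarrow> (real \<Rightarrow> 'a) \<Rightarrow> real \<Rightarrow> bool" where
  "differentiable_curve_at A a b \<gamma> t \<longleftrightarrow>
     (\<forall>c\<in>A. \<gamma> t \<in> fst c \<longrightarrow> (snd c \<circ> \<gamma>) differentiable (at t within {a..b}))"

text \<open>Differentiability almost everywhere is automatic for absolutely continuous curves; it is
  spelled out because \<^const>\<open>vector_derivative\<close> is unspecified elsewhere.\<close>

definition admissible ::
    "'a topology \<Rightarrow> ('a, 'e::euclidean_space) chart set \<Rightarrow> ('a \<Rightarrow> ('a, 'e) tangent set) \<Rightarrow>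
     real \<Rightarrow> real \<Rightarrow> (real \<Rightarrow> 'a) \<Rightarrow> bool" where
  "admissible X A \<Delta> a b \<gamma> \<longleftrightarrow>
     a \<le> b \<and> absolutely_continuous_curve X A a b \<gamma> \<and>
     (AE t in lebesgue_on {a..b}.
        differentiable_curve_at A a b \<gamma> t \<and> velocity A a b \<gamma> t \<in> \<Delta> (\<gamma> t))"

definition curve_length ::
    "('a, 'e::euclidean_space) chart set \<Rightarrow> ('a \<Rightarrow> ('a, 'e) tangent \<Rightarrow> ('a, 'e) tangent \<Rightarrow> real) \<Rightarrow>
     real \<Rightarrow> real \<Rightarrow> (real \<Rightarrow> 'a) \<Rightarrow> ennreal" where
  "curve_length A g a b \<gamma> =
     (\<integral>\<^sup>+ t. ennreal (sqrt (g (\<gamma> t) (velocity A a b \<gamma> t) (velocity A a b \<gamma> t)))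
        \<partial>lebesgue_on {a..b})"

text \<open>In \<^typ>\<open>ennreal\<close> the infimum of the empty set is \<open>\<infinity>\<close>.\<close>

definition cc_dist ::
    "'a topology \<Rightarrow> ('a, 'e::euclidean_space) chart set \<Rightarrow> ('a \<Rightarrow> ('a, 'e) tangent set) \<Rightarrow>
     ('a \<Rightarrow> ('a, 'e) tangent \<Rightarrow> ('a, 'e) tangent \<Rightarrow> real) \<Rightarrow> 'a \<Rightarrow> 'a \<Rightarrow> ennreal" where
  "cc_dist X A \<Delta> g p q =
     Inf {curve_length A g a b \<gamma> | a b \<gamma>. admissible X A \<Delta> a b \<gamma> \<and> \<gamma> a = p \<and> \<gamma> b = q}"

definition length_minimizing ::
    "'a topology \<Rightarrow> ('a, 'e::euclidean_space) chart set \<Rightarrow> ('a \<Rightarrow> ('a, 'e) tangent set) \<Rightarrow>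
     ('a \<Rightarrow> ('a, 'e) tangent \<Rightarrow> ('a, 'e) tangent \<Rightarrow> real) \<Rightarrow> real \<Rightarrow> real \<Rightarrow> (real \<Rightarrow> 'a) \<Rightarrow> bool" where
  "length_minimizing X A \<Delta> g a b \<gamma> \<longleftrightarrow>
     admissible X A \<Delta> a b \<gamma> \<and> curve_length A g a b \<gamma> = cc_dist X A \<Delta> g (\<gamma> a) (\<gamma> b)"

end

theory Submission
  imports Defs
begin

text \<open>
  The minimizing curve is a short piece of a normal extremal starting at \<open>p\<close>, and its minimality is
  certified by an explicit calibration.

  In a chart around \<open>p\<close>, with \<open>x\<^sub>0\<close> the coordinates of \<open>p\<close>, take an orthonormal frame
  \<open>Y\<^sub>i\<close> of class \<open>C\<^sup>1\<^sup>,\<^sup>1\<close> (Gram-Schmidt, lemma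
  \<open>orthonormal_frame\<close>). The Hamiltonian \<open>H(x, \<xi>) = 1/2 \<Sum>\<^sub>i (\<xi> \<bullet> Y\<^sub>i(x))\<^sup>2\<close> is of class
  \<open>C\<^sup>1\<^sup>,\<^sup>1\<close>, so its Hamiltonian vector field is locally Lipschitz and has an integral
  curve \<open>(x, \<xi>)\<close> through \<open>(x\<^sub>0, \<xi>\<^sub>0)\<close>, where \<open>\<xi>\<^sub>0\<close> is normalized by \<open>H(x\<^sub>0, \<xi>\<^sub>0) = 1/2\<close>. It is
  parametrized so that the affine function \<open>\<tau>(z) = \<xi>\<^sub>0 \<bullet> (z - x\<^sub>0)\<close> satisfies \<open>\<tau>(x(t)) = t\<close>; this
  assigns a time to every nearby point without any inverse function theorem.

  The calibration is
  \<open>F(z) = c(t) + \<xi>(t) \<bullet> y - (K/2) t |y|\<^sup>2\<close> with \<open>t = \<tau>(z)\<close> and \<open>y = z - x(t)\<close>,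
  where \<open>c'\<close> is the sub-Riemannian speed of \<open>x\<close>. Its differential is \<open>\<xi>(t)\<close> on the extremal, where
  \<open>\<Sum>\<^sub>i (dF Y\<^sub>i)\<^sup>2 = 1\<close> by conservation of \<open>H\<close>. Off the extremal the terms of \<open>\<Sum>\<^sub>i (dF Y\<^sub>i)\<^sup>2\<close> that
  are linear in \<open>y\<close> cancel by Hamilton's equations. The quadratic remainder is at most
  \<open>C |y|\<^sup>2\<close>, with \<open>C\<close> independent of \<open>K\<close> as long as \<open>|y|\<close>, \<open>K |t|\<close> and \<open>K |y|\<close> are at most 1; this is where the
  Lipschitz derivatives of the frame enter. The \<open>t\<close>-derivative of the quadratic term of \<open>F\<close>
  contributes at most \<open>- (K/2) |y|\<^sup>2\<close>, so \<open>\<Sum>\<^sub>i (dF Y\<^sub>i)\<^sup>2 \<le> 1\<close> near \<open>x\<^sub>0\<close> once \<open>K\<close> is large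
  (lemma \<open>energy_estimate\<close>).

  By the Cauchy-Schwarz inequality \<open>(F \<circ> \<eta>)' \<le> |\<eta>'|\<close> almost everywhere along an admissible curve
  \<open>\<eta>\<close> near \<open>p\<close>, so \<open>F\<close> increases along \<open>\<eta>\<close> by at most the length of \<open>\<eta>\<close> (lemma
  \<open>increment_le_length\<close>), while along the extremal it increases exactly by the length. A competitor
  that leaves the neighbourhood has length at least a fixed \<open>\<epsilon> > 0\<close>, by the same lemma applied to a linear
  function, and the extremal is cut to length less than \<open>\<epsilon>\<close>.
\<close>

section \<open>Absolutely continuous functions of one variable\<close>

text \<open>The fundamental theorem of calculus for the Henstock-Kurzweil integral, where it is a direct gauge
  argument: around the exceptional points the gauge is an open set of small measure, on which absolute
  continuity controls the increments; elsewhere it comes from the definition of the derivative.\<close>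

lemma absolutely_continuous_has_integral:
  fixes h h' :: "real \<Rightarrow> real"
  assumes AC: "absolutely_continuous_on_interval a b h" and "a \<le> b" and N: "negligible N"
    and der: "\<And>t. t \<in> {a..b} - N \<Longrightarrow> (h has_vector_derivative h' t) (at t within {a..b})"
  shows "((\<lambda>t. if t \<in> N then 0 else h' t) has_integral (h b - h a)) {a..b}"
proof (cases "a = b")
  case True
  then show ?thesis by (simp add: has_integral_refl)
next
  case False
  with \<open>a \<le> b\<close> have ab: "a < b" by simp
  define f where "f = (\<lambda>t. if t \<in> N then 0 else h' t)"
  have "(f has_integral (h b - h a)) {a..b}"
    unfolding has_integral_factor_content_real
  proof (intro allI impI)
    fix e :: real assume "e > 0"
    define \<epsilon> where "\<epsilon> = e / 2 * (b - a)"
    have "\<epsilon> > 0" using ab \<open>e > 0\<close> by (simp add: \<epsilon>_def)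
    obtain \<delta> where "\<delta> > 0" and \<delta>: "\<forall>P. finite P \<and>
        (\<forall>(s, t)\<in>P. a \<le> s \<and> s \<le> t \<and> t \<le> b) \<and>
        pairwise (\<lambda>(s, t) (s', t'). {s<..<t} \<inter> {s'<..<t'} = {}) P \<and>
        (\<Sum>(s, t)\<in>P. t - s) < \<delta> \<longrightarrow> (\<Sum>(s, t)\<in>P. norm (h t - h s)) < \<epsilon>"
      using AC[unfolded absolutely_continuous_on_interval_def, THEN spec, THEN mp, OF \<open>\<epsilon> > 0\<close>]
      by (elim exE conjE)
    obtain U where U: "open U" "N \<subseteq> U" "(U - N) \<in> lmeasurable" "emeasure lebesgue (U - N) < ennreal \<delta>"
      using sets_lebesgue_outer_open[OF negligible_imp_sets[OF N] \<open>\<delta> > 0\<close>] by blast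
    have Um: "U \<in> lmeasurable" "measure lebesgue U < \<delta>"
    proof -
      have eq: "U = (U - N) \<union> N" using U(2) by blast
      show "U \<in> lmeasurable"
        by (subst eq) (intro fmeasurable.Un U(3) negligible_imp_measurable N)
      have "measure lebesgue U = measure lebesgue (U - N)"
        using N by (metis U(3) eq fmeasurableD measure_Un_null_set negligible_iff_null_sets)
      also have "\<dots> < \<delta>"
        using U(3,4) by (simp add: emeasure_eq_measure2 ennreal_less_iff)
      finally show "measure lebesgue U < \<delta>" .
    qed
    have "\<exists>d>0. \<forall>y\<in>{a..b}. \<bar>y - t\<bar> < d \<longrightarrow> \<bar>h y - h t - (y - t) * h' t\<bar> \<le> e / 2 * \<bar>y - t\<bar>"
      if "t \<in> {a..b} - N" for t
    proof -
      have "e / 2 > 0" using \<open>e > 0\<close> by simp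
      with der[OF that] have "\<exists>d>0. \<forall>y\<in>{a..b}. norm (y - t) < d \<longrightarrow>
          norm (h y - h t - (y - t) *\<^sub>R h' t) \<le> e / 2 * norm (y - t)"
        unfolding has_vector_derivative_def has_derivative_within_alt by blast
      then show ?thesis by simp
    qed
    then obtain \<rho> where \<rho>: "\<And>t. t \<in> {a..b} - N \<Longrightarrow> \<rho> t > 0"
      "\<And>t y. t \<in> {a..b} - N \<Longrightarrow> y \<in> {a..b} \<Longrightarrow> \<bar>y - t\<bar> < \<rho> t \<Longrightarrow>
         \<bar>h y - h t - (y - t) * h' t\<bar> \<le> e / 2 * \<bar>y - t\<bar>"
      by metis
    define d where "d = (\<lambda>t. if t \<in> N then U else if t \<in> {a..b} then ball t (\<rho> t) else UNIV)"
    have gauge: "gauge d"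
      using U(1,2) \<rho>(1) by (auto simp: gauge_def d_def)
    have bound: "norm ((\<Sum>(x,K)\<in>p. measure lborel K *\<^sub>R f x) - (h b - h a)) \<le> e * measure lborel {a..b}"
      if p: "p tagged_division_of {a..b}" and fine: "d fine p" for p
    proof -
      have fin: "finite p" using p by auto
      define H where "H = (\<lambda>K. h (Sup K) - h (Inf K))"
      have tag: "\<exists>u v. K = {u..v} \<and> u \<le> x \<and> x \<le> v \<and> a \<le> u \<and> v \<le> b" if "(x, K) \<in> p" for x K
      proof -
        have "x \<in> K" "K \<subseteq> {a..b}" "\<exists>u v. K = cbox u v"
          using tagged_division_ofD[OF p] that by blast+
        then obtain u v where "K = {u..v}" by auto
        then show ?thesis using \<open>x \<in> K\<close> \<open>K \<subseteq> {a..b}\<close> by (intro exI[of _ u] exI[of _ v]) auto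
      qed
      \<comment> \<open>Degenerate intervals are left out so that an interval determines its tag.\<close>
      define q where "q = {(x, K) \<in> p. x \<in> N \<and> interior K \<noteq> {}}"
      have qp: "q \<subseteq> p" and finq: "finite q" using fin by (auto simp: q_def intro: finite_subset)
      have disj: "interior K \<inter> interior K' = {}" if "(x,K) \<in> p" "(x',K') \<in> p" "(x,K) \<noteq> (x',K')" for x K x' K'
        using tagged_division_ofD(5)[OF p that] .
      have sum_q: "(\<Sum>(x,K)\<in>q. \<bar>H K\<bar>) < \<epsilon>"
      proof -
        define P where "P = (\<lambda>(x,K). (Inf K, Sup K)) ` q"
        have inj: "inj_on (\<lambda>(x::real,K::real set). (Inf K, Sup K)) q"
        proof (rule inj_onI, clarify)
          fix x K x' K' assume A: "(x, K) \<in> q" "(x', K') \<in> q" "Inf K = Inf K'" "Sup K = Sup K'"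
          have pp: "(x, K) \<in> p" "(x', K') \<in> p" using A qp by auto
          have "K = K'"
            using tag[OF pp(1)] tag[OF pp(2)] A(3,4) by auto
          moreover have "interior K \<noteq> {}" using A by (auto simp: q_def)
          ultimately show "x = x' \<and> K = K'" using disj[of x K x' K'] A qp by auto
        qed
        have sums: "(\<Sum>(s,t)\<in>P. \<phi> s t) = (\<Sum>(x,K)\<in>q. \<phi> (Inf K) (Sup K))" for \<phi> :: "real \<Rightarrow> real \<Rightarrow> real"
          unfolding P_def by (subst sum.reindex[OF inj]) (auto intro!: sum.cong)
        have "(\<Sum>(s,t)\<in>P. norm (h t - h s)) < \<epsilon>"
        proof (rule \<delta>[rule_format], intro conjI)
          show "finite P" using finq by (simp add: P_def)
          show "\<forall>(s, t)\<in>P. a \<le> s \<and> s \<le> t \<and> t \<le> b"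
            unfolding P_def using tag qp by fastforce
          show "pairwise (\<lambda>(s, t) (s', t'). {s<..<t} \<inter> {s'<..<t'} = {}) P"
          proof -
            have "{Inf K<..<Sup K} \<inter> {Inf K'<..<Sup K'} = {}"
              if "(x,K) \<in> q" "(x',K') \<in> q" "(Inf K, Sup K) \<noteq> (Inf K', Sup K')" for x K x' K'
            proof -
              have "(x,K) \<in> p" "(x',K') \<in> p" using that qp by auto
              then show ?thesis
                using disj[of x K x' K'] that tag[of x K] tag[of x' K'] by auto
            qed
            then show ?thesis unfolding P_def pairwise_def by fastforce
          qed
          have "(\<Sum>(s, t)\<in>P. t - s) = (\<Sum>(x,K)\<in>q. measure lebesgue K)"
            unfolding sums using tag qp by (intro sum.cong) (force+)
          also have "\<dots> = (\<Sum>K\<in>snd ` q. measure lebesgue K)"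
          proof (subst sum.reindex)
            show "inj_on snd q"
              using disj qp by (fastforce simp: inj_on_def q_def)
          qed (auto intro!: sum.cong)
          also have "\<dots> = measure lebesgue (\<Union>(snd ` q))"
          proof (rule measure_negligible_finite_Union[symmetric])
            show "finite (snd ` q)" using finq by simp
            show "K \<in> lmeasurable" if "K \<in> snd ` q" for K
              using that tag qp by fastforce
            show "pairwise (\<lambda>S T. negligible (S \<inter> T)) (snd ` q)"
            proof (rule pairwiseI)
              fix S T assume ST: "S \<in> snd ` q" "T \<in> snd ` q" "S \<noteq> T"
              obtain x where "(x,S) \<in> q" using ST(1) by force
              moreover obtain y where "(y,T) \<in> q" using ST(2) by force
              ultimately have xy: "(x,S) \<in> p" "(y,T) \<in> p" using qp by auto
              then have "interior (S \<inter> T) = {}" using disj[OF xy] ST by auto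
              moreover have "convex (S \<inter> T)" using tag[OF xy(1)] tag[OF xy(2)] by (auto intro: convex_Int)
              ultimately show "negligible (S \<inter> T)"
                using negligible_convex_interior by blast
            qed
          qed
          also have "\<dots> \<le> measure lebesgue U"
          proof (rule measure_mono_fmeasurable)
            show "\<Union> (snd ` q) \<subseteq> U"
              using fineD[OF fine] qp by (fastforce simp: q_def d_def)
            show "\<Union> (snd ` q) \<in> sets lebesgue"
              using finq tag qp by (intro sets.finite_Union) (auto, force)
          qed (rule Um)
          also have "\<dots> < \<delta>" by (rule Um)
          finally show "(\<Sum>(s, t)\<in>P. t - s) < \<delta>" .
        qed
        then show ?thesis unfolding sums by (simp add: H_def)
      qed
      have bound1: "\<bar>measure lborel K * f x - H K\<bar> \<le> e / 2 * measure lborel K" if "(x,K) \<in> p - q" for x K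
      proof -
        have "(x,K) \<in> p" using that by simp
        from tag[OF this] obtain u v where uv: "K = {u..v}" "u \<le> x" "x \<le> v" "a \<le> u" "v \<le> b"
          by blast
        show ?thesis
        proof (cases "u = v")
          case True
          then show ?thesis by (simp add: uv H_def)
        next
          case False
          then have "x \<notin> N" using that uv by (auto simp: q_def)
          then have x: "x \<in> {a..b} - N" using uv by auto
          have "K \<subseteq> d x" using fineD[OF fine] that by auto
          then have sub: "{u..v} \<subseteq> ball x (\<rho> x)" using x by (auto simp: d_def uv)
          then have "v \<in> ball x (\<rho> x)" "u \<in> ball x (\<rho> x)"
            using subsetD[OF sub, of v] subsetD[OF sub, of u] uv(2,3) by simp_all
          then have "\<bar>v - x\<bar> < \<rho> x" "\<bar>u - x\<bar> < \<rho> x"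
            by (auto simp: dist_real_def)
          then have "\<bar>h v - h x - (v - x) * h' x\<bar> \<le> e / 2 * (v - x)"
            "\<bar>h u - h x - (u - x) * h' x\<bar> \<le> e / 2 * (x - u)"
            using \<rho>(2)[OF x, of v] \<rho>(2)[OF x, of u] uv by auto
          then have "\<bar>(h u - h x - (u - x) * h' x) - (h v - h x - (v - x) * h' x)\<bar>
              \<le> e / 2 * (v - x) + e / 2 * (x - u)"
            by linarith
          also have "(h u - h x - (u - x) * h' x) - (h v - h x - (v - x) * h' x)
              = (v - u) * h' x - (h v - h u)"
            by (simp add: algebra_simps)
          also have "e / 2 * (v - x) + e / 2 * (x - u) = e / 2 * (v - u)"
            by (simp add: field_simps)
          finally have "\<bar>(v - u) * h' x - (h v - h u)\<bar> \<le> e / 2 * (v - u)" .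
          then show ?thesis using uv \<open>x \<notin> N\<close> by (simp add: H_def f_def)
        qed
      qed
      have bound2: "\<bar>measure lborel K * f x - H K\<bar> = \<bar>H K\<bar>" if "(x,K) \<in> q" for x K
        using that by (auto simp: q_def f_def)
      have "h b - h a = (\<Sum>(x,K)\<in>p. H K)"
        unfolding H_def using additive_tagged_division_1[OF \<open>a \<le> b\<close> p, of h] by simp
      then have "norm ((\<Sum>(x,K)\<in>p. measure lborel K *\<^sub>R f x) - (h b - h a)) = \<bar>\<Sum>(x,K)\<in>p. measure lborel K * f x - H K\<bar>"
        by (simp add: sum_subtractf case_prod_unfold)
      also have "\<dots> \<le> (\<Sum>(x,K)\<in>p. \<bar>measure lborel K * f x - H K\<bar>)"
        by (metis (mono_tags, lifting) case_prod_beta' sum.cong sum_abs)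
      also have "\<dots> = (\<Sum>(x,K)\<in>p - q. \<bar>measure lborel K * f x - H K\<bar>) + (\<Sum>(x,K)\<in>q. \<bar>measure lborel K * f x - H K\<bar>)"
        using sum.subset_diff[OF qp fin] .
      also have "(\<Sum>(x,K)\<in>p - q. \<bar>measure lborel K * f x - H K\<bar>) \<le> (\<Sum>(x,K)\<in>p - q. e / 2 * measure lborel K)"
        using bound1 by (intro sum_mono) auto
      also have "\<dots> \<le> (\<Sum>(x,K)\<in>p. e / 2 * measure lborel K)"
        using \<open>e > 0\<close> fin by (intro sum_mono2) (auto intro!: mult_nonneg_nonneg)
      also have "\<dots> = e / 2 * (\<Sum>(x,K)\<in>p. measure lborel K)"
        by (simp add: sum_distrib_left case_prod_unfold)
      also have "(\<Sum>(x,K)\<in>p. measure lborel K) = b - a"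
        using additive_content_tagged_division[of p a b] p ab by simp
      also have "(\<Sum>(x,K)\<in>q. \<bar>measure lborel K * f x - H K\<bar>) = (\<Sum>(x,K)\<in>q. \<bar>H K\<bar>)"
        using bound2 by (intro sum.cong) auto
      also note sum_q
      finally show ?thesis using ab by (simp add: \<epsilon>_def algebra_simps)
    qed
    show "\<exists>d. gauge d \<and> (\<forall>p. p tagged_division_of {a..b} \<and> d fine p \<longrightarrow>
        norm ((\<Sum>(x, k)\<in>p. measure lborel k *\<^sub>R f x) - (h b - h a)) \<le> e * measure lborel {a..b})"
      by (intro exI[of _ d] conjI gauge allI impI, elim conjE, rule bound)
  qed
  then show ?thesis by (simp add: f_def)
qed

text \<open>The speed \<open>\<Phi>\<close> is not assumed to be measurable: the derivative of \<open>h\<close>, which is measurable, is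
  compared with it almost everywhere.\<close>

lemma absolutely_continuous_increment_le:
  fixes h \<Phi> :: "real \<Rightarrow> real"
  assumes AC: "absolutely_continuous_on_interval a b h" and "a \<le> b"
    and ae: "AE t in lebesgue_on {a..b}. \<exists>d. (h has_vector_derivative d) (at t within {a..b}) \<and> d \<le> \<Phi> t"
  shows "ennreal (h b - h a) \<le> (\<integral>\<^sup>+ t. ennreal (\<Phi> t) \<partial>lebesgue_on {a..b})"
proof -
  obtain N where N: "N \<in> null_sets (lebesgue_on {a..b})"
    "{t\<in>{a..b}. \<not> (\<exists>d. (h has_vector_derivative d) (at t within {a..b}) \<and> d \<le> \<Phi> t)} \<subseteq> N"
    using ae by (auto simp: eventually_ae_filter)
  have neg: "negligible N"
    using N(1) by (simp add: null_sets_restrict_space negligible_iff_null_sets)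
  obtain h' where h': "\<And>t. t \<in> {a..b} - N \<Longrightarrow> (h has_vector_derivative h' t) (at t within {a..b})"
    "\<And>t. t \<in> {a..b} - N \<Longrightarrow> h' t \<le> \<Phi> t"
    using N(2) by (auto simp: subset_iff) metis
  define f where "f = (\<lambda>t. if t \<in> N then 0 else h' t)"
  have I: "(f has_integral (h b - h a)) {a..b}"
    unfolding f_def by (rule absolutely_continuous_has_integral[OF AC \<open>a \<le> b\<close> neg h'(1)])
  then have meas: "f \<in> borel_measurable (lebesgue_on {a..b})"
    using integrable_imp_measurable by blast
  define \<Psi> where "\<Psi> = (\<lambda>t. max (f t) 0)"
  have measP: "\<Psi> \<in> borel_measurable (lebesgue_on {a..b})"
    unfolding \<Psi>_def using meas by measurable
  have "(\<integral>\<^sup>+ t. ennreal (\<Psi> t) \<partial>lebesgue_on {a..b}) \<le> (\<integral>\<^sup>+ t. ennreal (\<Phi> t) \<partial>lebesgue_on {a..b})"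
  proof (rule nn_integral_mono_AE)
    show "AE t in lebesgue_on {a..b}. ennreal (\<Psi> t) \<le> ennreal (\<Phi> t)"
    proof (rule AE_I'[OF N(1)])
      show "{t \<in> space (lebesgue_on {a..b}). \<not> ennreal (\<Psi> t) \<le> ennreal (\<Phi> t)} \<subseteq> N"
      proof clarify
        fix t assume t: "t \<in> space (lebesgue_on {a..b})" "\<not> ennreal (\<Psi> t) \<le> ennreal (\<Phi> t)"
        show "t \<in> N"
        proof (rule ccontr)
          assume "t \<notin> N"
          then have "h' t \<le> \<Phi> t" using h'(2) t(1) by simp
          then have "ennreal (\<Psi> t) \<le> ennreal (\<Phi> t)"
            using \<open>t \<notin> N\<close> by (auto simp: \<Psi>_def f_def max_def ennreal_leI)
          then show False using t(2) by simp
        qed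
      qed
    qed
  qed
  moreover have "ennreal (h b - h a) \<le> (\<integral>\<^sup>+ t. ennreal (\<Psi> t) \<partial>lebesgue_on {a..b})"
  proof (cases "(\<integral>\<^sup>+ t. ennreal (\<Psi> t) \<partial>lebesgue_on {a..b}) = \<infinity>")
    case False
    have int: "integrable (lebesgue_on {a..b}) \<Psi>"
      using False measP by (intro integrableI_nonneg) (auto simp: \<Psi>_def less_top)
    then have "(\<Psi> has_integral integral\<^sup>L (lebesgue_on {a..b}) \<Psi>) {a..b}"
      by (intro has_integral_integral_lebesgue_on) auto
    from has_integral_le[OF I this] have "h b - h a \<le> integral\<^sup>L (lebesgue_on {a..b}) \<Psi>"
      by (simp add: \<Psi>_def)
    then show ?thesis
      using nn_integral_eq_integral[OF int] by (simp add: \<Psi>_def ennreal_leI)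
  qed simp
  ultimately show ?thesis by (rule order_trans[rotated])
qed

lemma absolutely_continuous_lipschitz_compose:
  fixes f :: "'a::real_normed_vector \<Rightarrow> 'b::real_normed_vector"
  assumes "absolutely_continuous_on_interval a b \<phi>" "B-lipschitz_on S f" "\<phi> ` {a..b} \<subseteq> S"
  shows "absolutely_continuous_on_interval a b (f \<circ> \<phi>)"
  unfolding absolutely_continuous_on_interval_def
proof (intro allI impI)
  fix \<epsilon> :: real assume "\<epsilon> > 0"
  have B: "0 \<le> B" using lipschitz_on_nonneg[OF assms(2)] .
  then have "\<epsilon> / (B + 1) > 0" using \<open>\<epsilon> > 0\<close> by simp
  from assms(1)[unfolded absolutely_continuous_on_interval_def, THEN spec, THEN mp, OF this]
  obtain \<delta> where \<delta>: "\<delta> > 0" "\<forall>P. finite P \<and> (\<forall>(s, t)\<in>P. a \<le> s \<and> s \<le> t \<and> t \<le> b) \<and>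
        pairwise (\<lambda>(s, t) (s', t'). {s<..<t} \<inter> {s'<..<t'} = {}) P \<and>
        (\<Sum>(s, t)\<in>P. t - s) < \<delta> \<longrightarrow> (\<Sum>(s, t)\<in>P. norm (\<phi> t - \<phi> s)) < \<epsilon> / (B + 1)"
    by (elim exE conjE)
  show "\<exists>\<delta>>0. \<forall>P. finite P \<and> (\<forall>(s, t)\<in>P. a \<le> s \<and> s \<le> t \<and> t \<le> b) \<and>
        pairwise (\<lambda>(s, t) (s', t'). {s<..<t} \<inter> {s'<..<t'} = {}) P \<and>
        (\<Sum>(s, t)\<in>P. t - s) < \<delta> \<longrightarrow> (\<Sum>(s, t)\<in>P. norm ((f \<circ> \<phi>) t - (f \<circ> \<phi>) s)) < \<epsilon>"
  proof (rule exI[of _ \<delta>], rule conjI[OF \<delta>(1)], intro allI impI)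
    fix P :: "(real \<times> real) set"
    assume P: "finite P \<and> (\<forall>(s, t)\<in>P. a \<le> s \<and> s \<le> t \<and> t \<le> b) \<and>
        pairwise (\<lambda>(s, t) (s', t'). {s<..<t} \<inter> {s'<..<t'} = {}) P \<and> (\<Sum>(s, t)\<in>P. t - s) < \<delta>"
    have "norm (f (\<phi> t) - f (\<phi> s)) \<le> B * norm (\<phi> t - \<phi> s)" if "(s, t) \<in> P" for s t
    proof -
      have "a \<le> s \<and> s \<le> t \<and> t \<le> b" using P that by fast
      then have "\<phi> s \<in> S" "\<phi> t \<in> S" using assms(3) by auto
      then show ?thesis using lipschitz_onD[OF assms(2)] by (simp add: dist_norm)
    qed
    then have "(\<Sum>(s, t)\<in>P. norm ((f \<circ> \<phi>) t - (f \<circ> \<phi>) s)) \<le> (\<Sum>(s, t)\<in>P. B * norm (\<phi> t - \<phi> s))"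
      by (intro sum_mono) auto
    also have "\<dots> = B * (\<Sum>(s, t)\<in>P. norm (\<phi> t - \<phi> s))"
      by (simp add: sum_distrib_left case_prod_unfold)
    also have "\<dots> \<le> B * (\<epsilon> / (B + 1))"
      by (rule mult_left_mono[OF less_imp_le[OF \<delta>(2)[THEN spec, THEN mp, OF P]] B])
    also have "\<dots> < \<epsilon>" using B \<open>\<epsilon> > 0\<close> by (simp add: field_simps)
    finally show "(\<Sum>(s, t)\<in>P. norm ((f \<circ> \<phi>) t - (f \<circ> \<phi>) s)) < \<epsilon>" .
  qed
qed

lemma absolutely_continuous_id: "absolutely_continuous_on_interval a b (\<lambda>t. t)"
  unfolding absolutely_continuous_on_interval_def
proof (intro allI impI)
  fix \<epsilon> :: real assume "\<epsilon> > 0"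
  show "\<exists>\<delta>>0. \<forall>P. finite P \<and> (\<forall>(s, t)\<in>P. a \<le> s \<and> s \<le> t \<and> t \<le> b) \<and>
        pairwise (\<lambda>(s, t) (s', t'). {s<..<t} \<inter> {s'<..<t'} = {}) P \<and>
        (\<Sum>(s, t)\<in>P. t - s) < \<delta> \<longrightarrow> (\<Sum>(s, t)\<in>P. norm (t - s)) < \<epsilon>"
  proof (rule exI[of _ \<epsilon>], rule conjI[OF \<open>\<epsilon> > 0\<close>], intro allI impI)
    fix P :: "(real \<times> real) set"
    assume P: "finite P \<and> (\<forall>(s, t)\<in>P. a \<le> s \<and> s \<le> t \<and> t \<le> b) \<and>
        pairwise (\<lambda>(s, t) (s', t'). {s<..<t} \<inter> {s'<..<t'} = {}) P \<and> (\<Sum>(s, t)\<in>P. t - s) < \<epsilon>"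
    have "(\<Sum>(s, t)\<in>P. norm (t - s)) = (\<Sum>(s, t)\<in>P. t - s)"
      using P by (intro sum.cong) auto
    then show "(\<Sum>(s, t)\<in>P. norm (t - s)) < \<epsilon>" using P by simp
  qed
qed

lemma onorm_scaleR_vector_le:
  fixes v :: "'a::real_normed_vector"
  assumes "norm v \<le> M"
  shows "onorm (\<lambda>h::real. h *\<^sub>R v) \<le> M"
proof (rule onorm_bound)
  show "0 \<le> M" using assms norm_ge_zero order_trans by blast
  show "norm (h *\<^sub>R v) \<le> M * norm h" for h
    using mult_left_mono[OF assms, of "\<bar>h\<bar>"] by (simp add: mult.commute)
qed

lemma absolutely_continuous_of_bounded_derivative:
  fixes \<phi> :: "real \<Rightarrow> 'b::real_normed_vector"
  assumes "\<And>t. t \<in> {a..b} \<Longrightarrow> (\<phi> has_vector_derivative \<phi>' t) (at t within {a..b})"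
    and "\<And>t. t \<in> {a..b} \<Longrightarrow> norm (\<phi>' t) \<le> B" and "0 \<le> B"
  shows "absolutely_continuous_on_interval a b \<phi>"
proof -
  have "B-lipschitz_on {a..b} \<phi>"
  proof (rule lipschitz_onI)
    show "dist (\<phi> s) (\<phi> t) \<le> B * dist s t" if "s \<in> {a..b}" "t \<in> {a..b}" for s t
      unfolding dist_norm
    proof (rule differentiable_bound[where S = "{a..b}"])
      show "(\<phi> has_derivative (\<lambda>h. h *\<^sub>R \<phi>' t)) (at t within {a..b})" if "t \<in> {a..b}" for t
        using assms(1)[OF that] by (simp add: has_vector_derivative_def)
      show "onorm (\<lambda>h. h *\<^sub>R \<phi>' t) \<le> B" if "t \<in> {a..b}" for t
        using assms(2)[OF that] by (rule onorm_scaleR_vector_le)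
    qed (use that in auto)
  qed (rule assms(3))
  from absolutely_continuous_lipschitz_compose[OF absolutely_continuous_id this] show ?thesis
    by (simp add: o_def)
qed

section \<open>Solutions of Lipschitz differential equations\<close>

text \<open>The time interval is two-sided because the calibration near the initial point of the extremal
  involves negative times.\<close>

lemma picard_lindelof:
  fixes \<Phi> :: "'a::euclidean_space \<Rightarrow> 'a"
  assumes "\<rho> > 0" and Lip: "L-lipschitz_on (cball z0 \<rho>) \<Phi>"
  shows "\<exists>T>0. \<exists>z. z 0 = z0 \<and>
    (\<forall>t\<in>{-T..T}. z t \<in> cball z0 \<rho> \<and> (z has_vector_derivative \<Phi> (z t)) (at t within {-T..T}))"
proof -
  have L0: "L \<ge> 0" using lipschitz_on_nonneg[OF Lip] .
  have cont\<Phi>: "continuous_on (cball z0 \<rho>) \<Phi>" using lipschitz_on_continuous_on[OF Lip] .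
  obtain M where M: "M > 0" "\<And>w. w \<in> cball z0 \<rho> \<Longrightarrow> norm (\<Phi> w) \<le> M"
    using compact_imp_bounded[OF compact_continuous_image[OF cont\<Phi> compact_cball]]
    by (auto simp: bounded_pos)
  define T where "T = min (\<rho> / M) (1 / (2 * (L + 1)))"
  have T: "T > 0" "M * T \<le> \<rho>" "L * T \<le> 1 / 2"
  proof -
    show "T > 0" using \<open>\<rho> > 0\<close> M(1) L0 by (simp add: T_def)
    have "T \<le> \<rho> / M" "T \<le> 1 / (2 * (L + 1))" by (auto simp: T_def)
    then show "M * T \<le> \<rho>" using M(1) by (simp add: field_simps)
    have "(L + 1) * T \<le> 1 / 2" using \<open>T \<le> 1 / (2 * (L + 1))\<close> L0 by (simp add: field_simps)
    then show "L * T \<le> 1 / 2" using \<open>T > 0\<close> by (simp add: algebra_simps)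
  qed
  define I where "I = {-T..T}"
  have I0: "0 \<in> I" using T(1) by (simp add: I_def)
  \<comment> \<open>Functions on \<open>I\<close> are extended to be constant outside, so that the complete space of bounded
    continuous functions on the line can be used. The difference \<open>J f t - J f 0\<close> is the integral
    of \<open>\<Phi> \<circ> f\<close> from \<open>0\<close> to \<open>t\<close> for \<open>t\<close> of either sign.\<close>
  define S where "S = {f :: real \<Rightarrow>\<^sub>C 'a. \<forall>t. apply_bcontfun f t \<in> cball z0 \<rho>}"
  define J where "J = (\<lambda>(f :: real \<Rightarrow>\<^sub>C 'a) t. integral {-T..t} (\<lambda>s. \<Phi> (apply_bcontfun f s)))"
  define P where "P = (\<lambda>(f :: real \<Rightarrow>\<^sub>C 'a) t. z0 + (J f (max (-T) (min T t)) - J f 0))"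
  have clamp: "max (-T) (min T t) \<in> I" "\<bar>max (-T) (min T t)\<bar> \<le> T" for t
    using T(1) by (auto simp: I_def)
  have derJ: "(J f has_vector_derivative \<Phi> (apply_bcontfun f t)) (at t within I)"
    if "f \<in> S" "t \<in> I" for f t
  proof -
    have "continuous_on I (\<lambda>s. \<Phi> (apply_bcontfun f s))"
      using that(1) by (intro continuous_on_compose2[OF cont\<Phi>]) (auto simp: S_def)
    then show ?thesis
      unfolding J_def I_def using integral_has_vector_derivative that(2) by (metis I_def)
  qed
  have Jbound: "norm (J f t - J f 0) \<le> \<rho>" if "f \<in> S" "t \<in> I" for f t
  proof -
    have "norm (J f t - J f 0) \<le> M * norm (t - 0)"
    proof (rule differentiable_bound)
      show "convex I" by (simp add: I_def)
      show "(J f has_derivative (\<lambda>h. h *\<^sub>R \<Phi> (apply_bcontfun f x))) (at x within I)" if "x \<in> I" for x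
        using derJ[OF \<open>f \<in> S\<close> that] by (simp add: has_vector_derivative_def)
      show "onorm (\<lambda>h. h *\<^sub>R \<Phi> (apply_bcontfun f x)) \<le> M" if "x \<in> I" for x
        using M(2)[of "apply_bcontfun f x"] \<open>f \<in> S\<close>
        by (intro onorm_scaleR_vector_le) (auto simp: S_def)
    qed (use that I0 in auto)
    also have "\<dots> \<le> M * T" using that(2) M(1) by (auto simp: I_def)
    finally show ?thesis using T(2) by simp
  qed
  have contr: "norm ((J f t - J f 0) - (J g t - J g 0)) \<le> 1 / 2 * dist f g" if "f \<in> S" "g \<in> S" "t \<in> I" for f g t
  proof -
    have "norm ((J f t - J g t) - (J f 0 - J g 0)) \<le> (L * dist f g) * norm (t - 0)"
    proof (rule differentiable_bound[where S = I])
      show "convex I" by (simp add: I_def)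
      show "((\<lambda>t. J f t - J g t) has_derivative
          (\<lambda>h. h *\<^sub>R (\<Phi> (apply_bcontfun f x) - \<Phi> (apply_bcontfun g x)))) (at x within I)" if "x \<in> I" for x
        using has_vector_derivative_diff[OF derJ[OF \<open>f \<in> S\<close> that] derJ[OF \<open>g \<in> S\<close> that]]
        by (simp add: has_vector_derivative_def)
      have "norm (\<Phi> (apply_bcontfun f x) - \<Phi> (apply_bcontfun g x)) \<le> L * dist f g" for x
      proof -
        have "norm (\<Phi> (apply_bcontfun f x) - \<Phi> (apply_bcontfun g x))
            \<le> L * dist (apply_bcontfun f x) (apply_bcontfun g x)"
          using lipschitz_onD[OF Lip, of "apply_bcontfun f x" "apply_bcontfun g x"] that
          by (simp add: S_def dist_norm)
        also have "\<dots> \<le> L * dist f g"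
          using L0 dist_bounded[of f x g] by (intro mult_left_mono) auto
        finally show ?thesis .
      qed
      then show "onorm (\<lambda>h. h *\<^sub>R (\<Phi> (apply_bcontfun f x) - \<Phi> (apply_bcontfun g x))) \<le> L * dist f g" for x
        by (rule onorm_scaleR_vector_le)
    qed (use that I0 in auto)
    also have "\<dots> \<le> (L * dist f g) * T"
      using that(3) L0 by (intro mult_left_mono) (auto simp: I_def)
    also have "\<dots> \<le> 1 / 2 * dist f g"
      using mult_right_mono[OF T(3), of "dist f g"] by (simp add: algebra_simps)
    finally show ?thesis by (simp add: algebra_simps)
  qed
  have Pcont: "P f \<in> bcontfun" if "f \<in> S" for f
  proof (rule bcontfun_normI)
    have "continuous_on I (J f)"
      unfolding continuous_on_eq_continuous_within
      using derJ[OF that] has_vector_derivative_continuous by blast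
    then have "continuous_on UNIV (\<lambda>t. J f (max (-T) (min T t)))"
      by (rule continuous_on_compose2) (auto intro!: continuous_intros clamp(1))
    then show "continuous_on UNIV (P f)"
      unfolding P_def by (intro continuous_on_add continuous_on_diff continuous_on_const)
    show "norm (P f t) \<le> norm z0 + \<rho>" for t
      unfolding P_def by (rule norm_triangle_le) (simp add: Jbound[OF that clamp(1)])
  qed
  have "\<exists>!f\<in>S. Bcontfun (P f) = f"
  proof (rule Banach_fix[where c = "1/2"])
    have "S = PiC UNIV (\<lambda>_. cball z0 \<rho>)" by (auto simp: S_def mem_PiC_iff Pi_iff)
    then have "closed S" by (simp add: closed_PiC)
    then show "complete S" by (simp add: complete_eq_closed)
    have "const_bcontfun z0 \<in> S" using \<open>\<rho> > 0\<close> by (simp add: S_def)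
    then show "S \<noteq> {}" by blast
    show "(\<lambda>f. Bcontfun (P f)) ` S \<subseteq> S"
    proof clarify
      fix f assume f: "f \<in> S"
      show "Bcontfun (P f) \<in> S"
        using Jbound[OF f clamp(1)]
        unfolding S_def mem_Collect_eq Bcontfun_inverse[OF Pcont[OF f]] by (simp add: P_def dist_norm norm_minus_commute)
    qed
    show "dist (Bcontfun (P f)) (Bcontfun (P g)) \<le> 1 / 2 * dist f g" if "f \<in> S" "g \<in> S" for f g
    proof (rule dist_bound)
      fix t
      have "dist (P f t) (P g t) \<le> 1 / 2 * dist f g"
        using contr[OF that clamp(1)[of t]] by (simp add: P_def dist_norm)
      then show "dist (apply_bcontfun (Bcontfun (P f)) t) (apply_bcontfun (Bcontfun (P g)) t) \<le> 1 / 2 * dist f g"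
        by (simp add: Bcontfun_inverse Pcont that)
    qed
  qed auto
  then obtain f where f: "f \<in> S" "Bcontfun (P f) = f" by blast
  define z where "z = apply_bcontfun f"
  have z: "z t = z0 + (J f (max (-T) (min T t)) - J f 0)" for t
  proof -
    have "z = P f" using Bcontfun_inverse[OF Pcont[OF f(1)]] by (simp add: z_def f(2))
    then show ?thesis by (simp add: P_def)
  qed
  show ?thesis
  proof (intro exI[of _ T] exI[of _ z] conjI ballI)
    show "z 0 = z0" using T(1) by (simp add: z)
    fix t assume t: "t \<in> {-T..T}"
    show "z t \<in> cball z0 \<rho>" using f(1) by (simp add: S_def z_def)
    have "((\<lambda>t. z0 + (J f t - J f 0)) has_vector_derivative \<Phi> (z t)) (at t within {-T..T})"
      using derJ[OF f(1), of t] t by (auto simp: I_def z_def intro!: derivative_eq_intros)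
    then show "(z has_vector_derivative \<Phi> (z t)) (at t within {-T..T})"
      by (rule has_vector_derivative_transform[rotated 2]) (use t in \<open>auto simp: z\<close>)
  qed (rule T(1))
qed

section \<open>Bounded Lipschitz maps and maps of class \<open>C\<^sup>1\<^sup>,\<^sup>1\<close>\<close>

text \<open>Bounded Lipschitz functions. Boundedness is included because it makes the class closed under
  bilinear products.\<close>

definition bdd_lipschitz_on :: "'a::metric_space set \<Rightarrow> ('a \<Rightarrow> 'b::real_normed_vector) \<Rightarrow> bool" where
  "bdd_lipschitz_on S f \<longleftrightarrow> (\<exists>L. L-lipschitz_on S f) \<and> bounded (f ` S)"

lemma bdd_lipschitz_onI:
  assumes "\<And>x. x \<in> S \<Longrightarrow> norm (f x) \<le> B" "0 \<le> L"
    and "\<And>x y. x \<in> S \<Longrightarrow> y \<in> S \<Longrightarrow> norm (f x - f y) \<le> L * dist x y"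
  shows "bdd_lipschitz_on S f"
  unfolding bdd_lipschitz_on_def
proof
  show "\<exists>L. L-lipschitz_on S f"
    using assms(2,3) by (intro exI[of _ L] lipschitz_onI) (auto simp: dist_norm)
  show "bounded (f ` S)"
    using assms(1) by (auto simp: bounded_iff)
qed

lemma bdd_lipschitz_onE:
  assumes "bdd_lipschitz_on S f"
  obtains C where "0 < C" "\<And>x. x \<in> S \<Longrightarrow> norm (f x) \<le> C"
    "\<And>x y. x \<in> S \<Longrightarrow> y \<in> S \<Longrightarrow> norm (f x - f y) \<le> C * dist x y"
proof -
  obtain L B where L: "L-lipschitz_on S f" and B: "B > 0" "\<And>x. x \<in> S \<Longrightarrow> norm (f x) \<le> B"
    using assms by (auto simp: bdd_lipschitz_on_def bounded_pos)
  show ?thesis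
  proof (rule that[of "max L B"])
    show "0 < max L B" using B(1) by simp
    show "norm (f x) \<le> max L B" if "x \<in> S" for x using B(2)[OF that] by simp
    show "norm (f x - f y) \<le> max L B * dist x y" if "x \<in> S" "y \<in> S" for x y
      using lipschitz_onD[OF L that] mult_right_mono[of L "max L B" "dist x y"] by (simp add: dist_norm)
  qed
qed

lemma bdd_lipschitz_on_subset: "bdd_lipschitz_on S f \<Longrightarrow> T \<subseteq> S \<Longrightarrow> bdd_lipschitz_on T f"
  unfolding bdd_lipschitz_on_def by (meson bounded_subset image_mono lipschitz_on_subset)

lemma bdd_lipschitz_on_cong:
  "bdd_lipschitz_on S f \<Longrightarrow> (\<And>x. x \<in> S \<Longrightarrow> f x = g x) \<Longrightarrow> bdd_lipschitz_on S g"
  unfolding bdd_lipschitz_on_def using lipschitz_on_transform by (metis image_cong)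

lemma bdd_lipschitz_on_const: "bdd_lipschitz_on S (\<lambda>x. c)"
  by (rule bdd_lipschitz_onI[of _ _ "norm c" 0]) auto

lemma bdd_lipschitz_on_fst: "bounded S \<Longrightarrow> bdd_lipschitz_on S fst"
  unfolding bdd_lipschitz_on_def
  by (intro conjI exI[of _ 1] lipschitz_onI bounded_fst) (simp_all only: dist_fst_le mult_1 zero_le_one)

lemma bdd_lipschitz_on_snd: "bounded S \<Longrightarrow> bdd_lipschitz_on S snd"
  unfolding bdd_lipschitz_on_def
  by (intro conjI exI[of _ 1] lipschitz_onI bounded_snd) (simp_all only: dist_snd_le mult_1 zero_le_one)

lemma bdd_lipschitz_on_add:
  assumes "bdd_lipschitz_on S f" "bdd_lipschitz_on S g"
  shows "bdd_lipschitz_on S (\<lambda>x. f x + g x)"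
  using assms unfolding bdd_lipschitz_on_def
  by (auto intro: bounded_plus_comp intro!: lipschitz_on_add)

lemma bdd_lipschitz_on_Pair:
  assumes "bdd_lipschitz_on S f" "bdd_lipschitz_on S g"
  shows "bdd_lipschitz_on S (\<lambda>x. (f x, g x))"
proof -
  obtain A B where A: "0 < A" "\<And>x. x \<in> S \<Longrightarrow> norm (f x) \<le> A"
      "\<And>x y. x \<in> S \<Longrightarrow> y \<in> S \<Longrightarrow> norm (f x - f y) \<le> A * dist x y"
    and B: "0 < B" "\<And>x. x \<in> S \<Longrightarrow> norm (g x) \<le> B"
      "\<And>x y. x \<in> S \<Longrightarrow> y \<in> S \<Longrightarrow> norm (g x - g y) \<le> B * dist x y"
    using assms by (metis bdd_lipschitz_onE)
  have le: "norm (a, b) \<le> norm a + norm b" for a :: 'b and b :: 'c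
    using norm_Pair_le by blast
  show ?thesis
  proof (rule bdd_lipschitz_onI)
    show "norm (f x, g x) \<le> A + B" if "x \<in> S" for x
      using le[of "f x" "g x"] A(2) B(2) that by (smt (verit))
    show "norm ((f x, g x) - (f y, g y)) \<le> (A + B) * dist x y" if "x \<in> S" "y \<in> S" for x y
      using le[of "f x - f y" "g x - g y"] A(3)[OF that] B(3)[OF that] by (simp add: distrib_right)
  qed (use A B in auto)
qed

lemma (in bounded_bilinear) bdd_lipschitz_on:
  assumes "bdd_lipschitz_on S f" "bdd_lipschitz_on S g"
  shows "bdd_lipschitz_on S (\<lambda>x. prod (f x) (g x))"
proof -
  obtain A B where A: "0 < A" "\<And>x. x \<in> S \<Longrightarrow> norm (f x) \<le> A"
      "\<And>x y. x \<in> S \<Longrightarrow> y \<in> S \<Longrightarrow> norm (f x - f y) \<le> A * dist x y"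
    and B: "0 < B" "\<And>x. x \<in> S \<Longrightarrow> norm (g x) \<le> B"
      "\<And>x y. x \<in> S \<Longrightarrow> y \<in> S \<Longrightarrow> norm (g x - g y) \<le> B * dist x y"
    using assms by (metis bdd_lipschitz_onE)
  obtain K where K: "K > 0" "\<And>a b. norm (prod a b) \<le> norm a * norm b * K"
    using pos_bounded by blast
  have est: "norm (prod a b) \<le> c * d * K" if "norm a \<le> c" "norm b \<le> d" for a b c d
  proof -
    have "0 \<le> c" using that(1) norm_ge_zero order_trans by blast
    then have "norm a * norm b * K \<le> c * d * K"
      using that K(1) by (intro mult_mono mult_right_mono) auto
    then show ?thesis using K(2) order_trans by blast
  qed
  show ?thesis
  proof (rule bdd_lipschitz_onI)
    show "norm (prod (f x) (g x)) \<le> A * B * K" if "x \<in> S" for x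
      using est A(2) B(2) that by blast
    show "norm (prod (f x) (g x) - prod (f y) (g y)) \<le> (2 * A * B * K) * dist x y" if "x \<in> S" "y \<in> S" for x y
    proof -
      have "prod (f x) (g x) - prod (f y) (g y) = prod (f x - f y) (g x) + prod (f y) (g x - g y)"
        by (simp add: diff_left diff_right)
      also have "norm \<dots> \<le> (A * dist x y) * B * K + A * (B * dist x y) * K"
        using that by (intro norm_triangle_mono est A B)
      finally show ?thesis by (simp add: algebra_simps)
    qed
  qed (use A B K in auto)
qed

lemmas bdd_lipschitz_on_scaleR = bounded_bilinear.bdd_lipschitz_on[OF bounded_bilinear_scaleR]
lemmas bdd_lipschitz_on_inner = bounded_bilinear.bdd_lipschitz_on[OF bounded_bilinear_inner]

lemma bdd_lipschitz_on_sum: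
  assumes "finite I" "\<And>i. i \<in> I \<Longrightarrow> bdd_lipschitz_on S (f i)"
  shows "bdd_lipschitz_on S (\<lambda>x. \<Sum>i\<in>I. f i x)"
  using assms
  by (induction I rule: finite_induct) (auto intro: bdd_lipschitz_on_const bdd_lipschitz_on_add)

lemma bdd_lipschitz_on_compose:
  assumes "bdd_lipschitz_on T g" "bdd_lipschitz_on S f" "f ` S \<subseteq> T"
  shows "bdd_lipschitz_on S (\<lambda>x. g (f x))"
proof -
  obtain A where A: "0 < A" "\<And>x. x \<in> T \<Longrightarrow> norm (g x) \<le> A"
      "\<And>x y. x \<in> T \<Longrightarrow> y \<in> T \<Longrightarrow> norm (g x - g y) \<le> A * dist x y"
    using assms by (metis bdd_lipschitz_onE)
  obtain B where B: "0 < B" "\<And>x y. x \<in> S \<Longrightarrow> y \<in> S \<Longrightarrow> norm (f x - f y) \<le> B * dist x y"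
    using assms by (metis bdd_lipschitz_onE)
  show ?thesis
  proof (rule bdd_lipschitz_onI)
    show "norm (g (f x)) \<le> A" if "x \<in> S" for x
      using A(2) assms(3) that by blast
    show "norm (g (f x) - g (f y)) \<le> (A * B) * dist x y" if "x \<in> S" "y \<in> S" for x y
    proof -
      have "norm (g (f x) - g (f y)) \<le> A * dist (f x) (f y)"
        using A(3) assms(3) that by blast
      also have "\<dots> \<le> A * (B * dist x y)"
        using B(2)[OF that] A(1) by (intro mult_left_mono) (auto simp: dist_norm)
      finally show ?thesis by simp
    qed
  qed (use A B in auto)
qed

lemma bdd_lipschitz_on_inverse_atLeast:
  fixes c :: real
  assumes "0 < c"
  shows "bdd_lipschitz_on {c..} (\<lambda>t. inverse t)"
proof (rule bdd_lipschitz_onI)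
  show "norm (inverse x) \<le> inverse c" if "x \<in> {c..}" for x
    using that assms by (auto intro: le_imp_inverse_le)
  show "norm (inverse x - inverse y) \<le> (inverse c * inverse c) * dist x y" if "x \<in> {c..}" "y \<in> {c..}" for x y
  proof -
    have xy: "x > 0" "y > 0" "inverse x \<le> inverse c" "inverse y \<le> inverse c"
      using that assms by (auto intro: le_imp_inverse_le)
    have "inverse x - inverse y = (inverse x * inverse y) * (y - x)"
      using xy by (simp add: field_simps)
    then have "norm (inverse x - inverse y) = (inverse x * inverse y) * dist x y"
      using xy by (simp add: abs_mult dist_real_def abs_minus_commute)
    also have "\<dots> \<le> (inverse c * inverse c) * dist x y"
      using xy assms by (intro mult_right_mono mult_mono) auto
    finally show ?thesis .
  qed
qed (use assms in auto)

lemma bdd_lipschitz_on_sqrt: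
  fixes c C :: real
  assumes "0 < c"
  shows "bdd_lipschitz_on {c..C} sqrt"
proof (rule bdd_lipschitz_onI)
  show "norm (sqrt x) \<le> sqrt C" if "x \<in> {c..C}" for x
    using that assms by auto
  show "norm (sqrt x - sqrt y) \<le> inverse (sqrt c) * dist x y" if "x \<in> {c..C}" "y \<in> {c..C}" for x y
  proof -
    have xy: "x > 0" "y > 0" "sqrt c \<le> sqrt x + sqrt y"
      using that assms by (auto intro: add_increasing2)
    have "(sqrt x - sqrt y) * (sqrt x + sqrt y) = x - y"
      using xy by (simp add: algebra_simps)
    then have "\<bar>sqrt x - sqrt y\<bar> * \<bar>sqrt x + sqrt y\<bar> = \<bar>x - y\<bar>"
      by (metis abs_mult)
    moreover have "\<bar>sqrt x - sqrt y\<bar> * sqrt c \<le> \<bar>sqrt x - sqrt y\<bar> * \<bar>sqrt x + sqrt y\<bar>"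
      using xy by (intro mult_left_mono) auto
    ultimately show ?thesis using assms by (simp add: field_simps dist_real_def)
  qed
qed (use assms in auto)

lemma locally_Lipschitz_on_iff:
  "locally_Lipschitz_on S f \<longleftrightarrow> (\<forall>x\<in>S. \<exists>r>0. bdd_lipschitz_on (ball x r \<inter> S) f)"
proof
  assume L: "locally_Lipschitz_on S f"
  show "\<forall>x\<in>S. \<exists>r>0. bdd_lipschitz_on (ball x r \<inter> S) f"
  proof
    fix x assume x: "x \<in> S"
    then obtain r L where r: "r > 0" "L-lipschitz_on (ball x r \<inter> S) f"
      using L by (auto simp: locally_Lipschitz_on_def)
    have L0: "L \<ge> 0" using r(2) lipschitz_on_nonneg by blast
    have "bdd_lipschitz_on (ball x r \<inter> S) f"
    proof (rule bdd_lipschitz_onI[OF _ L0])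
      fix y assume y: "y \<in> ball x r \<inter> S"
      have "dist (f y) (f x) \<le> L * dist y x"
        using lipschitz_onD[OF r(2), of y x] x y r(1) by auto
      also have "\<dots> \<le> L * r" using L0 y by (intro mult_left_mono) (auto simp: dist_commute)
      finally show "norm (f y) \<le> norm (f x) + L * r"
        using norm_triangle_sub[of "f y" "f x"] by (simp add: dist_norm)
    qed (use lipschitz_onD[OF r(2)] in \<open>simp add: dist_norm\<close>)
    then show "\<exists>r>0. bdd_lipschitz_on (ball x r \<inter> S) f" using r(1) by blast
  qed
qed (unfold bdd_lipschitz_on_def locally_Lipschitz_on_def, blast)

lemma locally_Lipschitz_on_cong:
  fixes f g :: "'a::metric_space \<Rightarrow> 'b::real_normed_vector"
  shows "locally_Lipschitz_on S f \<Longrightarrow> (\<And>x. x \<in> S \<Longrightarrow> f x = g x) \<Longrightarrow> locally_Lipschitz_on S g"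
  unfolding locally_Lipschitz_on_iff by (blast intro: bdd_lipschitz_on_cong)

lemma locally_Lipschitz_on_const: "locally_Lipschitz_on S (\<lambda>x. c :: 'b::real_normed_vector)"
  unfolding locally_Lipschitz_on_iff by (auto intro!: exI[of _ 1] bdd_lipschitz_on_const)

lemma locally_Lipschitz_on_add:
  fixes f g :: "'a::metric_space \<Rightarrow> 'b::real_normed_vector"
  assumes "locally_Lipschitz_on S f" "locally_Lipschitz_on S g"
  shows "locally_Lipschitz_on S (\<lambda>x. f x + g x)"
  unfolding locally_Lipschitz_on_iff
proof
  fix x assume "x \<in> S"
  then obtain r s where "r > 0" "bdd_lipschitz_on (ball x r \<inter> S) f" "s > 0" "bdd_lipschitz_on (ball x s \<inter> S) g"
    using assms unfolding locally_Lipschitz_on_iff by blast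
  then show "\<exists>r>0. bdd_lipschitz_on (ball x r \<inter> S) (\<lambda>x. f x + g x)"
    by (intro exI[of _ "min r s"] conjI bdd_lipschitz_on_add) (auto elim!: bdd_lipschitz_on_subset)
qed

lemma (in bounded_bilinear) locally_Lipschitz_on:
  assumes "locally_Lipschitz_on S f" "locally_Lipschitz_on S g"
  shows "locally_Lipschitz_on S (\<lambda>x. prod (f x) (g x))"
  unfolding locally_Lipschitz_on_iff
proof
  fix x assume "x \<in> S"
  then obtain r s where "r > 0" "bdd_lipschitz_on (ball x r \<inter> S) f" "s > 0" "bdd_lipschitz_on (ball x s \<inter> S) g"
    using assms unfolding locally_Lipschitz_on_iff by blast
  then show "\<exists>r>0. bdd_lipschitz_on (ball x r \<inter> S) (\<lambda>x. prod (f x) (g x))"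
    by (intro exI[of _ "min r s"] conjI bdd_lipschitz_on) (auto elim!: bdd_lipschitz_on_subset)
qed

lemma locally_Lipschitz_imp_continuous_on:
  assumes "locally_Lipschitz_on S f"
  shows "continuous_on S f"
  unfolding continuous_on_eq_continuous_within
proof
  fix x assume x: "x \<in> S"
  then obtain r L where r: "r > 0" "L-lipschitz_on (ball x r \<inter> S) f"
    using assms by (auto simp: locally_Lipschitz_on_def)
  then have "continuous (at x within (ball x r \<inter> S)) f"
    using lipschitz_on_continuous_within x by fastforce
  moreover have "at x within (ball x r \<inter> S) = at x within S"
    by (rule at_within_nhd[of x "ball x r"]) (use r(1) in auto)
  ultimately show "continuous (at x within S) f"
    by (simp add: continuous_within)
qed

lemma locally_Lipschitz_on_inverse_sqrt:
  fixes f :: "'a::metric_space \<Rightarrow> real"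
  assumes f: "locally_Lipschitz_on S f" and pos: "\<And>x. x \<in> S \<Longrightarrow> f x > 0"
  shows "locally_Lipschitz_on S (\<lambda>x. inverse (sqrt (f x)))"
  unfolding locally_Lipschitz_on_iff
proof
  fix x assume x: "x \<in> S"
  then obtain r where r: "r > 0" "bdd_lipschitz_on (ball x r \<inter> S) f"
    using f unfolding locally_Lipschitz_on_iff by blast
  define c where "c = f x / 2"
  have c: "c > 0" using pos[OF x] by (simp add: c_def)
  have "continuous (at x within S) f"
    using locally_Lipschitz_imp_continuous_on[OF f] x by (auto simp: continuous_on_eq_continuous_within)
  then obtain d where d: "d > 0" "\<And>y. y \<in> S \<Longrightarrow> dist y x < d \<Longrightarrow> dist (f y) (f x) < c"
    using c unfolding continuous_within_eps_delta by blast
  have range: "f ` (ball x (min r d) \<inter> S) \<subseteq> {c..3 * c}"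
  proof clarsimp
    fix y assume "dist x y < d" "y \<in> S"
    then have "\<bar>f y - f x\<bar> < c" using d(2)[of y] by (simp add: dist_commute dist_real_def)
    moreover have "f x = 2 * c" by (simp add: c_def)
    ultimately show "c \<le> f y \<and> f y \<le> 3 * c" by linarith
  qed
  have "bdd_lipschitz_on (ball x (min r d) \<inter> S) (\<lambda>x. sqrt (f x))"
    by (rule bdd_lipschitz_on_compose[OF bdd_lipschitz_on_sqrt[OF c] bdd_lipschitz_on_subset[OF r(2)] range]) auto
  from bdd_lipschitz_on_compose[OF bdd_lipschitz_on_inverse_atLeast[of "sqrt c"] this]
  have "bdd_lipschitz_on (ball x (min r d) \<inter> S) (\<lambda>x. inverse (sqrt (f x)))"
    using c range by (fastforce simp: image_subset_iff)
  then show "\<exists>r>0. bdd_lipschitz_on (ball x r \<inter> S) (\<lambda>x. inverse (sqrt (f x)))"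
    using r(1) d(1) by (intro exI[of _ "min r d"]) auto
qed

text \<open>A description that does not mention \<^const>\<open>frechet_derivative\<close>: local Lipschitz continuity of the
  derivative already gives its continuity.\<close>

lemma C11_on_iff:
  "C11_on S f \<longleftrightarrow>
     (\<exists>D. (\<forall>x\<in>S. (f has_derivative D x) (at x)) \<and> (\<forall>v. locally_Lipschitz_on S (\<lambda>x. D x v)))"
proof
  assume "C11_on S f"
  then show "\<exists>D. (\<forall>x\<in>S. (f has_derivative D x) (at x)) \<and> (\<forall>v. locally_Lipschitz_on S (\<lambda>x. D x v))"
    by (intro exI[of _ "\<lambda>x. frechet_derivative f (at x)"])
      (auto simp: C11_on_def frechet_derivative_works[symmetric])
next
  assume "\<exists>D. (\<forall>x\<in>S. (f has_derivative D x) (at x)) \<and> (\<forall>v. locally_Lipschitz_on S (\<lambda>x. D x v))"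
  then obtain D where D: "\<And>x. x \<in> S \<Longrightarrow> (f has_derivative D x) (at x)"
    "\<And>v. locally_Lipschitz_on S (\<lambda>x. D x v)" by blast
  have "frechet_derivative f (at x) = D x" if "x \<in> S" for x
    using D(1)[OF that] by (metis frechet_derivative_at)
  then have L: "locally_Lipschitz_on S (\<lambda>x. frechet_derivative f (at x) v)" for v
    by (intro locally_Lipschitz_on_cong[OF D(2)[of v]]) simp
  then show "C11_on S f"
    using D(1) locally_Lipschitz_imp_continuous_on[OF L]
    by (auto simp: C11_on_def differentiable_def)
qed

lemma locally_Lipschitz_on_eventually:
  assumes "locally_Lipschitz_on S f" "open S" "x \<in> S"
  shows "\<forall>\<^sub>F r in at_right 0. ball x r \<subseteq> S \<and> bdd_lipschitz_on (ball x r) f"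
proof -
  obtain r where r: "r > 0" "bdd_lipschitz_on (ball x r \<inter> S) f"
    using assms unfolding locally_Lipschitz_on_iff by blast
  obtain s where s: "s > 0" "ball x s \<subseteq> S"
    using assms open_contains_ball by blast
  show ?thesis
    unfolding eventually_at_right_field
  proof (intro exI[of _ "min r s"] conjI allI impI)
    fix t assume "0 < t" "t < min r s"
    then have "ball x t \<subseteq> ball x r" "ball x t \<subseteq> ball x s" by auto
    then show "ball x t \<subseteq> S" "bdd_lipschitz_on (ball x t) f"
      using s(2) by (auto intro: bdd_lipschitz_on_subset[OF r(2)])
  qed (use r s in auto)
qed

text \<open>On \<open>B\<close> the map \<open>f\<close> has derivative \<open>D\<close>, and \<open>L\<close> bounds \<open>f\<close> and \<open>D\<close> and is a Lipschitz constant
  of \<open>D\<close>, in operator norm.\<close>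

definition C11_bounds :: "'e::euclidean_space set \<Rightarrow> real \<Rightarrow> ('e \<Rightarrow> 'f::euclidean_space) \<Rightarrow> ('e \<Rightarrow> 'e \<Rightarrow> 'f) \<Rightarrow> bool"
  where "C11_bounds B L f D \<longleftrightarrow> 0 \<le> L \<and> (\<forall>x\<in>B. (f has_derivative D x) (at x) \<and> norm (f x) \<le> L \<and>
     (\<forall>v. norm (D x v) \<le> L * norm v) \<and>
     (\<forall>y\<in>B. \<forall>v. norm (D x v - D y v) \<le> L * norm v * norm (x - y)))"

lemma C11_bounds_mono:
  assumes "C11_bounds B L f D" "B' \<subseteq> B" "L \<le> L'"
  shows "C11_bounds B' L' f D"
proof -
  have "a * b * c \<le> a' * b * c" if "a \<le> a'" "0 \<le> b" "0 \<le> c" for a a' b c :: real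
    using that by (intro mult_right_mono)
  moreover have "a * b \<le> a' * b" if "a \<le> a'" "0 \<le> b" for a a' b :: real
    using that by (intro mult_right_mono)
  ultimately show ?thesis
    using assms unfolding C11_bounds_def by (smt (verit) norm_ge_zero subsetD)
qed

lemma C11_bounds_lipschitz:
  assumes "C11_bounds B L f D" "convex B" "x \<in> B" "y \<in> B"
  shows "norm (f x - f y) \<le> L * norm (x - y)"
proof (rule differentiable_bound[OF assms(2)])
  show "(f has_derivative D x) (at x within B)" if "x \<in> B" for x
    using assms(1) that by (auto simp: C11_bounds_def intro: has_derivative_at_withinI)
  show "onorm (D x) \<le> L" if "x \<in> B" for x
    using assms(1) that by (auto simp: C11_bounds_def intro: onorm_bound)
qed (use assms in auto)

lemma C11_bounds_taylor:
  assumes "C11_bounds B L f D" "convex B" "x \<in> B" "y \<in> B"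
  shows "norm (f y - f x - D x (y - x)) \<le> L * (norm (y - x))\<^sup>2"
proof -
  have L0: "0 \<le> L" using assms by (auto simp: C11_bounds_def)
  have seg: "closed_segment x y \<subseteq> B" using assms by (simp add: closed_segment_subset)
  define h where "h = (\<lambda>z. f z - D x (z - x))"
  have lin: "bounded_linear (D x)"
    using assms(1,3) by (auto simp: C11_bounds_def has_derivative_bounded_linear)
  have "norm (h y - h x) \<le> (L * norm (y - x)) * norm (y - x)"
  proof (rule differentiable_bound[where S = "closed_segment x y"])
    fix z assume z: "z \<in> closed_segment x y"
    then have zB: "z \<in> B" using seg by auto
    have Dx: "((\<lambda>z. D x (z - x)) has_derivative D x) (at z)"
      using lin by (auto intro!: derivative_eq_intros bounded_linear.has_derivative[OF lin])
    have "(f has_derivative D z) (at z)"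
      using assms(1) zB by (auto simp: C11_bounds_def)
    from has_derivative_at_withinI[OF has_derivative_diff[OF this Dx]]
    show "(h has_derivative (\<lambda>v. D z v - D x v)) (at z within closed_segment x y)"
      unfolding h_def .
    have "norm (D z v - D x v) \<le> (L * norm (y - x)) * norm v" for v
    proof -
      have "norm (D z v - D x v) \<le> L * norm v * norm (z - x)"
        using assms(1,3) zB by (auto simp: C11_bounds_def)
      also have "\<dots> \<le> L * norm v * norm (y - x)"
        using L0 segment_bound(1)[OF z] by (intro mult_left_mono) auto
      finally show ?thesis by (simp add: mult_ac)
    qed
    then show "onorm (\<lambda>v. D z v - D x v) \<le> L * norm (y - x)"
      using L0 by (intro onorm_bound) auto
  qed auto
  moreover have "h y - h x = f y - f x - D x (y - x)"
    using linear_0[OF bounded_linear.linear[OF lin]] by (simp add: h_def)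
  ultimately show ?thesis by (simp add: power2_eq_square)
qed

lemma linear_eq_sum_Basis:
  fixes T :: "'e::euclidean_space \<Rightarrow> 'f::real_vector"
  assumes "linear T"
  shows "T v = (\<Sum>b\<in>Basis. (v \<bullet> b) *\<^sub>R T b)"
  using linear_sum[OF assms, of "\<lambda>b. (v \<bullet> b) *\<^sub>R b" Basis]
  by (simp add: euclidean_representation linear_cmul[OF assms])

lemma C11_on_bounds:
  fixes f :: "'e::euclidean_space \<Rightarrow> 'f::euclidean_space"
  assumes "C11_on S f" "open S" "x0 \<in> S"
  shows "\<exists>R>0. \<exists>L. \<exists>D. ball x0 R \<subseteq> S \<and> C11_bounds (ball x0 R) L f D"
proof -
  obtain D where D: "\<And>x. x \<in> S \<Longrightarrow> (f has_derivative D x) (at x)"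
    "\<And>v. locally_Lipschitz_on S (\<lambda>x. D x v)" using assms(1) unfolding C11_on_iff by blast
  have "\<forall>\<^sub>F r in at_right 0. \<forall>b\<in>Basis. ball x0 r \<subseteq> S \<and> bdd_lipschitz_on (ball x0 r) (\<lambda>x. D x b)"
    by (intro eventually_ball_finite ballI locally_Lipschitz_on_eventually D(2) assms(2,3)) auto
  then have "\<forall>\<^sub>F r in at_right 0. 0 < r \<and> (\<forall>b\<in>Basis. ball x0 r \<subseteq> S \<and> bdd_lipschitz_on (ball x0 r) (\<lambda>x. D x b))"
    using eventually_at_right_less eventually_conj by blast
  then obtain R where R: "R > 0" "\<And>b. b \<in> Basis \<Longrightarrow> ball x0 R \<subseteq> S \<and> bdd_lipschitz_on (ball x0 R) (\<lambda>x. D x b)"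
    using eventually_happens[of _ "at_right (0::real)"] trivial_limit_at_right_real by blast
  obtain b0 :: 'e where "b0 \<in> Basis" using nonempty_Basis by blast
  then have sub: "ball x0 R \<subseteq> S" using R(2) by blast
  obtain C where C: "\<And>b. b \<in> Basis \<Longrightarrow> 0 < C b"
    "\<And>b x. b \<in> Basis \<Longrightarrow> x \<in> ball x0 R \<Longrightarrow> norm (D x b) \<le> C b"
    "\<And>b x y. b \<in> Basis \<Longrightarrow> x \<in> ball x0 R \<Longrightarrow> y \<in> ball x0 R \<Longrightarrow> norm (D x b - D y b) \<le> C b * dist x y"
  proof -
    have "\<forall>b\<in>Basis. \<exists>c. 0 < c \<and> (\<forall>x\<in>ball x0 R. norm (D x b) \<le> c) \<and>
        (\<forall>x\<in>ball x0 R. \<forall>y\<in>ball x0 R. norm (D x b - D y b) \<le> c * dist x y)"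
    proof
      fix b :: 'e assume "b \<in> Basis"
      then have "bdd_lipschitz_on (ball x0 R) (\<lambda>x. D x b)" using R(2) by blast
      then show "\<exists>c. 0 < c \<and> (\<forall>x\<in>ball x0 R. norm (D x b) \<le> c) \<and>
          (\<forall>x\<in>ball x0 R. \<forall>y\<in>ball x0 R. norm (D x b - D y b) \<le> c * dist x y)"
        by (rule bdd_lipschitz_onE) blast
    qed
    from bchoice[OF this] show ?thesis using that by blast
  qed
  define M where "M = (\<Sum>b\<in>Basis. C b)"
  have M0: "0 \<le> M" unfolding M_def using C(1) by (intro sum_nonneg) (simp add: less_imp_le)
  have lin: "linear (D x)" if "x \<in> ball x0 R" for x
    using D(1) sub that by (meson has_derivative_linear subsetD)
  have bd: "norm (T v) \<le> (\<Sum>b\<in>Basis. K b) * norm v" if "linear T" "\<And>b. b \<in> Basis \<Longrightarrow> norm (T b) \<le> K b" for T :: "'e \<Rightarrow> 'f" and K v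
  proof -
    have "norm (T v) \<le> (\<Sum>b\<in>Basis. \<bar>v \<bullet> b\<bar> * norm (T b))"
      by (subst linear_eq_sum_Basis[OF that(1)]) (rule order_trans[OF norm_sum], simp)
    also have "\<dots> \<le> (\<Sum>b\<in>Basis. norm v * K b)"
      using that(2) by (intro sum_mono mult_mono) (auto simp: Basis_le_norm)
    finally show ?thesis by (simp add: sum_distrib_left mult.commute)
  qed
  have b1: "norm (D x v) \<le> M * norm v" if "x \<in> ball x0 R" for x v
    unfolding M_def using bd[OF lin[OF that]] C(2)[OF _ that] by blast
  have b2: "norm (D x v - D y v) \<le> M * norm v * norm (x - y)" if "x \<in> ball x0 R" "y \<in> ball x0 R" for x y v
  proof -
    have "norm (D x v - D y v) \<le> (\<Sum>b\<in>Basis. C b * dist x y) * norm v"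
      by (rule bd[OF linear_compose_sub[OF lin[OF that(1)] lin[OF that(2)]]]) (rule C(3)[OF _ that])
    then show ?thesis by (simp add: M_def sum_distrib_right[symmetric] dist_norm mult_ac)
  qed
  have b3: "norm (f x) \<le> norm (f x0) + M * R" if x: "x \<in> ball x0 R" for x
  proof -
    have "norm (f x - f x0) \<le> M * norm (x - x0)"
    proof (rule differentiable_bound[OF convex_ball])
      show "(f has_derivative D z) (at z within ball x0 R)" if "z \<in> ball x0 R" for z
        using has_derivative_at_withinI[OF D(1)] sub that by blast
      show "onorm (D z) \<le> M" if "z \<in> ball x0 R" for z
        using b1[OF that] M0 by (intro onorm_bound) auto
    qed (use x R in auto)
    also have "\<dots> \<le> M * R" using x M0 by (intro mult_left_mono) (auto simp: dist_norm norm_minus_commute)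
    finally show ?thesis using norm_triangle_sub[of "f x" "f x0"] by simp
  qed
  define L where "L = max M (norm (f x0) + M * R)"
  have "C11_bounds (ball x0 R) L f D"
    unfolding C11_bounds_def
  proof (intro conjI ballI allI)
    show "0 \<le> L" using M0 by (simp add: L_def)
    fix x assume x: "x \<in> ball x0 R"
    show "(f has_derivative D x) (at x)" using D(1) sub x by blast
    show "norm (f x) \<le> L" using b3[OF x] by (simp add: L_def)
    show "norm (D x v) \<le> L * norm v" for v
      using b1[OF x, of v] mult_right_mono[of M L "norm v"] by (simp add: L_def)
    fix y v assume y: "y \<in> ball x0 R"
    show "norm (D x v - D y v) \<le> L * norm v * norm (x - y)"
      using b2[OF x y, of v] mult_right_mono[of M L "norm v * norm (x - y)"] by (simp add: L_def mult_ac)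
  qed
  then show ?thesis using R(1) sub by blast
qed

lemma C11_on_imp_locally_Lipschitz_on:
  fixes f :: "'e::euclidean_space \<Rightarrow> 'f::euclidean_space"
  assumes "C11_on S f" "open S"
  shows "locally_Lipschitz_on S f"
  unfolding locally_Lipschitz_on_def
proof
  fix x assume "x \<in> S"
  then obtain R L D where R: "R > 0" "ball x R \<subseteq> S" "C11_bounds (ball x R) L f D"
    using C11_on_bounds[OF assms] by blast
  then have "L-lipschitz_on (ball x R \<inter> S) f"
    using C11_bounds_lipschitz[OF R(3) convex_ball]
    by (intro lipschitz_onI) (auto simp: dist_norm C11_bounds_def)
  then show "\<exists>r>0. \<exists>L. L-lipschitz_on (ball x r \<inter> S) f" using R(1) by blast
qed

lemma C11_on_const: "C11_on S (\<lambda>x. c)"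
  unfolding C11_on_iff by (intro exI[of _ "\<lambda>x v. 0"]) (auto intro: locally_Lipschitz_on_const)

lemma C11_on_add:
  assumes "C11_on S f" "C11_on S g"
  shows "C11_on S (\<lambda>x. f x + g x)"
proof -
  obtain D E where D: "\<And>x. x \<in> S \<Longrightarrow> (f has_derivative D x) (at x)"
    "\<And>v. locally_Lipschitz_on S (\<lambda>x. D x v)" and
    E: "\<And>x. x \<in> S \<Longrightarrow> (g has_derivative E x) (at x)"
    "\<And>v. locally_Lipschitz_on S (\<lambda>x. E x v)"
    using assms unfolding C11_on_iff by blast
  show ?thesis
    unfolding C11_on_iff
    by (intro exI[of _ "\<lambda>x v. D x v + E x v"])
      (auto intro!: has_derivative_add locally_Lipschitz_on_add D E)
qed

lemma C11_on_scaleR: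
  fixes f :: "'e::euclidean_space \<Rightarrow> real" and g :: "'e \<Rightarrow> 'f::euclidean_space"
  assumes "C11_on S f" "C11_on S g" "open S"
  shows "C11_on S (\<lambda>x. f x *\<^sub>R g x)"
proof -
  obtain D E where D: "\<And>x. x \<in> S \<Longrightarrow> (f has_derivative D x) (at x)"
    "\<And>v. locally_Lipschitz_on S (\<lambda>x. D x v)" and
    E: "\<And>x. x \<in> S \<Longrightarrow> (g has_derivative E x) (at x)"
    "\<And>v. locally_Lipschitz_on S (\<lambda>x. E x v)"
    using assms unfolding C11_on_iff by blast
  note lip = C11_on_imp_locally_Lipschitz_on[OF assms(1,3)] C11_on_imp_locally_Lipschitz_on[OF assms(2,3)]
  show ?thesis
    unfolding C11_on_iff
    by (intro exI[of _ "\<lambda>x v. f x *\<^sub>R E x v + D x v *\<^sub>R g x"])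
      (auto intro!: has_derivative_scaleR locally_Lipschitz_on_add D E
        bounded_bilinear.locally_Lipschitz_on[OF bounded_bilinear_scaleR] lip)
qed

lemma C11_on_inverse_sqrt:
  fixes f :: "'e::euclidean_space \<Rightarrow> real"
  assumes f: "C11_on S f" and "open S" and pos: "\<And>x. x \<in> S \<Longrightarrow> f x > 0"
  shows "C11_on S (\<lambda>x. inverse (sqrt (f x)))"
proof -
  obtain D where D: "\<And>x. x \<in> S \<Longrightarrow> (f has_derivative D x) (at x)"
    "\<And>v. locally_Lipschitz_on S (\<lambda>x. D x v)"
    using f unfolding C11_on_iff by blast
  define k where "k = (\<lambda>x. inverse (sqrt (f x)))"
  have k: "locally_Lipschitz_on S k"
    unfolding k_def
    by (intro locally_Lipschitz_on_inverse_sqrt C11_on_imp_locally_Lipschitz_on assms)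
  note mult = bounded_bilinear.locally_Lipschitz_on[OF bounded_bilinear_mult]
  have "(k has_derivative (\<lambda>v. (- 1 / 2) * (k x * (k x * (k x * D x v))))) (at x)" if "x \<in> S" for x
  proof -
    have "((\<lambda>t. inverse (sqrt t)) has_real_derivative (- 1 / 2) * (k x * (k x * k x))) (at (f x))"
      by (rule DERIV_cong[OF DERIV_inverse'[OF DERIV_real_sqrt]]) (use pos[OF that] in \<open>auto simp: k_def\<close>)
    from has_derivative_compose[OF D(1)[OF that] this[unfolded has_field_derivative_def]]
    show ?thesis by (simp add: k_def mult.assoc)
  qed
  moreover have "locally_Lipschitz_on S (\<lambda>x. (- 1 / 2) * (k x * (k x * (k x * D x v))))" for v
    by (rule mult[OF locally_Lipschitz_on_const mult[OF k mult[OF k mult[OF k D(2)]]]])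
  ultimately have "C11_on S k"
    unfolding C11_on_iff
    by (intro exI[of _ "\<lambda>x v. (- 1 / 2) * (k x * (k x * (k x * D x v)))"] conjI ballI allI)
  then show ?thesis by (simp add: k_def)
qed

section \<open>Orthonormal frames\<close>

lemma span_image_lessThan_iff:
  fixes e :: "nat \<Rightarrow> 'v::real_vector"
  shows "v \<in> span (e ` {..<k}) \<longleftrightarrow> (\<exists>c. v = (\<Sum>i<k. c i *\<^sub>R e i))"
proof
  show "v \<in> span (e ` {..<k}) \<Longrightarrow> \<exists>c. v = (\<Sum>i<k. c i *\<^sub>R e i)"
  proof (induction k arbitrary: v)
    case (Suc k)
    then have "v \<in> span (insert (e k) (e ` {..<k}))" by (simp add: lessThan_Suc)
    then obtain a where "v - a *\<^sub>R e k \<in> span (e ` {..<k})" by (auto simp: span_breakdown_eq)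
    from Suc.IH[OF this] obtain c where c: "v - a *\<^sub>R e k = (\<Sum>i<k. c i *\<^sub>R e i)" by blast
    have "(\<Sum>i<k. (c(k := a)) i *\<^sub>R e i) = (\<Sum>i<k. c i *\<^sub>R e i)" by (intro sum.cong) auto
    then have "v = (\<Sum>i<Suc k. (c(k := a)) i *\<^sub>R e i)" using c by (simp add: algebra_simps)
    then show ?case by blast
  qed simp
next
  assume "\<exists>c. v = (\<Sum>i<k. c i *\<^sub>R e i)"
  then obtain c where "v = (\<Sum>i<k. c i *\<^sub>R e i)" by blast
  then show "v \<in> span (e ` {..<k})"
    by (simp only:) (intro span_sum span_scale span_base, simp)
qed

lemma sum_fun_apply: "(\<Sum>i\<in>I. f i) x = (\<Sum>i\<in>I. f i x)" for f :: "'i \<Rightarrow> 'a \<Rightarrow> 'b::comm_monoid_add"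
  by (induction I rule: infinite_finite_induct) auto

context
  fixes V :: "'v::real_vector set" and g :: "'v \<Rightarrow> 'v \<Rightarrow> real"
  assumes V: "subspace V" and g: "inner_product_on V g"
begin

lemma inner_product_on_sym: "u \<in> V \<Longrightarrow> v \<in> V \<Longrightarrow> g u v = g v u"
  using g by (auto simp: inner_product_on_def)

lemma inner_product_on_add: "u \<in> V \<Longrightarrow> v \<in> V \<Longrightarrow> w \<in> V \<Longrightarrow> g (u + v) w = g u w + g v w"
  using g by (auto simp: inner_product_on_def)

lemma inner_product_on_scale: "u \<in> V \<Longrightarrow> v \<in> V \<Longrightarrow> g (r *\<^sub>R u) v = r * g u v"
  using g by (auto simp: inner_product_on_def)

lemma inner_product_on_pos: "u \<in> V \<Longrightarrow> u \<noteq> 0 \<Longrightarrow> g u u > 0"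
  using g by (auto simp: inner_product_on_def)

lemma inner_product_on_zero: "w \<in> V \<Longrightarrow> g 0 w = 0"
  using inner_product_on_scale[of w w 0] by simp

lemma inner_product_on_sum:
  assumes "finite I" "\<And>i. i \<in> I \<Longrightarrow> e i \<in> V" "w \<in> V"
  shows "g (\<Sum>i\<in>I. c i *\<^sub>R e i) w = (\<Sum>i\<in>I. c i * g (e i) w)"
  using assms
proof (induction I rule: finite_induct)
  case empty
  then show ?case by (simp add: inner_product_on_zero)
next
  case (insert j I)
  then have "(\<Sum>i\<in>I. c i *\<^sub>R e i) \<in> V" "c j *\<^sub>R e j \<in> V"
    by (auto intro!: subspace_sum[OF V] subspace_scale[OF V])
  then show ?case using insert by (simp add: inner_product_on_add inner_product_on_scale)
qed

lemma inner_product_on_orthonormal_sum: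
  fixes e :: "nat \<Rightarrow> 'v"
  assumes "\<And>i. i < k \<Longrightarrow> e i \<in> V" and "\<And>i j. i < k \<Longrightarrow> j < k \<Longrightarrow> g (e i) (e j) = (if i = j then 1 else 0)"
  shows "g (\<Sum>i<k. c i *\<^sub>R e i) (\<Sum>i<k. c i *\<^sub>R e i) = (\<Sum>i<k. (c i)\<^sup>2)"
proof -
  define w where "w = (\<Sum>i<k. c i *\<^sub>R e i)"
  have w: "w \<in> V" unfolding w_def using assms(1) by (auto intro!: subspace_sum[OF V] subspace_scale[OF V])
  have ew: "g (e i) w = c i" if "i < k" for i
  proof -
    have "g (e i) w = g w (e i)" using inner_product_on_sym w assms(1) that by blast
    also have "\<dots> = (\<Sum>j<k. c j * g (e j) (e i))"
      unfolding w_def using assms(1) that by (intro inner_product_on_sum) auto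
    also have "\<dots> = (\<Sum>j<k. if j = i then c j else 0)"
      using assms(2) that by (intro sum.cong) auto
    finally show ?thesis using that by (simp add: sum.delta')
  qed
  have "g w w = (\<Sum>i<k. c i * g (e i) w)"
    using inner_product_on_sum[of "{..<k}" e w c] assms(1) w by (simp add: w_def[symmetric])
  then show ?thesis unfolding w_def[symmetric] using ew by (simp add: power2_eq_square)
qed

end

context connected_smooth_manifold
begin

lemma openin_chart_domain: "c \<in> A \<Longrightarrow> openin X (fst c)"
  using charts by (auto simp: is_chart_def)

lemma homeomorphic_chart:
  "c \<in> A \<Longrightarrow> homeomorphic_map (subtopology X (fst c)) (top_of_set (snd c ` fst c)) (snd c)"
  using charts by (auto simp: is_chart_def)

lemma open_chart_image:
  assumes "c \<in> A" "openin X W"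
  shows "open (snd c ` (fst c \<inter> W))"
proof -
  have "openin (subtopology X (fst c)) (fst c \<inter> W)"
    using assms(2) by (metis Int_commute openin_subtopology_Int)
  moreover have "open_map (subtopology X (fst c)) (top_of_set (snd c ` fst c)) (snd c)"
    using homeomorphic_chart[OF assms(1)] by (simp add: homeomorphic_eq_everything_map)
  ultimately have "openin (top_of_set (snd c ` fst c)) (snd c ` (fst c \<inter> W))"
    by (simp add: open_map_def)
  moreover have "open (snd c ` fst c)" using charts[OF assms(1)] by (simp add: is_chart_def)
  ultimately show ?thesis using openin_open_trans by blast
qed

lemma inj_on_chart: "c \<in> A \<Longrightarrow> inj_on (snd c) (fst c)"
  using homeomorphic_chart[of c] openin_subset[OF openin_chart_domain[of c]]
  by (auto simp: homeomorphic_eq_everything_map topspace_subtopology inf_absorb2)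

lemma chart_inv_chart: "c \<in> A \<Longrightarrow> q \<in> fst c \<Longrightarrow> chart_inv c (snd c q) = q"
  by (simp add: inj_on_chart inv_into_f_f)

lemma C11_function_inverse_sqrt:
  assumes "C11_function A W f" "openin X W" "\<And>q. q \<in> W \<Longrightarrow> f q > 0"
  shows "C11_function A W (\<lambda>q. inverse (sqrt (f q)))"
  unfolding C11_function_def
proof
  fix c assume c: "c \<in> A"
  have "C11_on (snd c ` (fst c \<inter> W)) (\<lambda>x. inverse (sqrt ((f \<circ> chart_inv c) x)))"
  proof (rule C11_on_inverse_sqrt)
    show "C11_on (snd c ` (fst c \<inter> W)) (f \<circ> chart_inv c)"
      using assms(1) c by (auto simp: C11_function_def)
    show "open (snd c ` (fst c \<inter> W))" by (rule open_chart_image[OF c assms(2)])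
    show "0 < (f \<circ> chart_inv c) x" if "x \<in> snd c ` (fst c \<inter> W)" for x
      using that assms(3) chart_inv_chart[OF c] by auto
  qed
  then show "C11_on (snd c ` (fst c \<inter> W)) ((\<lambda>q. inverse (sqrt (f q))) \<circ> chart_inv c)"
    by (simp add: o_def)
qed

lemma C11_vector_field_scale:
  assumes "C11_function A W f" "C11_vector_field A W V" "openin X W"
    and "\<And>q. q \<in> W \<Longrightarrow> f q *\<^sub>R V q \<in> tangent_space A q"
  shows "C11_vector_field A W (\<lambda>q. f q *\<^sub>R V q)"
  unfolding C11_vector_field_def
proof (intro conjI ballI assms(4))
  fix c assume c: "c \<in> A"
  have "C11_on (snd c ` (fst c \<inter> W)) (f \<circ> chart_inv c)"
    "C11_on (snd c ` (fst c \<inter> W)) (\<lambda>x. V (chart_inv c x) c)"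
    using assms c by (auto simp: C11_function_def C11_vector_field_def)
  from C11_on_scaleR[OF this open_chart_image[OF c assms(3)]]
  have "C11_on (snd c ` (fst c \<inter> W)) (\<lambda>x. (f \<circ> chart_inv c) x *\<^sub>R V (chart_inv c x) c)" .
  then show "C11_on (snd c ` (fst c \<inter> W)) (\<lambda>x. (f (chart_inv c x) *\<^sub>R V (chart_inv c x)) c)"
    by (simp add: scaleR_fun_def o_def)
qed

lemma C11_vector_field_add:
  assumes "C11_vector_field A W U" "C11_vector_field A W V"
    and "\<And>q. q \<in> W \<Longrightarrow> U q + V q \<in> tangent_space A q"
  shows "C11_vector_field A W (\<lambda>q. U q + V q)"
  unfolding C11_vector_field_def
proof (intro conjI ballI assms(3))
  fix c assume "c \<in> A"
  then have "C11_on (snd c ` (fst c \<inter> W)) (\<lambda>x. U (chart_inv c x) c + V (chart_inv c x) c)"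
    using assms by (intro C11_on_add) (auto simp: C11_vector_field_def)
  then show "C11_on (snd c ` (fst c \<inter> W)) (\<lambda>x. (U (chart_inv c x) + V (chart_inv c x)) c)"
    by simp
qed

lemma C11_function_const: "C11_function A W (\<lambda>q. r)"
  unfolding C11_function_def by (simp add: o_def C11_on_const)

end

context C11_sub_Riemannian_manifold
begin

lemma subspace_distribution: "q \<in> topspace X \<Longrightarrow> subspace (\<Delta> q)"
  and distribution_tangent: "q \<in> topspace X \<Longrightarrow> v \<in> \<Delta> q \<Longrightarrow> v \<in> tangent_space A q"
  and dim_distribution: "q \<in> topspace X \<Longrightarrow> dim (\<Delta> q) = m"
  using distribution by (auto simp: C11_distribution_def)

lemma metric_inner_product: "q \<in> topspace X \<Longrightarrow> inner_product_on (\<Delta> q) (g q)"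
  using metric by (auto simp: C11_metric_def)

lemma C11_function_metric:
  assumes "openin X W" "C11_vector_field A W Y" "C11_vector_field A W Z"
    and "\<And>q. q \<in> W \<Longrightarrow> Y q \<in> \<Delta> q" "\<And>q. q \<in> W \<Longrightarrow> Z q \<in> \<Delta> q"
  shows "C11_function A W (\<lambda>q. g q (Y q) (Z q))"
  using metric assms unfolding C11_metric_def by blast

text \<open>The orthogonalization preserves the spans of initial segments of the frame. It does not break down,
  because \<open>m\<close> vector fields spanning an \<open>m\<close>-dimensional space are linearly independent.\<close>

lemma gram_schmidt:
  assumes W: "openin X W"
    and Y: "\<And>i. i < m \<Longrightarrow> C11_vector_field A W (Y i)"
    and span: "\<And>q. q \<in> W \<Longrightarrow> \<Delta> q = span ((\<lambda>i. Y i q) ` {..<m})"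
    and "k \<le> m"
  shows "\<exists>Z. (\<forall>i<k. C11_vector_field A W (Z i)) \<and>
     (\<forall>q\<in>W. span ((\<lambda>i. Z i q) ` {..<k}) = span ((\<lambda>i. Y i q) ` {..<k}) \<and>
        (\<forall>i<k. \<forall>j<k. g q (Z i q) (Z j q) = (if i = j then 1 else 0)))"
  using \<open>k \<le> m\<close>
proof (induction k)
  case 0
  then show ?case by auto
next
  case (Suc k)
  then have k: "k < m" by simp
  obtain Z where Z: "\<And>i. i < k \<Longrightarrow> C11_vector_field A W (Z i)"
    and spZ: "\<And>q. q \<in> W \<Longrightarrow> span ((\<lambda>i. Z i q) ` {..<k}) = span ((\<lambda>i. Y i q) ` {..<k})"
    and on: "\<And>q i j. q \<in> W \<Longrightarrow> i < k \<Longrightarrow> j < k \<Longrightarrow> g q (Z i q) (Z j q) = (if i = j then 1 else 0)"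
    using Suc.IH k by (metis less_imp_le)
  have top: "q \<in> topspace X" if "q \<in> W" for q using W that openin_subset by blast
  note sub = subspace_distribution[OF top] and ip = metric_inner_product[OF top]
  have Y\<Delta>: "Y i q \<in> \<Delta> q" if "q \<in> W" "i < m" for i q
    using span[OF that(1)] that(2) by (auto intro: span_base)
  have Z\<Delta>: "Z i q \<in> \<Delta> q" if "q \<in> W" "i < k" for i q
  proof -
    have "Z i q \<in> span ((\<lambda>i. Y i q) ` {..<k})"
      using spZ[OF that(1)] that(2) by (metis imageI lessThan_iff span_base)
    also have "\<dots> \<subseteq> \<Delta> q" unfolding span[OF that(1)] using k by (intro span_mono) auto
    finally show ?thesis .
  qed
  define V where "V = (\<lambda>q. Y k q + (\<Sum>i<k. (- g q (Y k q) (Z i q)) *\<^sub>R Z i q))"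
  have V\<Delta>: "V q \<in> \<Delta> q" if "q \<in> W" for q
    unfolding V_def using Y\<Delta>[OF that k] Z\<Delta>[OF that]
    by (auto intro!: subspace_add[OF sub[OF that]] subspace_sum[OF sub[OF that]] subspace_scale[OF sub[OF that]]
        subspace_neg[OF sub[OF that]])
  have CV: "C11_vector_field A W V"
  proof -
    have "C11_vector_field A W (\<lambda>q. Y k q + (\<Sum>i<l. (- g q (Y k q) (Z i q)) *\<^sub>R Z i q))" if "l \<le> k" for l
      using that
    proof (induction l)
      case 0
      then show ?case using Y[OF k] by simp
    next
      case (Suc l)
      have l: "l < k" using Suc.prems by simp
      have negZ: "C11_vector_field A W (\<lambda>q. (-1) *\<^sub>R Z l q)"
        using distribution_tangent[OF top] subspace_scale[OF sub] Z\<Delta> l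
        by (intro C11_vector_field_scale C11_function_const Z W) blast+
      have "C11_function A W (\<lambda>q. g q (Y k q) (Z l q))"
        by (rule C11_function_metric[OF W Y[OF k] Z[OF l]]) (use Y\<Delta> Z\<Delta> k l in auto)
      then have term_l: "C11_vector_field A W (\<lambda>q. g q (Y k q) (Z l q) *\<^sub>R ((-1) *\<^sub>R Z l q))"
        using distribution_tangent[OF top] subspace_scale[OF sub] Z\<Delta> l
        by (intro C11_vector_field_scale negZ W) blast+
      have "C11_vector_field A W (\<lambda>q. (Y k q + (\<Sum>i<l. (- g q (Y k q) (Z i q)) *\<^sub>R Z i q))
          + g q (Y k q) (Z l q) *\<^sub>R ((-1) *\<^sub>R Z l q))"
      proof (rule C11_vector_field_add[OF Suc.IH term_l])
        fix q assume q: "q \<in> W"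
        have "(Y k q + (\<Sum>i<l. (- g q (Y k q) (Z i q)) *\<^sub>R Z i q)) + g q (Y k q) (Z l q) *\<^sub>R ((-1) *\<^sub>R Z l q) \<in> \<Delta> q"
          using Y\<Delta>[OF q k] Z\<Delta>[OF q] l
          by (intro subspace_add[OF sub[OF q]] subspace_sum[OF sub[OF q]] subspace_scale[OF sub[OF q]]) auto
        then show "(Y k q + (\<Sum>i<l. (- g q (Y k q) (Z i q)) *\<^sub>R Z i q)) + g q (Y k q) (Z l q) *\<^sub>R ((-1) *\<^sub>R Z l q)
            \<in> tangent_space A q"
          using distribution_tangent[OF top[OF q]] by blast
      qed (use l in auto)
      then show ?case by (simp only: sum.lessThan_Suc add.assoc scaleR_scaleR mult_minus1_right)
    qed
    from this[of k] show ?thesis by (simp add: V_def)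
  qed
  have YV: "Y k q \<in> span (insert (V q) ((\<lambda>i. Z i q) ` {..<k}))" for q
  proof -
    have "Y k q - 1 *\<^sub>R V q = (\<Sum>i<k. g q (Y k q) (Z i q) *\<^sub>R Z i q)"
      by (simp add: V_def sum_negf)
    moreover have "\<dots> \<in> span ((\<lambda>i. Z i q) ` {..<k})"
      by (intro span_sum span_scale span_base) auto
    ultimately show ?thesis unfolding span_breakdown_eq by metis
  qed
  have V0: "V q \<noteq> 0" if q: "q \<in> W" for q
  proof
    assume "V q = 0"
    then have "Y k q \<in> span ((\<lambda>i. Y i q) ` {..<k})"
      using YV[of q] spZ[OF q] by simp
    also have "\<dots> \<subseteq> span ((\<lambda>i. Y i q) ` ({..<m} - {k}))"
      using k by (intro span_mono) auto
    finally have "span (insert (Y k q) ((\<lambda>i. Y i q) ` ({..<m} - {k}))) = span ((\<lambda>i. Y i q) ` ({..<m} - {k}))"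
      by (rule span_redundant)
    moreover have "insert (Y k q) ((\<lambda>i. Y i q) ` ({..<m} - {k})) = (\<lambda>i. Y i q) ` {..<m}"
      using k by auto
    ultimately have "\<Delta> q \<subseteq> span ((\<lambda>i. Y i q) ` ({..<m} - {k}))" using span[OF q] by simp
    then have "dim (\<Delta> q) \<le> card ((\<lambda>i. Y i q) ` ({..<m} - {k}))" by (intro dim_le_card) auto
    also have "\<dots> \<le> card ({..<m} - {k})" by (intro card_image_le) auto
    also have "\<dots> < m" using k by simp
    finally show False using dim_distribution[OF top[OF q]] by simp
  qed
  have VZ: "g q (V q) (Z j q) = 0" if q: "q \<in> W" and j: "j < k" for q j
  proof -
    have "g q (V q) (Z j q) = g q (Y k q) (Z j q) + (\<Sum>i<k. - g q (Y k q) (Z i q) * g q (Z i q) (Z j q))"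
    proof -
      have "(\<Sum>i<k. - g q (Y k q) (Z i q) *\<^sub>R Z i q) \<in> \<Delta> q"
        using Z\<Delta>[OF q] by (intro subspace_sum[OF sub[OF q]] subspace_scale[OF sub[OF q]]) auto
      from inner_product_on_add[OF sub[OF q] ip[OF q] Y\<Delta>[OF q k] this Z\<Delta>[OF q j]]
      show ?thesis
        unfolding V_def using inner_product_on_sum[OF sub[OF q] ip[OF q], of "{..<k}" "\<lambda>i. Z i q" "Z j q"
            "\<lambda>i. - g q (Y k q) (Z i q)"] Z\<Delta>[OF q] j
        by simp
    qed
    also have "(\<Sum>i<k. - g q (Y k q) (Z i q) * g q (Z i q) (Z j q)) = (\<Sum>i<k. if i = j then - g q (Y k q) (Z i q) else 0)"
      using on[OF q _ j] by (intro sum.cong) auto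
    finally show ?thesis using j by (simp add: sum.delta')
  qed
  have gV: "g q (V q) (V q) > 0" if "q \<in> W" for q
    using inner_product_on_pos[OF sub[OF that] ip[OF that] V\<Delta>[OF that] V0[OF that]] .
  define k' where "k' = (\<lambda>q. inverse (sqrt (g q (V q) (V q))))"
  define U where "U = (\<lambda>q. k' q *\<^sub>R V q)"
  have k': "k' q > 0" "(k' q)\<^sup>2 * g q (V q) (V q) = 1" if "q \<in> W" for q
    using gV[OF that] by (auto simp: k'_def power_inverse)
  have U\<Delta>: "U q \<in> \<Delta> q" if "q \<in> W" for q
    unfolding U_def using V\<Delta>[OF that] by (intro subspace_scale[OF sub[OF that]])
  have CU: "C11_vector_field A W U"
    unfolding U_def
  proof (rule C11_vector_field_scale[OF _ CV W])
    show "C11_function A W k'"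
      unfolding k'_def using gV
      by (intro C11_function_inverse_sqrt C11_function_metric W CV V\<Delta>)
    show "k' q *\<^sub>R V q \<in> tangent_space A q" if "q \<in> W" for q
      using distribution_tangent[OF top[OF that] U\<Delta>[OF that]] by (simp add: U_def)
  qed
  have UU: "g q (U q) (U q) = 1" if q: "q \<in> W" for q
  proof -
    have "g q (U q) (U q) = k' q * g q (V q) (U q)"
      unfolding U_def using inner_product_on_scale[OF sub[OF q] ip[OF q] V\<Delta>[OF q] U\<Delta>[OF q]]
      by (simp add: U_def)
    also have "g q (V q) (U q) = g q (U q) (V q)"
      using inner_product_on_sym[OF sub[OF q] ip[OF q] V\<Delta>[OF q] U\<Delta>[OF q]] .
    also have "\<dots> = k' q * g q (V q) (V q)"
      unfolding U_def using inner_product_on_scale[OF sub[OF q] ip[OF q] V\<Delta>[OF q] V\<Delta>[OF q]] .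
    finally show ?thesis using k'(2)[OF q] by (simp add: power2_eq_square)
  qed
  have UZ: "g q (U q) (Z j q) = 0" "g q (Z j q) (U q) = 0" if q: "q \<in> W" and j: "j < k" for q j
  proof -
    show "g q (U q) (Z j q) = 0"
      unfolding U_def using inner_product_on_scale[OF sub[OF q] ip[OF q] V\<Delta>[OF q] Z\<Delta>[OF q j]] VZ[OF q j] by simp
    then show "g q (Z j q) (U q) = 0"
      using inner_product_on_sym[OF sub[OF q] ip[OF q] Z\<Delta>[OF q j] U\<Delta>[OF q]] by simp
  qed
  have spU: "span (insert (U q) ((\<lambda>i. Z i q) ` {..<k})) = span (insert (Y k q) ((\<lambda>i. Y i q) ` {..<k}))"
    if q: "q \<in> W" for q
  proof (rule subset_antisym; rule span_minimal[OF _ subspace_span])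
    let ?S = "span (insert (Y k q) ((\<lambda>i. Y i q) ` {..<k}))"
    have ZS: "Z i q \<in> ?S" if "i < k" for i
    proof -
      have "Z i q \<in> span ((\<lambda>i. Y i q) ` {..<k})"
        using spZ[OF q] that by (metis imageI lessThan_iff span_base)
      also have "\<dots> \<subseteq> ?S" by (intro span_mono) auto
      finally show ?thesis .
    qed
    have "Y k q \<in> ?S" by (simp add: span_base)
    then have "U q \<in> ?S"
      unfolding U_def V_def using ZS by (auto intro!: span_scale span_add span_sum span_neg)
    then show "insert (U q) ((\<lambda>i. Z i q) ` {..<k}) \<subseteq> ?S" using ZS by auto
    let ?T = "span (insert (U q) ((\<lambda>i. Z i q) ` {..<k}))"
    have UT: "U q \<in> ?T" by (simp add: span_base)
    have "V q = inverse (k' q) *\<^sub>R U q" using k'(1)[OF q] by (simp add: U_def)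
    then have "V q \<in> ?T" using span_scale[OF UT] by simp
    moreover have "(\<lambda>i. Z i q) ` {..<k} \<subseteq> ?T" by (auto intro: span_base)
    ultimately have "span (insert (V q) ((\<lambda>i. Z i q) ` {..<k})) \<subseteq> ?T"
      by (intro span_minimal) auto
    then have "Y k q \<in> ?T" using YV by blast
    moreover have "(\<lambda>i. Y i q) ` {..<k} \<subseteq> ?T"
    proof -
      have "(\<lambda>i. Y i q) ` {..<k} \<subseteq> span ((\<lambda>i. Z i q) ` {..<k})"
        unfolding spZ[OF q] by (rule span_superset)
      also have "\<dots> \<subseteq> ?T" by (intro span_mono) auto
      finally show ?thesis .
    qed
    ultimately show "insert (Y k q) ((\<lambda>i. Y i q) ` {..<k}) \<subseteq> ?T" by auto
  qed
  define Z' where "Z' = Z(k := U)"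
  have im: "(\<lambda>i. Z' i q) ` {..<Suc k} = insert (U q) ((\<lambda>i. Z i q) ` {..<k})"
    "(\<lambda>i. Y i q) ` {..<Suc k} = insert (Y k q) ((\<lambda>i. Y i q) ` {..<k})" for q
    by (auto simp: Z'_def lessThan_Suc)
  show ?case
  proof (intro exI[of _ Z'] conjI allI impI ballI)
    show "C11_vector_field A W (Z' i)" if "i < Suc k" for i
      using that Z CU by (auto simp: Z'_def less_Suc_eq)
    fix q assume q: "q \<in> W"
    show "span ((\<lambda>i. Z' i q) ` {..<Suc k}) = span ((\<lambda>i. Y i q) ` {..<Suc k})"
      unfolding im using spU[OF q] .
    show "g q (Z' i q) (Z' j q) = (if i = j then 1 else 0)" if "i < Suc k" "j < Suc k" for i j
      using that on[OF q] UU[OF q] UZ[OF q] by (auto simp: Z'_def less_Suc_eq)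
  qed
qed

lemma orthonormal_frame:
  assumes "p \<in> topspace X"
  obtains W Z where "openin X W" "p \<in> W" "\<And>i. i < m \<Longrightarrow> C11_vector_field A W (Z i)"
    "\<And>q. q \<in> W \<Longrightarrow> \<Delta> q = span ((\<lambda>i. Z i q) ` {..<m})"
    "\<And>q i j. q \<in> W \<Longrightarrow> i < m \<Longrightarrow> j < m \<Longrightarrow> g q (Z i q) (Z j q) = (if i = j then 1 else 0)"
proof -
  from distribution[unfolded C11_distribution_def, THEN conjunct2, THEN bspec, OF assms]
  obtain W Y where WY: "openin X W \<and> p \<in> W \<and> (\<forall>i<m. C11_vector_field A W (Y i)) \<and>
      (\<forall>q\<in>W. \<Delta> q = span ((\<lambda>i. Y i q) ` {..<m}))"
    by (elim exE)
  then have W: "openin X W" "p \<in> W" by simp_all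
  have Y: "C11_vector_field A W (Y i)" if "i < m" for i using WY that by simp
  have spanY: "\<Delta> q = span ((\<lambda>i. Y i q) ` {..<m})" if "q \<in> W" for q using WY that by simp
  have "\<exists>Z. (\<forall>i<m. C11_vector_field A W (Z i)) \<and>
     (\<forall>q\<in>W. span ((\<lambda>i. Z i q) ` {..<m}) = span ((\<lambda>i. Y i q) ` {..<m}) \<and>
        (\<forall>i<m. \<forall>j<m. g q (Z i q) (Z j q) = (if i = j then 1 else 0)))"
    by (rule gram_schmidt[OF W(1)]) (simp_all add: Y spanY)
  then
  obtain Z where Z: "\<forall>i<m. C11_vector_field A W (Z i)"
    "\<forall>q\<in>W. span ((\<lambda>i. Z i q) ` {..<m}) = span ((\<lambda>i. Y i q) ` {..<m}) \<and>
        (\<forall>i<m. \<forall>j<m. g q (Z i q) (Z j q) = (if i = j then 1 else 0))"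
    by (elim exE conjE)
  show ?thesis
  proof (rule that[OF W, of Z])
    show "C11_vector_field A W (Z i)" if "i < m" for i using Z(1) that by blast
    show "\<Delta> q = span ((\<lambda>i. Z i q) ` {..<m})" if "q \<in> W" for q
      using Z(2) spanY[OF that] that by simp
    show "g q (Z i q) (Z j q) = (if i = j then 1 else 0)" if "q \<in> W" "i < m" "j < m" for q i j
      using Z(2) that by simp
  qed
qed

end

section \<open>Normal extremals and their calibrations in coordinates\<close>

text \<open>A frame given in coordinates on a ball, with uniform \<open>C\<^sup>1\<^sup>,\<^sup>1\<close> bounds.\<close>

locale C11_frame =
  fixes x0 :: "'e::euclidean_space" and R L :: real and m :: nat
    and Y :: "nat \<Rightarrow> 'e \<Rightarrow> 'e" and D :: "nat \<Rightarrow> 'e \<Rightarrow> 'e \<Rightarrow> 'e"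
  assumes R: "0 < R"
    and bounds: "\<And>i. i < m \<Longrightarrow> C11_bounds (ball x0 R) L (Y i) (D i)"

text \<open>A normal extremal \<open>(x, \<xi>)\<close> on the interval \<open>[-T, T]\<close>, covectors being identified with vectors by
  the Euclidean inner product. With \<open>h\<^sub>i = \<xi> \<bullet> Y\<^sub>i(x)\<close>, \<open>V = \<Sum>\<^sub>i h\<^sub>i Y\<^sub>i(x)\<close> and
  \<open>\<lambda> = \<xi>(0) \<bullet> V\<close>, Hamilton's equations are \<open>\<lambda> x' = V\<close> and
  \<open>\<lambda> (\<xi>' \<bullet> v) = - \<Sum>\<^sub>i h\<^sub>i (\<xi> \<bullet> D\<^sub>i(x) v)\<close>. The factor \<open>\<lambda>\<close> changes the parameter of the Hamiltonian
  flow so that \<open>\<xi>(0) \<bullet> x' = 1\<close>; it is assumed to be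
  bounded below. The number \<open>M\<close> is a common bound for all data.\<close>

locale normal_extremal = C11_frame x0 R L m Y D
  for x0 :: "'a::euclidean_space" and R L :: real and m :: nat
    and Y :: "nat \<Rightarrow> 'a \<Rightarrow> 'a" and D :: "nat \<Rightarrow> 'a \<Rightarrow> 'a \<Rightarrow> 'a" +
  fixes x \<xi> x' \<xi>' :: "real \<Rightarrow> 'a" and T M :: real
  assumes T: "0 < T" and M: "1 \<le> M" "L \<le> M" "norm (\<xi> 0) \<le> M"
    and start: "x 0 = x0" and energy0: "(\<Sum>i<m. (\<xi> 0 \<bullet> Y i x0)\<^sup>2) = 1"
    and in_ball: "\<And>t. t \<in> {-T..T} \<Longrightarrow> x t \<in> ball x0 R"
    and der_x: "\<And>t. t \<in> {-T..T} \<Longrightarrow> (x has_vector_derivative x' t) (at t within {-T..T})"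
    and der_\<xi>: "\<And>t. t \<in> {-T..T} \<Longrightarrow> (\<xi> has_vector_derivative \<xi>' t) (at t within {-T..T})"
    and ham_pos: "\<And>t. t \<in> {-T..T} \<Longrightarrow> 1/2 \<le> \<xi> 0 \<bullet> (\<Sum>i<m. (\<xi> t \<bullet> Y i (x t)) *\<^sub>R Y i (x t))"
    and ham_x: "\<And>t. t \<in> {-T..T} \<Longrightarrow>
        (\<xi> 0 \<bullet> (\<Sum>i<m. (\<xi> t \<bullet> Y i (x t)) *\<^sub>R Y i (x t))) *\<^sub>R x' t = (\<Sum>i<m. (\<xi> t \<bullet> Y i (x t)) *\<^sub>R Y i (x t))"
    and ham_\<xi>: "\<And>t v. t \<in> {-T..T} \<Longrightarrow>
        (\<xi> 0 \<bullet> (\<Sum>i<m. (\<xi> t \<bullet> Y i (x t)) *\<^sub>R Y i (x t))) * (\<xi>' t \<bullet> v) =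
          - (\<Sum>i<m. (\<xi> t \<bullet> Y i (x t)) * (\<xi> t \<bullet> D i (x t) v))"
    and norms: "\<And>t. t \<in> {-T..T} \<Longrightarrow> norm (\<xi> t) \<le> M \<and> norm (x' t) \<le> M \<and> norm (\<xi>' t) \<le> M"
begin

text \<open>The momentum functions \<open>h i\<close>, the time change \<open>lam\<close>, which is also the reciprocal of the
  sub-Riemannian speed of \<open>x\<close>, and the time function \<open>\<tau>\<close>.\<close>

definition h :: "nat \<Rightarrow> real \<Rightarrow> real" where "h i t = \<xi> t \<bullet> Y i (x t)"
definition lam :: "real \<Rightarrow> real" where "lam t = \<xi> 0 \<bullet> (\<Sum>i<m. h i t *\<^sub>R Y i (x t))"
definition \<tau> :: "'a \<Rightarrow> real" where "\<tau> z = \<xi> 0 \<bullet> (z - x0)"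

abbreviation I where "I \<equiv> {-T..T}"

lemma lam: "t \<in> I \<Longrightarrow> 1/2 \<le> lam t" "t \<in> I \<Longrightarrow> lam t *\<^sub>R x' t = (\<Sum>i<m. h i t *\<^sub>R Y i (x t))"
  "t \<in> I \<Longrightarrow> lam t * (\<xi>' t \<bullet> v) = - (\<Sum>i<m. h i t * (\<xi> t \<bullet> D i (x t) v))"
  using ham_pos ham_x ham_\<xi> by (simp_all add: lam_def h_def)

lemma Y_has_derivative: "i < m \<Longrightarrow> z \<in> ball x0 R \<Longrightarrow> (Y i has_derivative D i z) (at z)"
  using bounds by (auto simp: C11_bounds_def)

lemma M0: "0 \<le> M" using M by simp

lemma Y_bounds:
  assumes "i < m" "z \<in> ball x0 R"
  shows "norm (Y i z) \<le> M" "norm (D i z v) \<le> M * norm v"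
proof -
  have "norm (Y i z) \<le> L" "norm (D i z v) \<le> L * norm v"
    using bounds assms by (auto simp: C11_bounds_def)
  then show "norm (Y i z) \<le> M" "norm (D i z v) \<le> M * norm v"
    using M(2) mult_right_mono[OF M(2), of "norm v"] by auto
qed

lemma x_bound:
  assumes "t \<in> I"
  shows "norm (x t - x0) \<le> M * \<bar>t\<bar>"
proof -
  have "norm (x t - x 0) \<le> M * norm (t - 0)"
  proof (rule differentiable_bound[where S = I])
    show "(x has_derivative (\<lambda>s. s *\<^sub>R x' t)) (at t within I)" if "t \<in> I" for t
      using der_x[OF that] by (simp add: has_vector_derivative_def)
    show "onorm (\<lambda>s. s *\<^sub>R x' t) \<le> M" if "t \<in> I" for t
      using norms[OF that] by (intro onorm_scaleR_vector_le) simp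
  qed (use assms T in auto)
  then show ?thesis by (simp add: start)
qed

lemma constant_on_I:
  fixes f :: "real \<Rightarrow> real"
  assumes "\<And>t. t \<in> I \<Longrightarrow> (f has_derivative (\<lambda>_. 0)) (at t within I)" "t \<in> I"
  shows "f t = f 0"
proof -
  obtain c where "\<forall>t\<in>I. f t = c"
    using has_derivative_zero_constant[of I f] assms(1) by auto
  moreover have "0 \<in> I" using T by simp
  ultimately show ?thesis using assms(2) by metis
qed

lemma \<tau>_x:
  assumes "t \<in> I"
  shows "\<tau> (x t) = t"
proof -
  have "((\<lambda>t. \<tau> (x t) - t) has_derivative (\<lambda>_. 0)) (at t within I)" if t: "t \<in> I" for t
  proof -
    have "lam t * (\<xi> 0 \<bullet> x' t) = lam t"
      using arg_cong[OF lam(2)[OF t], of "\<lambda>v. \<xi> 0 \<bullet> v"] by (simp add: lam_def)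
    then have one: "\<xi> 0 \<bullet> x' t = 1" using lam(1)[OF t] by simp
    have "((\<lambda>t. \<tau> (x t) - t) has_vector_derivative (\<xi> 0 \<bullet> x' t - 1)) (at t within I)"
      unfolding \<tau>_def has_vector_derivative_def
      using der_x[OF t, unfolded has_vector_derivative_def]
      by (auto intro!: derivative_eq_intros simp: inner_diff_right algebra_simps)
    then show ?thesis by (simp add: one has_vector_derivative_def)
  qed
  from constant_on_I[OF this assms] have "\<tau> (x t) - t = \<tau> (x 0) - 0" .
  then show ?thesis by (simp add: start \<tau>_def)
qed

lemma h_has_derivative:
  assumes "i < m" "t \<in> I"
  shows "(h i has_vector_derivative \<xi> t \<bullet> D i (x t) (x' t) + \<xi>' t \<bullet> Y i (x t)) (at t within I)"
proof -
  have "((\<lambda>t. Y i (x t)) has_vector_derivative D i (x t) (x' t)) (at t within I)"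
    using vector_derivative_diff_chain_within[OF der_x[OF assms(2)]
        has_derivative_at_withinI[OF Y_has_derivative[OF assms(1) in_ball[OF assms(2)]]]]
    by (simp add: o_def)
  then show ?thesis
    using der_\<xi>[OF assms(2)] unfolding h_def[abs_def] has_vector_derivative_def
    by (auto intro!: derivative_eq_intros simp: algebra_simps)
qed

text \<open>Conservation of the Hamiltonian, which is half of this sum.\<close>

lemma energy:
  assumes "t \<in> I"
  shows "(\<Sum>i<m. (h i t)\<^sup>2) = 1"
proof -
  have "((\<lambda>t. \<Sum>i<m. (h i t)\<^sup>2) has_derivative (\<lambda>_. 0)) (at t within I)" if t: "t \<in> I" for t
  proof -
    let ?h' = "\<lambda>i. \<xi> t \<bullet> D i (x t) (x' t) + \<xi>' t \<bullet> Y i (x t)"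
    have "lam t * (\<Sum>i<m. h i t * (\<xi>' t \<bullet> Y i (x t))) = lam t * (\<xi>' t \<bullet> (lam t *\<^sub>R x' t))"
      unfolding lam(2)[OF t] by (simp add: inner_sum_right)
    also have "\<dots> = - lam t * (\<Sum>i<m. h i t * (\<xi> t \<bullet> D i (x t) (x' t)))"
      using lam(3)[OF t, of "x' t"] by simp
    finally have "lam t * (\<Sum>i<m. h i t * ?h' i) = 0"
      by (simp add: distrib_left sum.distrib)
    then have "(\<Sum>i<m. h i t * ?h' i) = 0" using lam(1)[OF t] by simp
    moreover have "((\<lambda>t. \<Sum>i<m. (h i t)\<^sup>2) has_derivative (\<lambda>s. \<Sum>i<m. 2 * h i t * (s *\<^sub>R ?h' i))) (at t within I)"
      using h_has_derivative[OF _ t] unfolding has_vector_derivative_def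
      by (intro has_derivative_sum) (auto intro!: derivative_eq_intros simp: algebra_simps)
    moreover have "(\<Sum>i<m. 2 * h i t * (s *\<^sub>R ?h' i)) = 2 * s * (\<Sum>i<m. h i t * ?h' i)" for s
      unfolding sum_distrib_left by (intro sum.cong) (auto simp: algebra_simps)
    ultimately show ?thesis by simp
  qed
  from constant_on_I[OF this assms] have "(\<Sum>i<m. (h i t)\<^sup>2) = (\<Sum>i<m. (h i 0)\<^sup>2)" .
  then show ?thesis using energy0 by (simp add: start h_def)
qed

lemma h_le_1: "i < m \<Longrightarrow> t \<in> I \<Longrightarrow> \<bar>h i t\<bar> \<le> 1"
proof -
  assume "i < m" "t \<in> I"
  then have "(h i t)\<^sup>2 \<le> 1"
    using energy member_le_sum[of i "{..<m}" "\<lambda>i. (h i t)\<^sup>2"] by simp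
  then show ?thesis by (simp add: abs_square_le_1)
qed

text \<open>The vector \<open>\<omega> K t y\<close> represents the differential of the calibration at the point \<open>z = x t + y\<close> with
  \<open>\<tau> z = t\<close>. The coefficient of \<open>\<xi> 0\<close> comes from differentiating with respect to \<open>t\<close>.\<close>

definition \<beta> :: "real \<Rightarrow> real \<Rightarrow> 'a \<Rightarrow> real" where
  "\<beta> K t y = \<xi>' t \<bullet> y + K * t * (y \<bullet> x' t)"

definition \<omega> :: "real \<Rightarrow> real \<Rightarrow> 'a \<Rightarrow> 'a" where
  "\<omega> K t y = \<xi> t - (K * t) *\<^sub>R y + (\<beta> K t y - K / 2 * (norm y)\<^sup>2) *\<^sub>R \<xi> 0"

text \<open>A bound, independent of \<open>K\<close>, for the coefficient of \<open>|y|\<^sup>2\<close> in the energy of \<open>\<omega> K t y\<close>, apart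
  from the negative contribution that is proportional to \<open>K\<close>.\<close>

definition C0 :: real where "C0 = m * (10 * M^3 + 100 * M^6)"

lemma C0_nonneg: "0 \<le> C0"
  using M by (simp add: C0_def)

context
  fixes K t :: real and y :: 'a
  assumes t: "t \<in> I" and K: "0 \<le> K" "K * \<bar>t\<bar> \<le> 1" "K * norm y \<le> 1" and y: "norm y \<le> 1"
begin

lemma \<beta>_bound: "\<bar>\<beta> K t y\<bar> \<le> 2 * M * norm y"
proof -
  have "\<bar>\<xi>' t \<bullet> y\<bar> \<le> norm (\<xi>' t) * norm y" by (rule Cauchy_Schwarz_ineq2)
  also have "\<dots> \<le> M * norm y" using norms[OF t] by (intro mult_right_mono) auto
  finally have 1: "\<bar>\<xi>' t \<bullet> y\<bar> \<le> M * norm y" .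
  have "\<bar>y \<bullet> x' t\<bar> \<le> norm y * norm (x' t)" by (rule Cauchy_Schwarz_ineq2)
  also have "\<dots> \<le> norm y * M" using norms[OF t] by (intro mult_left_mono) auto
  finally have 2: "\<bar>y \<bullet> x' t\<bar> \<le> norm y * M" .
  have "\<bar>K * t * (y \<bullet> x' t)\<bar> = K * \<bar>t\<bar> * \<bar>y \<bullet> x' t\<bar>" using K(1) by (simp add: abs_mult)
  also have "\<dots> \<le> 1 * (norm y * M)" using K 2 by (intro mult_mono) auto
  finally have "\<bar>K * t * (y \<bullet> x' t)\<bar> \<le> M * norm y" by (simp add: mult.commute)
  with 1 show ?thesis unfolding \<beta>_def by linarith
qed

lemma quadratic_bound: "0 \<le> K / 2 * (norm y)\<^sup>2" "K / 2 * (norm y)\<^sup>2 \<le> norm y"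
proof -
  have "K * norm y * norm y \<le> 1 * norm y" using K by (intro mult_right_mono) auto
  moreover have "0 \<le> K * norm y * norm y" using K(1) by simp
  ultimately show "K / 2 * (norm y)\<^sup>2 \<le> norm y" by (simp add: power2_eq_square)
qed (use K(1) in simp)

lemma slope_bound: "\<bar>\<beta> K t y - K / 2 * (norm y)\<^sup>2\<bar> \<le> 3 * M * norm y"
  using \<beta>_bound quadratic_bound mult_right_mono[OF M(1), of "norm y"] by simp

lemma \<omega>_bound: "norm (\<omega> K t y) \<le> 5 * M\<^sup>2"
proof -
  have "norm (\<omega> K t y) \<le> norm (\<xi> t - (K * t) *\<^sub>R y) + norm ((\<beta> K t y - K / 2 * (norm y)\<^sup>2) *\<^sub>R \<xi> 0)"
    unfolding \<omega>_def by (rule norm_triangle_ineq)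
  also have "\<dots> \<le> (norm (\<xi> t) + norm ((K * t) *\<^sub>R y)) + \<bar>\<beta> K t y - K / 2 * (norm y)\<^sup>2\<bar> * norm (\<xi> 0)"
    by (intro add_mono norm_triangle_ineq4) simp
  also have "\<dots> \<le> (M + 1) + (3 * M * 1) * M"
  proof (intro add_mono mult_mono)
    show "norm (\<xi> t) \<le> M" using norms[OF t] by simp
    have "K * \<bar>t\<bar> * norm y \<le> 1 * 1" using K y by (intro mult_mono) auto
    then show "norm ((K * t) *\<^sub>R y) \<le> 1" using K(1) by (simp add: abs_mult)
    show "\<bar>\<beta> K t y - K / 2 * (norm y)\<^sup>2\<bar> \<le> 3 * M * 1"
      using slope_bound mult_left_mono[OF y, of "3 * M"] M0 by simp
  qed (use M M0 in auto)
  also have "\<dots> \<le> 5 * M\<^sup>2"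
    using M(1) mult_left_mono[OF M(1) M0] unfolding power2_eq_square by linarith
  finally show ?thesis .
qed

text \<open>The differential of the calibration has energy at most 1 near the extremal if \<open>K\<close> is large. The
  pairing with \<open>Y i\<close> splits into the momentum \<open>h i\<close>, the part \<open>a i\<close> linear in \<open>y\<close>, the part
  \<open>b i\<close> coming from the derivative of the coefficient of \<open>|y|\<^sup>2\<close>, and a remainder \<open>e i\<close> of second
  order.\<close>

lemma energy_estimate:
  assumes xy: "x t + y \<in> ball x0 R"
  shows "(\<Sum>i<m. (\<omega> K t y \<bullet> Y i (x t + y))\<^sup>2) \<le> 1 + (C0 - K / 2) * (norm y)\<^sup>2"
proof -
  define n where "n = norm y"
  define k where "k = - K * t"
  define \<alpha> where "\<alpha> = \<beta> K t y"
  define \<gamma> where "\<gamma> = - (K / 2 * n\<^sup>2)"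
  have n: "0 \<le> n" "n \<le> 1" using y by (auto simp: n_def)
  have nn: "n\<^sup>2 \<le> n" using n by (simp add: power2_eq_square mult_left_le)
  have k: "\<bar>k\<bar> \<le> 1" using K by (simp add: k_def abs_mult)
  note xt = in_ball[OF t]
  have nrm: "norm (\<xi> t) \<le> M" "norm (\<xi> 0) \<le> M" "norm y \<le> n" using norms[OF t] M by (auto simp: n_def)
  have ip: "\<bar>u \<bullet> v\<bar> \<le> a * b" if "norm u \<le> a" "norm v \<le> b" for u v :: 'a and a b
  proof -
    have "0 \<le> a" using that(1) norm_ge_zero order_trans by blast
    then have "norm u * norm v \<le> a * b" using that by (intro mult_mono) auto
    then show ?thesis using Cauchy_Schwarz_ineq2 order_trans by blast
  qed
  have am: "\<bar>a * b\<bar> \<le> c * d" if "\<bar>a\<bar> \<le> c" "\<bar>b\<bar> \<le> d" for a b c d :: real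
    using mult_mono[OF that] that by (simp add: abs_mult)
  have \<omega>_eq: "\<omega> K t y = \<xi> t + k *\<^sub>R y + (\<alpha> + \<gamma>) *\<^sub>R \<xi> 0"
    by (simp add: \<omega>_def \<alpha>_def \<gamma>_def k_def n_def)
  have \<alpha>_le: "\<bar>\<alpha>\<bar> \<le> 2 * M * n" using \<beta>_bound by (simp add: \<alpha>_def n_def)
  have \<gamma>_le: "\<bar>\<gamma>\<bar> \<le> n" "\<gamma> \<le> 0" using quadratic_bound by (auto simp: \<gamma>_def n_def)
  have \<alpha>\<gamma>_le: "\<bar>\<alpha> + \<gamma>\<bar> \<le> 3 * M * n" using slope_bound by (simp add: \<alpha>_def \<gamma>_def n_def)
  have M23: "M\<^sup>2 \<le> M^3" "M \<le> M^3" "0 \<le> M^3"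
    using M(1) self_le_power[of M 3] power_increasing[of 2 3 M] by auto
  define a where "a = (\<lambda>i. \<xi> t \<bullet> D i (x t) y + k * (y \<bullet> Y i (x t)) + \<alpha> * (\<xi> 0 \<bullet> Y i (x t)))"
  define b where "b = (\<lambda>i. \<gamma> * (\<xi> 0 \<bullet> Y i (x t)))"
  define e where "e = (\<lambda>i. \<xi> t \<bullet> (Y i (x t + y) - Y i (x t) - D i (x t) y)
      + k * (y \<bullet> (Y i (x t + y) - Y i (x t))) + (\<alpha> + \<gamma>) * (\<xi> 0 \<bullet> (Y i (x t + y) - Y i (x t))))"
  define q where "q = (\<lambda>i. a i + b i + e i)"
  have split: "\<omega> K t y \<bullet> Y i (x t + y) = h i t + q i" for i
    unfolding \<omega>_eq q_def a_def b_def e_def h_def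
    by (simp add: inner_add_left inner_diff_right algebra_simps)
  have e_le: "\<bar>e i\<bar> \<le> 5 * M^3 * n\<^sup>2" if i: "i < m" for i
  proof -
    have d1: "norm (Y i (x t + y) - Y i (x t)) \<le> M * n"
      using C11_bounds_lipschitz[OF bounds[OF i] convex_ball xy xt] mult_right_mono[OF M(2) n(1)]
      by (simp add: n_def)
    have d2: "norm (Y i (x t + y) - Y i (x t) - D i (x t) y) \<le> M * n\<^sup>2"
      using C11_bounds_taylor[OF bounds[OF i] convex_ball xt xy] mult_right_mono[OF M(2), of "n\<^sup>2"]
      by (simp add: n_def)
    have "\<bar>e i\<bar> \<le> M * (M * n\<^sup>2) + 1 * (n * (M * n)) + (3 * M * n) * (M * (M * n))"
      unfolding e_def by (intro order_trans[OF abs_triangle_ineq] add_mono am ip nrm d1 d2 k \<alpha>\<gamma>_le)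
    also have "\<dots> = (M\<^sup>2 + M + 3 * M^3) * n\<^sup>2"
      by (simp add: power2_eq_square power3_eq_cube algebra_simps)
    also have "\<dots> \<le> (5 * M^3) * n\<^sup>2" using M23 by (intro mult_right_mono) auto
    finally show ?thesis .
  qed
  have q_le: "\<bar>q i\<bar> \<le> 10 * M^3 * n" if i: "i < m" for i
  proof -
    note Yb = Y_bounds[OF i xt]
    have "\<bar>a i\<bar> \<le> M * (M * n) + 1 * (n * M) + (2 * M * n) * (M * M)"
      unfolding a_def using Yb(2)[of y]
      by (intro order_trans[OF abs_triangle_ineq] add_mono am ip nrm Yb(1) k \<alpha>_le) (simp add: n_def)
    also have "\<dots> = (M\<^sup>2 + M + 2 * M^3) * n"
      by (simp add: power2_eq_square power3_eq_cube algebra_simps)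
    also have "\<dots> \<le> (4 * M^3) * n" using M23 n by (intro mult_right_mono) auto
    finally have a_le: "\<bar>a i\<bar> \<le> 4 * M^3 * n" .
    have "\<bar>b i\<bar> \<le> n * (M * M)"
      unfolding b_def by (intro am ip nrm Yb(1) \<gamma>_le)
    also have "\<dots> \<le> M^3 * n" using mult_right_mono[OF M23(1) n(1)] by (simp add: power2_eq_square mult_ac)
    finally have b_le: "\<bar>b i\<bar> \<le> M^3 * n" .
    have "5 * M^3 * n\<^sup>2 \<le> 5 * M^3 * n" using nn M23 by (intro mult_left_mono) auto
    then show ?thesis using a_le b_le e_le[OF i] by (simp add: q_def)
  qed
  have V: "(\<Sum>i<m. h i t * (u \<bullet> Y i (x t))) = lam t * (u \<bullet> x' t)" for u
    using arg_cong[OF lam(2)[OF t], of "\<lambda>v. u \<bullet> v"] by (simp add: inner_sum_right)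
  have unit: "\<xi> 0 \<bullet> x' t = 1"
    using V[of "\<xi> 0"] lam(1)[OF t] by (simp add: lam_def inner_sum_right)
  \<comment> \<open>The first-order terms cancel by Hamilton's equations.\<close>
  have "(\<Sum>i<m. h i t * a i) = (\<Sum>i<m. h i t * (\<xi> t \<bullet> D i (x t) y)) + k * (\<Sum>i<m. h i t * (y \<bullet> Y i (x t)))
      + \<alpha> * (\<Sum>i<m. h i t * (\<xi> 0 \<bullet> Y i (x t)))"
    by (simp add: a_def distrib_left sum.distrib sum_distrib_left mult_ac)
  also have "\<dots> = lam t * (\<alpha> - \<xi>' t \<bullet> y + k * (y \<bullet> x' t))"
    using lam(3)[OF t, of y] unfolding V unit by (simp add: algebra_simps)
  also have "\<dots> = 0" by (simp add: \<alpha>_def \<beta>_def k_def)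
  finally have ha: "(\<Sum>i<m. h i t * a i) = 0" .
  \<comment> \<open>This term is at most \<open>- K / 4 * n\<^sup>2\<close>, and it dominates the remainders when \<open>K\<close> is large.\<close>
  have hb: "(\<Sum>i<m. h i t * b i) = \<gamma> * lam t"
  proof -
    have "(\<Sum>i<m. h i t * b i) = \<gamma> * (\<Sum>i<m. h i t * (\<xi> 0 \<bullet> Y i (x t)))"
      by (simp add: b_def sum_distrib_left mult_ac)
    then show ?thesis unfolding V unit by simp
  qed
  have he: "(\<Sum>i<m. h i t * e i) \<le> m * (5 * M^3 * n\<^sup>2)"
  proof -
    have "h i t * e i \<le> 5 * M^3 * n\<^sup>2" if "i < m" for i
      using am[OF h_le_1[OF that t] e_le[OF that]] by simp
    then have "(\<Sum>i<m. h i t * e i) \<le> (\<Sum>i<m. 5 * M^3 * n\<^sup>2)" by (intro sum_mono) auto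
    then show ?thesis by simp
  qed
  have qq: "(\<Sum>i<m. (q i)\<^sup>2) \<le> m * (100 * M^6 * n\<^sup>2)"
  proof -
    have "(q i)\<^sup>2 \<le> 100 * M^6 * n\<^sup>2" if "i < m" for i
    proof -
      have "\<bar>q i\<bar>\<^sup>2 \<le> (10 * M^3 * n)\<^sup>2" using q_le[OF that] by (intro power_mono) auto
      then show ?thesis by (simp add: power_mult_distrib flip: power_mult)
    qed
    then have "(\<Sum>i<m. (q i)\<^sup>2) \<le> (\<Sum>i<m. 100 * M^6 * n\<^sup>2)" by (intro sum_mono) auto
    then show ?thesis by simp
  qed
  have eq: "(\<Sum>i<m. (\<omega> K t y \<bullet> Y i (x t + y))\<^sup>2)
      = (\<Sum>i<m. (h i t)\<^sup>2) + 2 * (\<Sum>i<m. h i t * q i) + (\<Sum>i<m. (q i)\<^sup>2)"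
    unfolding split power2_sum by (simp add: sum.distrib sum_distrib_left mult_ac)
  have hq: "(\<Sum>i<m. h i t * q i) = \<gamma> * lam t + (\<Sum>i<m. h i t * e i)"
    using ha hb by (simp add: q_def distrib_left sum.distrib)
  have combine: "S1 + 2 * (S2 + S3) + S4 \<le> 1 + 2 * (B2 + B3) + B4"
    if "S1 = 1" "S2 \<le> B2" "S3 \<le> B3" "S4 \<le> B4" for S1 S2 S3 S4 B2 B3 B4 :: real
    using that by (intro add_mono mult_left_mono) auto
  have "\<gamma> * lam t \<le> \<gamma> * (1 / 2)"
    using \<gamma>_le(2) lam(1)[OF t] by (intro mult_left_mono_neg)
  then have "(\<Sum>i<m. (\<omega> K t y \<bullet> Y i (x t + y))\<^sup>2)
      \<le> 1 + 2 * (\<gamma> * (1 / 2) + m * (5 * M^3 * n\<^sup>2)) + m * (100 * M^6 * n\<^sup>2)"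
    unfolding eq hq by (rule combine[OF energy[OF t] _ he qq])
  also have "\<dots> = 1 + (C0 - K / 2) * n\<^sup>2"
    by (simp add: \<gamma>_def C0_def algebra_simps)
  finally show ?thesis by (simp add: n_def)
qed

end

lemma \<xi>_x': "t \<in> I \<Longrightarrow> \<xi> t \<bullet> x' t = 1 / lam t"
proof -
  assume t: "t \<in> I"
  have "lam t * (\<xi> t \<bullet> x' t) = (\<Sum>i<m. (h i t)\<^sup>2)"
    using arg_cong[OF lam(2)[OF t], of "\<lambda>v. \<xi> t \<bullet> v"]
    by (simp add: inner_sum_right h_def power2_eq_square)
  then show ?thesis using energy[OF t] lam(1)[OF t] by (simp add: field_simps)
qed

lemma continuous_on_speed: "continuous_on I (\<lambda>t. 1 / lam t)"
proof -
  have cx: "continuous_on I x"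
    unfolding continuous_on_eq_continuous_within using has_vector_derivative_continuous[OF der_x] by blast
  have ch: "continuous_on I (h i)" if "i < m" for i
    unfolding continuous_on_eq_continuous_within
    using has_vector_derivative_continuous[OF h_has_derivative[OF that]] by blast
  have cY: "continuous_on I (\<lambda>t. Y i (x t))" if "i < m" for i
  proof (rule continuous_on_compose2[OF _ cx])
    show "continuous_on (ball x0 R) (Y i)"
      by (intro continuous_at_imp_continuous_on ballI has_derivative_continuous[OF Y_has_derivative[OF that]])
  qed (use in_ball in auto)
  have "continuous_on I lam"
    unfolding lam_def by (intro continuous_intros ch cY) auto
  moreover have "\<forall>t\<in>I. lam t \<noteq> 0" using lam(1) by force
  ultimately show ?thesis by (intro continuous_intros)
qed

text \<open>The arc length of \<open>x\<close> measured from time \<open>- T\<close>, and the calibration.\<close>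

definition c :: "real \<Rightarrow> real" where "c t = integral {-T..t} (\<lambda>s. 1 / lam s)"

lemma c_has_derivative: "t \<in> I \<Longrightarrow> (c has_vector_derivative 1 / lam t) (at t within I)"
  unfolding c_def[abs_def] by (rule integral_has_vector_derivative[OF continuous_on_speed])

definition F :: "real \<Rightarrow> 'a \<Rightarrow> real" where
  "F K z = c (\<tau> z) + \<xi> (\<tau> z) \<bullet> (z - x (\<tau> z)) - K / 2 * \<tau> z * (norm (z - x (\<tau> z)))\<^sup>2"

lemma F_x: "t \<in> I \<Longrightarrow> F K (x t) = c t"
  by (simp add: F_def \<tau>_x)

lemma F_has_derivative:
  assumes "\<bar>\<tau> z\<bar> < T"
  shows "(F K has_derivative (\<lambda>v. \<omega> K (\<tau> z) (z - x (\<tau> z)) \<bullet> v)) (at z)"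
proof -
  define t where "t = \<tau> z"
  define y where "y = z - x t"
  have t: "t \<in> I" "t \<in> interior I" using assms by (auto simp: t_def)
  have at: "at t within I = at t" using at_within_interior[OF t(2)] .
  have d\<tau>: "(\<tau> has_derivative (\<lambda>v. \<xi> 0 \<bullet> v)) (at z)"
    unfolding \<tau>_def[abs_def] by (auto intro!: derivative_eq_intros)
  have dx: "((\<lambda>z. x (\<tau> z)) has_derivative (\<lambda>v. (\<xi> 0 \<bullet> v) *\<^sub>R x' t)) (at z)"
    using has_derivative_compose[OF d\<tau>] der_x[OF t(1)] unfolding has_vector_derivative_def at
    by (auto simp: t_def)
  have d\<xi>: "((\<lambda>z. \<xi> (\<tau> z)) has_derivative (\<lambda>v. (\<xi> 0 \<bullet> v) *\<^sub>R \<xi>' t)) (at z)"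
    using has_derivative_compose[OF d\<tau>] der_\<xi>[OF t(1)] unfolding has_vector_derivative_def at
    by (auto simp: t_def)
  have dc: "((\<lambda>z. c (\<tau> z)) has_derivative (\<lambda>v. (\<xi> 0 \<bullet> v) *\<^sub>R (1 / lam t))) (at z)"
    using has_derivative_compose[OF d\<tau>] c_has_derivative[OF t(1)] unfolding has_vector_derivative_def at
    by (auto simp: t_def)
  have dw: "((\<lambda>z. z - x (\<tau> z)) has_derivative (\<lambda>v. v - (\<xi> 0 \<bullet> v) *\<^sub>R x' t)) (at z)"
    by (intro has_derivative_diff has_derivative_ident dx)
  have "(F K has_derivative (\<lambda>v. (\<xi> 0 \<bullet> v) *\<^sub>R (1 / lam t)
      + (\<xi> t \<bullet> (v - (\<xi> 0 \<bullet> v) *\<^sub>R x' t) + ((\<xi> 0 \<bullet> v) *\<^sub>R \<xi>' t) \<bullet> y)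
      - K / 2 * (t * (y \<bullet> (v - (\<xi> 0 \<bullet> v) *\<^sub>R x' t) + (v - (\<xi> 0 \<bullet> v) *\<^sub>R x' t) \<bullet> y) + (\<xi> 0 \<bullet> v) * (y \<bullet> y)))) (at z)"
    unfolding F_def[abs_def] power2_norm_eq_inner mult.assoc y_def t_def
    by (intro has_derivative_diff has_derivative_add has_derivative_inner has_derivative_mult_right
        has_derivative_mult dc[unfolded t_def] d\<xi>[unfolded t_def] dw[unfolded t_def] d\<tau>)
  moreover have "(\<xi> 0 \<bullet> v) *\<^sub>R (1 / lam t)
      + (\<xi> t \<bullet> (v - (\<xi> 0 \<bullet> v) *\<^sub>R x' t) + ((\<xi> 0 \<bullet> v) *\<^sub>R \<xi>' t) \<bullet> y)
      - K / 2 * (t * (y \<bullet> (v - (\<xi> 0 \<bullet> v) *\<^sub>R x' t) + (v - (\<xi> 0 \<bullet> v) *\<^sub>R x' t) \<bullet> y) + (\<xi> 0 \<bullet> v) * (y \<bullet> y))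
    = \<omega> K t y \<bullet> v" for v
    unfolding \<omega>_def \<beta>_def using \<xi>_x'[OF t(1)]
    by (simp add: inner_diff_left inner_diff_right inner_add_left power2_norm_eq_inner inner_commute algebra_simps)
  ultimately show ?thesis by (simp add: t_def y_def)
qed

text \<open>The calibration \<open>f\<close> on a ball around \<open>x0\<close>, together with the controls \<open>u\<close> of the extremal. Along the
  extremal \<open>f\<close> grows with the speed of the extremal. Along any admissible curve it grows at most with
  the speed of that curve, since its differential has energy at most 1 on the frame.\<close>

lemma calibration:
  shows "\<exists>r>0. \<exists>S>0. \<exists>f f' B u. r \<le> R \<and>
     (\<forall>t\<in>{0..S}. x t \<in> ball x0 r \<and>
        (x has_vector_derivative (\<Sum>i<m. u i t *\<^sub>R Y i (x t))) (at t within {0..S}) \<and>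
        ((\<lambda>t. f (x t)) has_vector_derivative sqrt (\<Sum>i<m. (u i t)\<^sup>2)) (at t within {0..S}) \<and>
        0 < sqrt (\<Sum>i<m. (u i t)\<^sup>2)) \<and>
     continuous_on {0..S} (\<lambda>t. sqrt (\<Sum>i<m. (u i t)\<^sup>2)) \<and>
     B-lipschitz_on (ball x0 r) f \<and>
     (\<forall>z\<in>ball x0 r. (f has_derivative f' z) (at z) \<and> (\<Sum>i<m. (f' z (Y i z))\<^sup>2) \<le> 1)"
proof -
  define K where "K = 2 * C0"
  have K0: "0 \<le> K" using C0_nonneg by (simp add: K_def)
  have M2: "1 \<le> M\<^sup>2" "M \<le> M\<^sup>2" using M(1) self_le_power[of M 2] one_le_power[of M 2] by auto
  \<comment> \<open>Points within distance \<open>r\<close> of \<open>x0\<close> have \<open>|\<tau> z| \<le> M r\<close> and \<open>|z - x (\<tau> z)| \<le> 2 M\<^sup>2 r\<close>, so the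
    smallness conditions of the energy estimate hold.\<close>
  define r where "r = min R (min (T / (2 * M)) (1 / (2 * M\<^sup>2 * (K + 1))))"
  have "0 < 2 * M\<^sup>2 * (K + 1)" using M2(1) K0 by (intro mult_pos_pos) linarith+
  then have r: "0 < r" "r \<le> R" "r \<le> T / (2 * M)" "r \<le> 1 / (2 * M\<^sup>2 * (K + 1))"
    using R T M(1) by (auto simp: r_def)
  have rM: "M * r < T" using r(3) T M(1) by (simp add: field_simps)
  have rK: "2 * M\<^sup>2 * r * (K + 1) \<le> 1"
    using r(4) \<open>0 < 2 * M\<^sup>2 * (K + 1)\<close> by (simp add: pos_le_divide_eq mult_ac)
  have near: "\<bar>\<tau> z\<bar> < T" "K * \<bar>\<tau> z\<bar> \<le> 1" "K * norm (z - x (\<tau> z)) \<le> 1" "norm (z - x (\<tau> z)) \<le> 1"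
    if z: "z \<in> ball x0 r" for z
  proof -
    have zr: "norm (z - x0) \<le> r" using z by (simp add: dist_norm norm_minus_commute)
    have "\<bar>\<tau> z\<bar> \<le> norm (\<xi> 0) * norm (z - x0)" unfolding \<tau>_def by (rule Cauchy_Schwarz_ineq2)
    also have "\<dots> \<le> M * r" using M M0 zr by (intro mult_mono) auto
    finally have \<tau>r: "\<bar>\<tau> z\<bar> \<le> M * r" .
    then show \<tau>T: "\<bar>\<tau> z\<bar> < T" using rM by simp
    then have "\<tau> z \<in> I" by auto
    have "norm (z - x (\<tau> z)) \<le> norm (z - x0) + norm (x (\<tau> z) - x0)"
      using norm_triangle_ineq4[of "z - x0" "x (\<tau> z) - x0"] by simp
    also have "\<dots> \<le> r + M * (M * r)"
      using zr order_trans[OF x_bound[OF \<open>\<tau> z \<in> I\<close>] mult_left_mono[OF \<tau>r M0]] by (rule add_mono)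
    also have "\<dots> \<le> 2 * M\<^sup>2 * r"
      using mult_right_mono[OF M2(1), of r] r(1) by (simp add: power2_eq_square)
    finally have n: "norm (z - x (\<tau> z)) \<le> 2 * M\<^sup>2 * r" .
    have \<tau>2: "\<bar>\<tau> z\<bar> \<le> 2 * M\<^sup>2 * r"
    proof -
      have "M * r \<le> M\<^sup>2 * r" using M2(2) r(1) by (intro mult_right_mono) auto
      moreover have "0 \<le> M\<^sup>2 * r" using r(1) by simp
      ultimately show ?thesis using \<tau>r unfolding mult.assoc by linarith
    qed
    have s: "K * s \<le> 1" "s \<le> 1" if "0 \<le> s" "s \<le> 2 * M\<^sup>2 * r" for s
    proof -
      have "s * (K + 1) \<le> 2 * M\<^sup>2 * r * (K + 1)" using that K0 by (intro mult_right_mono) auto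
      then have "s * K + s \<le> 1" using rK by (simp add: distrib_left)
      moreover have "0 \<le> s * K" using that K0 by simp
      ultimately show "K * s \<le> 1" "s \<le> 1" using that by (simp_all add: mult.commute)
    qed
    show "K * \<bar>\<tau> z\<bar> \<le> 1" using s(1)[OF _ \<tau>2] by simp
    show "K * norm (z - x (\<tau> z)) \<le> 1" "norm (z - x (\<tau> z)) \<le> 1" using s[OF _ n] by simp_all
  qed
  define f' where "f' = (\<lambda>z v. \<omega> K (\<tau> z) (z - x (\<tau> z)) \<bullet> v)"
  have f': "(F K has_derivative f' z) (at z)" if "z \<in> ball x0 r" for z
    unfolding f'_def by (rule F_has_derivative[OF near(1)[OF that]])
  have tI: "\<tau> z \<in> I" if "z \<in> ball x0 r" for z using near(1)[OF that] by auto
  have calib: "(\<Sum>i<m. (f' z (Y i z))\<^sup>2) \<le> 1" if z: "z \<in> ball x0 r" for z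
  proof -
    have "x (\<tau> z) + (z - x (\<tau> z)) \<in> ball x0 R" using z r(2) by simp
    from energy_estimate[OF tI[OF z] K0 near(2-4)[OF z] this] show ?thesis
      by (simp add: f'_def K_def)
  qed
  have lip: "(5 * M\<^sup>2)-lipschitz_on (ball x0 r) (F K)"
  proof (rule lipschitz_onI)
    fix z w assume zw: "z \<in> ball x0 r" "w \<in> ball x0 r"
    have "norm (F K z - F K w) \<le> (5 * M\<^sup>2) * norm (z - w)"
    proof (rule differentiable_bound[OF convex_ball])
      show "(F K has_derivative f' z) (at z within ball x0 r)" if "z \<in> ball x0 r" for z
        using has_derivative_at_withinI[OF f'[OF that]] .
      show "onorm (f' z) \<le> 5 * M\<^sup>2" if z: "z \<in> ball x0 r" for z
      proof (rule onorm_bound)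
        fix v
        have "norm (f' z v) \<le> norm (\<omega> K (\<tau> z) (z - x (\<tau> z))) * norm v"
          unfolding f'_def real_norm_def by (rule Cauchy_Schwarz_ineq2)
        also have "\<dots> \<le> (5 * M\<^sup>2) * norm v"
          by (intro mult_right_mono \<omega>_bound[OF tI[OF z] K0 near(2-4)[OF z]]) auto
        finally show "norm (f' z v) \<le> 5 * M\<^sup>2 * norm v" .
      qed simp
    qed (use zw in auto)
    then show "dist (F K z) (F K w) \<le> 5 * M\<^sup>2 * dist z w" by (simp add: dist_norm)
  qed simp
  define S where "S = min T (r / (2 * M))"
  have S: "0 < S" "S \<le> T" "M * S < r"
  proof -
    show "0 < S" using T r(1) M(1) by (simp add: S_def)
    show "S \<le> T" by (simp add: S_def)
    have "M * S \<le> M * (r / (2 * M))" using M0 by (intro mult_left_mono) (auto simp: S_def)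
    then show "M * S < r" using r(1) M(1) by simp
  qed
  have SI: "{0..S} \<subseteq> I" using S by auto
  define u where "u = (\<lambda>i t. h i t / lam t)"
  have speed: "sqrt (\<Sum>i<m. (u i t)\<^sup>2) = 1 / lam t" if "t \<in> I" for t
  proof -
    have "(\<Sum>i<m. (u i t)\<^sup>2) = (\<Sum>i<m. (h i t)\<^sup>2) / (lam t)\<^sup>2"
      by (simp add: u_def power_divide sum_divide_distrib)
    then show ?thesis using energy[OF that] lam(1)[OF that] by (simp add: real_sqrt_divide)
  qed
  have x': "x' t = (\<Sum>i<m. u i t *\<^sub>R Y i (x t))" if "t \<in> I" for t
  proof -
    have "x' t = (1 / lam t) *\<^sub>R (lam t *\<^sub>R x' t)" using lam(1)[OF that] by simp
    also have "\<dots> = (\<Sum>i<m. u i t *\<^sub>R Y i (x t))"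
      unfolding lam(2)[OF that] by (simp add: u_def scaleR_sum_right)
    finally show ?thesis .
  qed
  show ?thesis
  proof (rule exI[of _ r], rule conjI[OF r(1)], rule exI[of _ S], rule conjI[OF S(1)], rule exI[of _ "F K"],
      rule exI[of _ f'], rule exI[of _ "5 * M\<^sup>2"], rule exI[of _ u], intro conjI ballI)
    fix t assume t: "t \<in> {0..S}"
    then have tt: "t \<in> I" using SI by auto
    have "M * \<bar>t\<bar> \<le> M * S" using t M0 by (intro mult_left_mono) auto
    then show "x t \<in> ball x0 r"
      using x_bound[OF tt] S(3) by (simp add: dist_norm norm_minus_commute)
    show "(x has_vector_derivative (\<Sum>i<m. u i t *\<^sub>R Y i (x t))) (at t within {0..S})"
      using has_vector_derivative_within_subset[OF der_x[OF tt] SI] x'[OF tt] by simp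
    show "((\<lambda>t. F K (x t)) has_vector_derivative sqrt (\<Sum>i<m. (u i t)\<^sup>2)) (at t within {0..S})"
      unfolding speed[OF tt]
      by (rule has_vector_derivative_transform[OF t _ has_vector_derivative_within_subset[OF c_has_derivative[OF tt] SI]])
        (use SI F_x in auto)
    show "0 < sqrt (\<Sum>i<m. (u i t)\<^sup>2)"
      using lam(1)[OF tt] by (simp add: speed[OF tt])
  next
    have "continuous_on {0..S} (\<lambda>t. 1 / lam t)" using continuous_on_subset[OF continuous_on_speed SI] .
    then show "continuous_on {0..S} (\<lambda>t. sqrt (\<Sum>i<m. (u i t)\<^sup>2))"
      by (rule continuous_on_eq) (use speed SI in auto)
  qed (use r S lip f' calib in auto)
qed

end

context C11_frame
begin

text \<open>The extremal starts with a covector \<open>\<xi>0\<close> proportional to a nonzero frame vector \<open>Y i0 x0\<close>. By the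
  choice of the factor it has energy 1, so that the time change equals 1 at time 0 and stays at
  least \<open>1/2\<close> nearby.\<close>

lemma normal_extremal_exists:
  assumes i0: "i0 < m" "Y i0 x0 \<noteq> 0"
  shows "\<exists>x \<xi> x' \<xi>' T M. normal_extremal x0 R L m Y D x \<xi> x' \<xi>' T M"
proof -
  define N where "N = (\<Sum>i<m. (Y i0 x0 \<bullet> Y i x0)\<^sup>2)"
  have "0 < (Y i0 x0 \<bullet> Y i0 x0)\<^sup>2" using i0 by simp
  also have "\<dots> \<le> N" unfolding N_def using i0 by (intro member_le_sum) auto
  finally have N: "0 < N" .
  define \<xi>0 where "\<xi>0 = (1 / sqrt N) *\<^sub>R Y i0 x0"
  have \<xi>0: "(\<Sum>i<m. (\<xi>0 \<bullet> Y i x0)\<^sup>2) = 1"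
  proof -
    have "(\<Sum>i<m. (\<xi>0 \<bullet> Y i x0)\<^sup>2) = (1 / sqrt N)\<^sup>2 * N"
      by (simp add: \<xi>0_def N_def power_mult_distrib sum_distrib_left power_divide sum_divide_distrib)
    then show ?thesis using N by (simp add: power_divide)
  qed
  define V where "V = (\<lambda>z. \<Sum>i<m. (snd z \<bullet> Y i (fst z)) *\<^sub>R Y i (fst z))"
  define W where "W = (\<lambda>z. \<Sum>i<m. (snd z \<bullet> Y i (fst z)) *\<^sub>R (\<Sum>b\<in>Basis. (snd z \<bullet> D i (fst z) b) *\<^sub>R b))"
  define lm where "lm = (\<lambda>z. \<xi>0 \<bullet> V z)"
  define z0 where "z0 = (x0, \<xi>0)"
  have lm0: "lm z0 = 1"
    using \<xi>0 by (simp add: lm_def V_def z0_def inner_sum_right power2_eq_square)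
  define B where "B = ball z0 R"
  have fstB: "fst z \<in> ball x0 R" if "z \<in> B" for z
    using that dist_fst_le[of z0 z] by (simp add: B_def z0_def)
  have lf: "bdd_lipschitz_on B fst" and ls: "bdd_lipschitz_on B snd"
    by (auto simp: B_def intro: bdd_lipschitz_on_fst bdd_lipschitz_on_snd)
  have lY0: "bdd_lipschitz_on (ball x0 R) (Y i)" if "i < m" for i
    using C11_bounds_lipschitz[OF bounds[OF that] convex_ball] bounds[OF that]
    by (intro bdd_lipschitz_onI[of _ _ L L]) (auto simp: C11_bounds_def dist_norm)
  have lD0: "bdd_lipschitz_on (ball x0 R) (\<lambda>x. D i x b)" if "i < m" for i b
    using bounds[OF that]
    by (intro bdd_lipschitz_onI[of _ _ "L * norm b" "L * norm b"]) (auto simp: C11_bounds_def dist_norm)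
  have lY: "bdd_lipschitz_on B (\<lambda>z. Y i (fst z))" if "i < m" for i
    by (rule bdd_lipschitz_on_compose[OF lY0[OF that] lf]) (use fstB in auto)
  have lD: "bdd_lipschitz_on B (\<lambda>z. D i (fst z) b)" if "i < m" for i b
    by (rule bdd_lipschitz_on_compose[OF lD0[OF that] lf]) (use fstB in auto)
  have lV: "bdd_lipschitz_on B V" unfolding V_def
    by (intro bdd_lipschitz_on_sum bdd_lipschitz_on_scaleR bdd_lipschitz_on_inner ls lY) auto
  have lW: "bdd_lipschitz_on B W" unfolding W_def
    by (intro bdd_lipschitz_on_sum bdd_lipschitz_on_scaleR bdd_lipschitz_on_inner bdd_lipschitz_on_const ls lY lD) auto
  have llm: "bdd_lipschitz_on B lm" unfolding lm_def
    by (intro bdd_lipschitz_on_inner bdd_lipschitz_on_const lV)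
  obtain C where C: "0 < C" "\<And>z w. z \<in> B \<Longrightarrow> w \<in> B \<Longrightarrow> norm (lm z - lm w) \<le> C * dist z w"
    using llm by (metis bdd_lipschitz_onE)
  define \<rho> where "\<rho> = min (R / 2) (1 / (2 * C))"
  have \<rho>: "0 < \<rho>" "\<rho> < R" "C * \<rho> \<le> 1 / 2"
  proof -
    show "0 < \<rho>" "\<rho> < R" using R C(1) by (auto simp: \<rho>_def)
    have "C * \<rho> \<le> C * (1 / (2 * C))" using C(1) by (intro mult_left_mono) (auto simp: \<rho>_def)
    then show "C * \<rho> \<le> 1 / 2" using C(1) by simp
  qed
  define S where "S = cball z0 \<rho>"
  have SB: "S \<subseteq> B" using \<rho> by (auto simp: S_def B_def)
  have lmS: "1/2 \<le> lm z" if "z \<in> S" for z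
  proof -
    have "z0 \<in> B" using R by (simp add: B_def)
    then have "norm (lm z - lm z0) \<le> C * dist z z0" using C(2) SB that by blast
    also have "\<dots> \<le> C * \<rho>" using that C(1) by (intro mult_left_mono) (auto simp: S_def dist_commute)
    finally show ?thesis using \<rho>(3) lm0 by simp
  qed
  have linv: "bdd_lipschitz_on S (\<lambda>z. inverse (lm z))"
    by (rule bdd_lipschitz_on_compose[OF bdd_lipschitz_on_inverse_atLeast[of "1/2"] bdd_lipschitz_on_subset[OF llm SB]])
      (use lmS in auto)
  define \<Phi> where "\<Phi> = (\<lambda>z. (inverse (lm z) *\<^sub>R V z, inverse (lm z) *\<^sub>R ((-1) *\<^sub>R W z)))"
  have "bdd_lipschitz_on S \<Phi>" unfolding \<Phi>_def
    by (intro bdd_lipschitz_on_Pair bdd_lipschitz_on_scaleR bdd_lipschitz_on_const linv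
        bdd_lipschitz_on_subset[OF lV SB] bdd_lipschitz_on_subset[OF lW SB])
  then obtain Q P where Q: "Q-lipschitz_on S \<Phi>" and P: "\<And>z. z \<in> S \<Longrightarrow> norm (\<Phi> z) \<le> P"
    by (auto simp: bdd_lipschitz_on_def bounded_iff)
  obtain T z where T: "0 < T" and z: "z 0 = z0" "\<And>t. t \<in> {-T..T} \<Longrightarrow> z t \<in> S"
    "\<And>t. t \<in> {-T..T} \<Longrightarrow> (z has_vector_derivative \<Phi> (z t)) (at t within {-T..T})"
    using picard_lindelof[OF \<rho>(1) Q[unfolded S_def]] by (auto simp: S_def)
  define M where "M = Max {1, L, norm \<xi>0 + \<rho>, P}"
  have M: "1 \<le> M" "L \<le> M" "norm \<xi>0 + \<rho> \<le> M" "P \<le> M" by (auto simp: M_def)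
  have nfst: "norm (fst w) \<le> norm w" "norm (snd w) \<le> norm w" for w :: "'e \<times> 'e"
    using norm_fst_le norm_snd_le by (metis prod.collapse)+
  have "normal_extremal x0 R L m Y D (\<lambda>t. fst (z t)) (\<lambda>t. snd (z t)) (\<lambda>t. fst (\<Phi> (z t))) (\<lambda>t. snd (\<Phi> (z t))) T M"
  proof unfold_locales
    show "0 < T" "1 \<le> M" "L \<le> M" by fact+
    show "norm (snd (z 0)) \<le> M" using M(3) \<rho>(1) by (simp add: z(1) z0_def)
    show "fst (z 0) = x0" by (simp add: z(1) z0_def)
    show "(\<Sum>i<m. (snd (z 0) \<bullet> Y i x0)\<^sup>2) = 1" using \<xi>0 by (simp add: z(1) z0_def)
    fix t assume t: "t \<in> {-T..T}"
    note zt = z(2)[OF t]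
    show "fst (z t) \<in> ball x0 R" using fstB SB zt by blast
    show "((\<lambda>t. fst (z t)) has_vector_derivative fst (\<Phi> (z t))) (at t within {-T..T})"
      by (rule bounded_linear.has_vector_derivative[OF bounded_linear_fst z(3)[OF t]])
    show "((\<lambda>t. snd (z t)) has_vector_derivative snd (\<Phi> (z t))) (at t within {-T..T})"
      by (rule bounded_linear.has_vector_derivative[OF bounded_linear_snd z(3)[OF t]])
    have lm_eq: "snd (z 0) \<bullet> (\<Sum>i<m. (snd (z t) \<bullet> Y i (fst (z t))) *\<^sub>R Y i (fst (z t))) = lm (z t)"
      by (simp add: lm_def V_def z(1) z0_def)
    show "1/2 \<le> snd (z 0) \<bullet> (\<Sum>i<m. (snd (z t) \<bullet> Y i (fst (z t))) *\<^sub>R Y i (fst (z t)))"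
      unfolding lm_eq by (rule lmS[OF zt])
    have lmpos: "lm (z t) \<noteq> 0" using lmS[OF zt] by auto
    show "(snd (z 0) \<bullet> (\<Sum>i<m. (snd (z t) \<bullet> Y i (fst (z t))) *\<^sub>R Y i (fst (z t)))) *\<^sub>R fst (\<Phi> (z t))
        = (\<Sum>i<m. (snd (z t) \<bullet> Y i (fst (z t))) *\<^sub>R Y i (fst (z t)))"
      unfolding lm_eq using lmpos by (simp add: \<Phi>_def V_def)
    show "(snd (z 0) \<bullet> (\<Sum>i<m. (snd (z t) \<bullet> Y i (fst (z t))) *\<^sub>R Y i (fst (z t)))) * (snd (\<Phi> (z t)) \<bullet> v)
        = - (\<Sum>i<m. (snd (z t) \<bullet> Y i (fst (z t))) * (snd (z t) \<bullet> D i (fst (z t)) v))" for v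
    proof -
      have "W (z t) \<bullet> v = (\<Sum>i<m. (snd (z t) \<bullet> Y i (fst (z t))) * (snd (z t) \<bullet> D i (fst (z t)) v))"
      proof -
        have "(\<Sum>b\<in>Basis. (snd (z t) \<bullet> D i (fst (z t)) b) *\<^sub>R b) \<bullet> v = snd (z t) \<bullet> D i (fst (z t)) v" if "i < m" for i
        proof -
          have "linear (D i (fst (z t)))"
            using bounds[OF that] fstB SB zt has_derivative_linear unfolding C11_bounds_def by blast
          from linear_eq_sum_Basis[OF this, of v] show ?thesis
            by (simp add: inner_sum_left inner_sum_right inner_commute mult.commute)
        qed
        then show ?thesis unfolding W_def by (simp add: inner_sum_left)
      qed
      then show ?thesis unfolding lm_eq using lmpos by (simp add: \<Phi>_def)
    qed
    have "norm (\<Phi> (z t)) \<le> M" using P[OF zt] M(4) by simp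
    moreover have "norm (snd (z t)) \<le> M"
    proof -
      have "dist \<xi>0 (snd (z t)) \<le> \<rho>"
        using zt dist_snd_le[of z0 "z t"] by (simp add: S_def z0_def)
      then show ?thesis using M(3) norm_triangle_sub[of "snd (z t)" \<xi>0] by (simp add: dist_norm norm_minus_commute)
    qed
    ultimately show "norm (snd (z t)) \<le> M \<and> norm (fst (\<Phi> (z t))) \<le> M \<and> norm (snd (\<Phi> (z t))) \<le> M"
      using nfst[of "\<Phi> (z t)"] by simp
  qed
  then show ?thesis by blast
qed

end

section \<open>Admissible curves in a chart\<close>

lemma tangent_space_transition:
  assumes "v \<in> tangent_space A q" "c \<in> A" "c' \<in> A" "q \<in> fst c" "q \<in> fst c'"
  shows "v c' = frechet_derivative (snd c' \<circ> chart_inv c) (at (snd c q)) (v c)"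
proof -
  have "\<forall>c\<in>A. \<forall>c'\<in>A. q \<in> fst c \<inter> fst c' \<longrightarrow>
      v c' = frechet_derivative (snd c' \<circ> chart_inv c) (at (snd c q)) (v c)"
    using assms(1) unfolding tangent_space_def mem_Collect_eq by (rule conjunct2)
  then show ?thesis using assms(2-) by blast
qed

lemma tangent_space_outside:
  assumes "v \<in> tangent_space A q" "\<not> (c \<in> A \<and> q \<in> fst c)"
  shows "v c = 0"
proof -
  have "\<forall>c. \<not> (c \<in> A \<and> q \<in> fst c) \<longrightarrow> v c = 0"
    using assms(1) unfolding tangent_space_def mem_Collect_eq by (rule conjunct1)
  then show ?thesis using assms(2) by blast
qed

context connected_smooth_manifold
begin

lemma chart_chart_inv: "c \<in> A \<Longrightarrow> z \<in> snd c ` S \<Longrightarrow> S \<subseteq> fst c \<Longrightarrow> chart_inv c z \<in> S \<and> snd c (chart_inv c z) = z"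
  using chart_inv_chart by auto

lemma continuous_map_chart_inv:
  assumes c: "c \<in> A"
  shows "continuous_map (top_of_set (snd c ` fst c)) X (chart_inv c)"
proof -
  obtain \<psi> where \<psi>: "homeomorphic_maps (subtopology X (fst c)) (top_of_set (snd c ` fst c)) (snd c) \<psi>"
    using homeomorphic_chart[OF c] homeomorphic_map_maps by blast
  have sub: "fst c \<subseteq> topspace X" using openin_subset[OF openin_chart_domain[OF c]] .
  have "continuous_map (top_of_set (snd c ` fst c)) X \<psi>"
    using \<psi> by (auto simp: homeomorphic_maps_def intro: continuous_map_into_fulltopology)
  moreover have "\<psi> z = chart_inv c z" if "z \<in> snd c ` fst c" for z
    using \<psi> that sub chart_inv_chart[OF c]
    by (auto simp: homeomorphic_maps_def topspace_subtopology)
  ultimately show ?thesis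
    by (auto intro: continuous_map_eq)
qed

lemma continuous_map_chart: "c \<in> A \<Longrightarrow> continuous_map (subtopology X (fst c)) euclidean (snd c)"
  using homeomorphic_chart[of c] continuous_map_into_fulltopology
  by (auto dest!: homeomorphic_imp_continuous_map)

lemma openin_chart_preimage:
  assumes "c \<in> A" "open U"
  shows "openin X {q \<in> fst c. snd c q \<in> U}"
proof -
  have top: "topspace (subtopology X (fst c)) = fst c"
    using openin_subset[OF openin_chart_domain[OF assms(1)]] by (simp add: inf_absorb2)
  have "openin (subtopology X (fst c)) {q \<in> topspace (subtopology X (fst c)). snd c q \<in> U}"
    by (rule openin_continuous_map_preimage[OF continuous_map_chart[OF assms(1)]]) (use assms(2) in simp)
  then show ?thesis
    unfolding top by (rule openin_trans_full[OF _ openin_chart_domain[OF assms(1)]])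
qed

lemma closedin_chart_preimage:
  assumes c: "c \<in> A" and K: "compact K" "K \<subseteq> snd c ` fst c"
  shows "closedin X {q \<in> fst c. snd c q \<in> K}"
proof -
  have "compactin X (chart_inv c ` K)"
    by (rule image_compactin[OF _ continuous_map_chart_inv[OF c]])
      (use K in \<open>simp add: compactin_subtopology\<close>)
  moreover have "chart_inv c ` K = {q \<in> fst c. snd c q \<in> K}"
    using K(2) chart_inv_chart[OF c] chart_chart_inv[OF c, of _ "fst c"] by force
  ultimately show ?thesis using compactin_imp_closedin[OF Hausdorff] by simp
qed

lemma transition_differentiable:
  assumes "c \<in> A" "c' \<in> A" "q \<in> fst c" "q \<in> fst c'"
  shows "(snd c' \<circ> chart_inv c) differentiable (at (snd c q))"
proof -
  have "Ck_on 1 (snd c ` (fst c \<inter> fst c')) (snd c' \<circ> chart_inv c)"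
    using smooth_transition[OF assms(1,2)] by (simp add: smooth_on_def)
  then show ?thesis using assms by auto
qed

lemma transition_has_derivative:
  assumes "c \<in> A" "c' \<in> A" "q \<in> fst c" "q \<in> fst c'"
  shows "((snd c' \<circ> chart_inv c) has_derivative frechet_derivative (snd c' \<circ> chart_inv c) (at (snd c q))) (at (snd c q))"
  using transition_differentiable[OF assms] frechet_derivative_works by blast

lemma transition_C1:
  assumes "c \<in> A" "c' \<in> A"
  shows "continuous_on (snd c ` (fst c \<inter> fst c')) (\<lambda>z. frechet_derivative (snd c' \<circ> chart_inv c) (at z) v)"
proof -
  have "Ck_on 1 (snd c ` (fst c \<inter> fst c')) (snd c' \<circ> chart_inv c)"
    using smooth_transition[OF assms(1,2)] by (simp add: smooth_on_def)
  then show ?thesis by simp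
qed

lemma tangent_vector_eq_0:
  assumes v: "v \<in> tangent_space A q" and c: "c \<in> A" "q \<in> fst c" and 0: "v c = 0"
  shows "v = 0"
proof
  fix c'
  show "v c' = 0 c'"
  proof (cases "c' \<in> A \<and> q \<in> fst c'")
    case True
    then have "v c' = frechet_derivative (snd c' \<circ> chart_inv c) (at (snd c q)) (v c)"
      using tangent_space_transition[OF v] c by blast
    also have "\<dots> = frechet_derivative (snd c' \<circ> chart_inv c) (at (snd c q)) 0"
      unfolding 0 ..
    also have "\<dots> = 0"
      using transition_has_derivative[of c c' q] c True by (metis has_derivative_linear linear_0)
    finally show ?thesis by simp
  qed (use tangent_space_outside[OF v] in simp)
qed

end

context C11_sub_Riemannian_manifold
begin

text \<open>A function whose differential has norm at most 1 on the distribution grows along an admissible curve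
  at most by its length. Only the initial part of the curve, up to time \<open>s\<close>, has to lie in the domain
  of the function.\<close>

lemma increment_le_length:
  assumes adm: "admissible X A \<Delta> a b \<eta>" and s: "a \<le> s" "s \<le> b"
    and c: "c \<in> A" and W: "W \<subseteq> topspace X"
    and spanZ: "\<And>q. q \<in> W \<Longrightarrow> \<Delta> q = span ((\<lambda>i. Z i q) ` {..<m})"
    and onZ: "\<And>q i j. q \<in> W \<Longrightarrow> i < m \<Longrightarrow> j < m \<Longrightarrow> g q (Z i q) (Z j q) = (if i = j then 1 else 0)"
    and \<eta>: "\<And>t. t \<in> {a..s} \<Longrightarrow> \<eta> t \<in> fst c \<inter> W \<and> snd c (\<eta> t) \<in> G"
    and lip: "B-lipschitz_on G f"
    and der: "\<And>q. q \<in> fst c \<inter> W \<Longrightarrow> snd c q \<in> G \<Longrightarrow> (f has_derivative f' (snd c q)) (at (snd c q))"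
    and calib: "\<And>q. q \<in> fst c \<inter> W \<Longrightarrow> snd c q \<in> G \<Longrightarrow> (\<Sum>i<m. (f' (snd c q) (Z i q c))\<^sup>2) \<le> 1"
  shows "ennreal (f (snd c (\<eta> s)) - f (snd c (\<eta> a))) \<le> curve_length A g a b \<eta>"
proof -
  define h where "h = f \<circ> (snd c \<circ> \<eta>)"
  define speed where "speed = (\<lambda>t. sqrt (g (\<eta> t) (velocity A a b \<eta> t) (velocity A a b \<eta> t)))"
  have "absolutely_continuous_on_interval a s (snd c \<circ> \<eta>)"
    using adm c s \<eta> unfolding admissible_def absolutely_continuous_curve_def by blast
  then have AC: "absolutely_continuous_on_interval a s h"
    unfolding h_def by (rule absolutely_continuous_lipschitz_compose[OF _ lip]) (use \<eta> in auto)
  have AE_iff: "(AE t in lebesgue_on {a'..b'}. P t) \<longleftrightarrow> (AE t in lebesgue. t \<in> {a'..b'} \<longrightarrow> P t)"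
    for P and a' b' :: real
    by (rule AE_restrict_space_iff) simp
  have "AE t in lebesgue_on {a..b}. differentiable_curve_at A a b \<eta> t \<and> velocity A a b \<eta> t \<in> \<Delta> (\<eta> t)"
    using adm by (simp add: admissible_def)
  then have "AE t in lebesgue. t \<in> {a..b} \<longrightarrow> differentiable_curve_at A a b \<eta> t \<and> velocity A a b \<eta> t \<in> \<Delta> (\<eta> t)"
    unfolding AE_iff .
  then have "AE t in lebesgue. t \<in> {a..s} \<longrightarrow> (\<exists>d. (h has_vector_derivative d) (at t within {a..s}) \<and> d \<le> speed t)"
  proof (rule AE_mp, intro AE_I2 impI)
    fix t assume good: "t \<in> {a..b} \<longrightarrow> differentiable_curve_at A a b \<eta> t \<and> velocity A a b \<eta> t \<in> \<Delta> (\<eta> t)"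
      and t: "t \<in> {a..s}"
    define q where "q = \<eta> t"
    define z where "z = snd c q"
    define v where "v = velocity A a b \<eta> t"
    have q: "q \<in> fst c \<inter> W" "z \<in> G" using \<eta>[OF t] by (auto simp: q_def z_def)
    have tab: "t \<in> {a..b}" using t s by auto
    have diff: "(snd c \<circ> \<eta>) differentiable (at t within {a..b})" and v\<Delta>: "v \<in> \<Delta> q"
      using good tab c q(1) unfolding differentiable_curve_at_def q_def v_def by auto
    have "v c = vector_derivative (snd c \<circ> \<eta>) (at t within {a..b})"
      using c q(1) by (simp add: v_def velocity_def q_def)
    then have "((snd c \<circ> \<eta>) has_vector_derivative v c) (at t within {a..b})"
      using diff vector_derivative_works by metis
    then have "((snd c \<circ> \<eta>) has_vector_derivative v c) (at t within {a..s})"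
      by (rule has_vector_derivative_within_subset) (use s in auto)
    then have hder: "(h has_vector_derivative f' z (v c)) (at t within {a..s})"
      unfolding h_def
      by (rule vector_derivative_diff_chain_within)
        (use has_derivative_at_withinI[OF der[OF q(1) q(2)[unfolded z_def]]] in \<open>simp add: z_def q_def\<close>)
    have "v \<in> span ((\<lambda>i. Z i q) ` {..<m})" using v\<Delta> spanZ[of q] q(1) by simp
    then obtain k where k: "v = (\<Sum>i<m. k i *\<^sub>R Z i q)"
      unfolding span_image_lessThan_iff by (elim exE)
    have top: "q \<in> topspace X" using q(1) W by blast
    have Z\<Delta>: "Z i q \<in> \<Delta> q" if "i < m" for i
      using spanZ[of q] q(1) that by (auto intro: span_base)
    have gv: "g q v v = (\<Sum>i<m. (k i)\<^sup>2)"
      unfolding k using inner_product_on_orthonormal_sum[OF subspace_distribution[OF top] metric_inner_product[OF top]]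
        Z\<Delta> onZ q(1) by auto
    have "linear (f' z)" using der[of q] q by (auto simp: z_def intro: has_derivative_linear)
    then have "f' z (v c) = (\<Sum>i<m. k i * f' z (Z i q c))"
      by (simp add: k sum_fun_apply scaleR_fun_def linear_sum linear_cmul)
    also have "\<dots> \<le> sqrt ((\<Sum>i<m. (k i)\<^sup>2) * (\<Sum>i<m. (f' z (Z i q c))\<^sup>2))"
      by (rule real_le_rsqrt) (rule Cauchy_Schwarz_ineq_sum)
    also have "\<dots> \<le> sqrt ((\<Sum>i<m. (k i)\<^sup>2) * 1)"
      using calib[of q] q by (intro real_sqrt_le_mono mult_left_mono sum_nonneg) (auto simp: z_def)
    also have "\<dots> = speed t" by (simp add: speed_def gv flip: q_def v_def)
    finally show "\<exists>d. (h has_vector_derivative d) (at t within {a..s}) \<and> d \<le> speed t"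
      using hder by blast
  qed
  then have ae: "AE t in lebesgue_on {a..s}. \<exists>d. (h has_vector_derivative d) (at t within {a..s}) \<and> d \<le> speed t"
    unfolding AE_iff .
  have "ennreal (h s - h a) \<le> (\<integral>\<^sup>+ t. ennreal (speed t) \<partial>lebesgue_on {a..s})"
    by (rule absolutely_continuous_increment_le[OF AC s(1) ae])
  also have "\<dots> = (\<integral>\<^sup>+ t. ennreal (speed t) * indicator {a..s} t \<partial>lebesgue)"
    by (rule nn_integral_restrict_space) auto
  also have "\<dots> \<le> (\<integral>\<^sup>+ t. ennreal (speed t) * indicator {a..b} t \<partial>lebesgue)"
    using s by (intro nn_integral_mono) (auto simp: indicator_def)
  also have "\<dots> = (\<integral>\<^sup>+ t. ennreal (speed t) \<partial>lebesgue_on {a..b})"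
    by (rule nn_integral_restrict_space[symmetric]) auto
  also have "\<dots> = curve_length A g a b \<eta>"
    by (simp add: curve_length_def speed_def)
  finally show ?thesis by (simp add: h_def)
qed

text \<open>Admissibility has to be checked in all charts, although the curve is given in the chart \<open>c\<close>.\<close>

lemma chart_curve_admissible:
  assumes c: "c \<in> A" and W: "W \<subseteq> topspace X" and S: "0 < S"
    and CZ: "\<And>i. i < m \<Longrightarrow> C11_vector_field A W (Z i)"
    and spanZ: "\<And>q. q \<in> W \<Longrightarrow> \<Delta> q = span ((\<lambda>i. Z i q) ` {..<m})"
    and onZ: "\<And>q i j. q \<in> W \<Longrightarrow> i < m \<Longrightarrow> j < m \<Longrightarrow> g q (Z i q) (Z j q) = (if i = j then 1 else 0)"
    and x: "\<And>t. t \<in> {0..S} \<Longrightarrow> x t \<in> snd c ` (fst c \<inter> W)"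
    and der: "\<And>t. t \<in> {0..S} \<Longrightarrow>
      (x has_vector_derivative (\<Sum>i<m. u i t *\<^sub>R Z i (chart_inv c (x t)) c)) (at t within {0..S})"
    and bd: "\<And>t. t \<in> {0..S} \<Longrightarrow> norm (\<Sum>i<m. u i t *\<^sub>R Z i (chart_inv c (x t)) c) \<le> B"
  defines "\<gamma> \<equiv> chart_inv c \<circ> x"
  shows "admissible X A \<Delta> 0 S \<gamma>"
    and "\<And>t. t \<in> {0..S} \<Longrightarrow> g (\<gamma> t) (velocity A 0 S \<gamma> t) (velocity A 0 S \<gamma> t) = (\<Sum>i<m. (u i t)\<^sup>2)"
proof -
  define x' where "x' = (\<lambda>t. \<Sum>i<m. u i t *\<^sub>R Z i (\<gamma> t) c)"
  have x': "(x has_vector_derivative x' t) (at t within {0..S})" "norm (x' t) \<le> B" if "t \<in> {0..S}" for t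
    using der[OF that] bd[OF that] by (simp_all add: x'_def \<gamma>_def)
  have B: "0 \<le> B" using x'(2)[of 0] S norm_ge_zero order_trans by (metis atLeastAtMost_iff less_imp_le order_refl)
  have \<gamma>: "\<gamma> t \<in> fst c \<inter> W" "snd c (\<gamma> t) = x t" if "t \<in> {0..S}" for t
    using chart_chart_inv[OF c x[OF that]] by (auto simp: \<gamma>_def)
  define D :: "('a, 'e) chart \<Rightarrow> real \<Rightarrow> 'e \<Rightarrow> 'e"
    where "D = (\<lambda>c' t. frechet_derivative (snd c' \<circ> chart_inv c) (at (x t)))"
  have trans: "((snd c' \<circ> \<gamma>) has_vector_derivative D c' t (x' t)) (at t within {0..S})" "linear (D c' t)"
    if "c' \<in> A" "t \<in> {0..S}" "\<gamma> t \<in> fst c'" for c' t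
  proof -
    have d: "((snd c' \<circ> chart_inv c) has_derivative D c' t) (at (x t))"
      using transition_has_derivative[OF c that(1) _ that(3)] \<gamma>[OF that(2)] by (simp add: D_def)
    show "((snd c' \<circ> \<gamma>) has_vector_derivative D c' t (x' t)) (at t within {0..S})"
      unfolding \<gamma>_def o_assoc
      by (rule vector_derivative_diff_chain_within[OF x'(1)[OF that(2)] has_derivative_at_withinI[OF d]])
    show "linear (D c' t)" using d by (rule has_derivative_linear)
  qed
  have tangent: "Z i q \<in> tangent_space A q" if "q \<in> W" "i < m" for i q
    using CZ[OF that(2)] that(1) by (simp add: C11_vector_field_def)
  have vel: "velocity A 0 S \<gamma> t = (\<Sum>i<m. u i t *\<^sub>R Z i (\<gamma> t))" if t: "t \<in> {0..S}" for t
  proof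
    fix c'
    show "velocity A 0 S \<gamma> t c' = (\<Sum>i<m. u i t *\<^sub>R Z i (\<gamma> t)) c'"
    proof (cases "c' \<in> A \<and> \<gamma> t \<in> fst c'")
      case True
      have Zc': "Z i (\<gamma> t) c' = D c' t (Z i (\<gamma> t) c)" if "i < m" for i
        using tangent_space_transition[OF tangent[OF _ that], of "\<gamma> t" c c'] \<gamma>[OF t] c True
        by (simp add: D_def)
      have "velocity A 0 S \<gamma> t c' = D c' t (x' t)"
        using vector_derivative_within_closed_interval[OF S t trans(1)] True t by (simp add: velocity_def)
      also have "\<dots> = (\<Sum>i<m. u i t *\<^sub>R Z i (\<gamma> t) c')"
        using trans(2)[of c' t] True t Zc' by (simp add: x'_def linear_sum linear_cmul)
      finally show ?thesis by (simp add: sum_fun_apply scaleR_fun_def)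
    next
      case False
      then have "Z i (\<gamma> t) c' = 0" if "i < m" for i
        using tangent_space_outside[OF tangent[OF _ that], of "\<gamma> t" c'] \<gamma>[OF t] by blast
      then show ?thesis using False by (auto simp: velocity_def sum_fun_apply scaleR_fun_def)
    qed
  qed
  have Z\<Delta>: "Z i q \<in> \<Delta> q" if "q \<in> W" "i < m" for i q
    using spanZ[OF that(1)] that(2) by (auto intro: span_base)
  show "g (\<gamma> t) (velocity A 0 S \<gamma> t) (velocity A 0 S \<gamma> t) = (\<Sum>i<m. (u i t)\<^sup>2)" if t: "t \<in> {0..S}" for t
  proof -
    have q: "\<gamma> t \<in> W" "\<gamma> t \<in> topspace X" using \<gamma>[OF t] W by auto
    show ?thesis unfolding vel[OF t]
      using inner_product_on_orthonormal_sum[OF subspace_distribution[OF q(2)] metric_inner_product[OF q(2)]]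
        Z\<Delta>[OF q(1)] onZ[OF q(1)] by auto
  qed
  have cx: "continuous_on {0..S} x"
    unfolding continuous_on_eq_continuous_within using has_vector_derivative_continuous[OF x'(1)] by blast
  show "admissible X A \<Delta> 0 S \<gamma>"
    unfolding admissible_def absolutely_continuous_curve_def
  proof (intro conjI ballI allI impI)
    show "0 \<le> S" using S by simp
    have "continuous_map (top_of_set {0..S}) (top_of_set (snd c ` fst c)) x"
      using cx x by (fastforce simp: continuous_map_in_subtopology)
    from continuous_map_compose[OF this continuous_map_chart_inv[OF c]]
    show "continuous_map (top_of_set {0..S}) X \<gamma>" by (simp add: \<gamma>_def)
    show "AE t in lebesgue_on {0..S}. differentiable_curve_at A 0 S \<gamma> t \<and> velocity A 0 S \<gamma> t \<in> \<Delta> (\<gamma> t)"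
    proof (rule AE_I2)
      fix t assume "t \<in> space (lebesgue_on {0..S})"
      then have t: "t \<in> {0..S}" by simp
      have "differentiable_curve_at A 0 S \<gamma> t"
        unfolding differentiable_curve_at_def using trans(1) t differentiableI_vector by blast
      moreover have "velocity A 0 S \<gamma> t \<in> \<Delta> (\<gamma> t)"
        unfolding vel[OF t] spanZ[OF IntD2[OF \<gamma>(1)[OF t]]] span_image_lessThan_iff
        by (intro exI[of _ "\<lambda>i. u i t"] refl)
      ultimately show "differentiable_curve_at A 0 S \<gamma> t \<and> velocity A 0 S \<gamma> t \<in> \<Delta> (\<gamma> t)" ..
    qed
    fix c' s t assume c': "c' \<in> A" and st: "0 \<le> s \<and> s \<le> t \<and> t \<le> S \<and> \<gamma> ` {s..t} \<subseteq> fst c'"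
    have sub: "{s..t} \<subseteq> {0..S}" using st by auto
    have xO: "x \<tau> \<in> snd c ` (fst c \<inter> fst c')" if "\<tau> \<in> {s..t}" for \<tau>
    proof -
      have "\<gamma> \<tau> \<in> fst c \<inter> fst c'" "snd c (\<gamma> \<tau>) = x \<tau>" using \<gamma>[of \<tau>] sub st that by auto
      then show ?thesis by (metis imageI)
    qed
    have "\<exists>K. \<forall>\<tau>\<in>{s..t}. norm (D c' \<tau> b) \<le> K" for b
    proof -
      have "continuous_on {s..t} (\<lambda>\<tau>. D c' \<tau> b)"
        unfolding D_def
        by (rule continuous_on_compose2[OF transition_C1[OF c c'] continuous_on_subset[OF cx sub]]) (use xO in auto)
      from compact_imp_bounded[OF compact_continuous_image[OF this compact_Icc]]
      show ?thesis by (auto simp: bounded_iff)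
    qed
    then obtain K where K: "\<And>\<tau> b. \<tau> \<in> {s..t} \<Longrightarrow> norm (D c' \<tau> b) \<le> K b" by metis
    have K0: "0 \<le> K b" for b using K[of s b] st norm_ge_zero order_trans by (metis atLeastAtMost_iff order_refl)
    show "absolutely_continuous_on_interval s t (snd c' \<circ> \<gamma>)"
    proof (rule absolutely_continuous_of_bounded_derivative)
      fix \<tau> assume \<tau>: "\<tau> \<in> {s..t}"
      then have \<tau>S: "\<tau> \<in> {0..S}" "\<gamma> \<tau> \<in> fst c'" using sub st by auto
      show "((snd c' \<circ> \<gamma>) has_vector_derivative D c' \<tau> (x' \<tau>)) (at \<tau> within {s..t})"
        using has_vector_derivative_within_subset[OF trans(1)[OF c' \<tau>S] sub] .
      have "norm (D c' \<tau> (x' \<tau>)) = norm (\<Sum>b\<in>Basis. (x' \<tau> \<bullet> b) *\<^sub>R D c' \<tau> b)"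
        using linear_eq_sum_Basis[OF trans(2)[OF c' \<tau>S], of "x' \<tau>"] by simp
      also have "\<dots> \<le> (\<Sum>b\<in>Basis. \<bar>x' \<tau> \<bullet> b\<bar> * norm (D c' \<tau> b))"
        by (rule order_trans[OF norm_sum]) simp
      also have "\<dots> \<le> (\<Sum>b\<in>Basis. B * K b)"
        using K[OF \<tau>] x'(2)[OF \<tau>S(1)] B
        by (intro sum_mono mult_mono) (auto intro: order_trans[OF Basis_le_norm])
      finally show "norm (D c' \<tau> (x' \<tau>)) \<le> (\<Sum>b\<in>Basis. B * K b)" .
    qed (use B K0 in \<open>auto intro!: sum_nonneg\<close>)
  qed
qed

text \<open>A curve that leaves an open coordinate ball has a first exit time, at which it meets the boundary
  sphere. This uses that compact coordinate balls are closed in the manifold, hence the Hausdorff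
  property.\<close>

lemma exit_time:
  fixes a b r :: real
  assumes c: "c \<in> A" and a: "a \<le> b" and \<eta>: "continuous_map (top_of_set {a..b}) X \<eta>"
    and K: "cball x0 r \<subseteq> snd c ` fst c"
    and start: "\<eta> a \<in> fst c" "snd c (\<eta> a) \<in> ball x0 r"
    and exit: "\<not> (\<forall>t\<in>{a..b}. \<eta> t \<in> fst c \<and> snd c (\<eta> t) \<in> ball x0 r)"
  shows "\<exists>s\<in>{a..b}. (\<forall>t\<in>{a..s}. \<eta> t \<in> fst c \<and> snd c (\<eta> t) \<in> cball x0 r) \<and> dist x0 (snd c (\<eta> s)) = r"
proof -
  define N where "N = {q \<in> fst c. snd c q \<in> ball x0 r}"
  define N' where "N' = {q \<in> fst c. snd c q \<in> cball x0 r}"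
  have "openin X N" unfolding N_def by (rule openin_chart_preimage[OF c]) simp
  then have "openin (top_of_set {a..b}) {t \<in> topspace (top_of_set {a..b}). \<eta> t \<in> N}"
    using openin_continuous_map_preimage[OF \<eta>] by blast
  then have clE: "closedin (top_of_set {a..b}) ({a..b} - {t \<in> {a..b}. \<eta> t \<in> N})"
    by (metis closedin_def closedin_diff closedin_topspace topspace_euclidean_subtopology)
  define E where "E = {a..b} - {t \<in> {a..b}. \<eta> t \<in> N}"
  have E: "closed E"
    unfolding E_def by (rule closedin_closed_trans[OF clE closed_atLeastAtMost])
  have E0: "E \<noteq> {}" "bdd_below E" using exit by (auto simp: E_def N_def)
  define s where "s = Inf E"
  have sE: "s \<in> E" unfolding s_def by (rule closed_contains_Inf[OF E0 E])
  have before: "\<eta> t \<in> N" if "t \<in> {a..b}" "t < s" for t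
    using cInf_lower[OF _ E0(2), of t] that by (auto simp: E_def s_def)
  have sab: "s \<in> {a..b}" using sE by (simp add: E_def)
  have "a \<noteq> s" using sE start by (auto simp: E_def N_def)
  then have "a < s" using sab by auto
  have "closedin X N'" unfolding N'_def by (rule closedin_chart_preimage[OF c compact_cball K])
  then have "closedin (top_of_set {a..b}) {t \<in> topspace (top_of_set {a..b}). \<eta> t \<in> N'}"
    using closedin_continuous_map_preimage[OF \<eta>] by blast
  then have cl: "closed {t \<in> {a..b}. \<eta> t \<in> N'}"
    using closedin_closed_trans closed_atLeastAtMost by (metis topspace_euclidean_subtopology)
  have "{a..<s} \<subseteq> {t \<in> {a..b}. \<eta> t \<in> N'}"
    using before sab by (fastforce simp: N_def N'_def)
  then have "closure {a..<s} \<subseteq> {t \<in> {a..b}. \<eta> t \<in> N'}" by (rule closure_minimal[OF _ cl])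
  then have all: "\<eta> t \<in> N'" if "t \<in> {a..s}" for t
    using that \<open>a < s\<close> by (auto simp: closure_atLeastLessThan)
  have "\<eta> s \<in> N'" "\<eta> s \<notin> N" using all \<open>a < s\<close> sE by (auto simp: E_def)
  then have "dist x0 (snd c (\<eta> s)) = r" by (auto simp: N_def N'_def)
  then show ?thesis using sab all by (auto simp: N'_def intro!: bexI[of _ s])
qed

section \<open>Short normal extremals are length-minimizing\<close>

lemma coordinate_frame:
  assumes "1 \<le> m" "p \<in> topspace X"
  obtains c W Z R L D where "c \<in> A" "p \<in> fst c \<inter> W" "openin X W"
    "\<And>i. i < m \<Longrightarrow> C11_vector_field A W (Z i)"
    "\<And>q. q \<in> W \<Longrightarrow> \<Delta> q = span ((\<lambda>i. Z i q) ` {..<m})"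
    "\<And>q i j. q \<in> W \<Longrightarrow> i < m \<Longrightarrow> j < m \<Longrightarrow> g q (Z i q) (Z j q) = (if i = j then 1 else 0)"
    "ball (snd c p) R \<subseteq> snd c ` (fst c \<inter> W)"
    "C11_frame (snd c p) R L m (\<lambda>i z. Z i (chart_inv c z) c) D"
    "Z 0 p c \<noteq> 0"
proof -
  obtain W Z where W: "openin X W" "p \<in> W" and CZ: "\<And>i. i < m \<Longrightarrow> C11_vector_field A W (Z i)"
    and spanZ: "\<And>q. q \<in> W \<Longrightarrow> \<Delta> q = span ((\<lambda>i. Z i q) ` {..<m})"
    and onZ: "\<And>q i j. q \<in> W \<Longrightarrow> i < m \<Longrightarrow> j < m \<Longrightarrow> g q (Z i q) (Z j q) = (if i = j then 1 else 0)"
    using orthonormal_frame[OF assms(2)] by blast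
  obtain c where c: "c \<in> A" "p \<in> fst c" using covering assms(2) by blast
  define Y where "Y = (\<lambda>i z. Z i (chart_inv c z) c)"
  define S where "S = snd c ` (fst c \<inter> W)"
  have S: "open S" "snd c p \<in> S" using open_chart_image[OF c(1) W(1)] c(2) W(2) by (auto simp: S_def)
  have "\<exists>R>0. \<exists>L D. ball (snd c p) R \<subseteq> S \<and> C11_bounds (ball (snd c p) R) L (Y i) D" if "i < m" for i
  proof (rule C11_on_bounds[OF _ S])
    show "C11_on S (Y i)" using CZ[OF that] c(1) by (simp add: C11_vector_field_def S_def Y_def)
  qed
  then obtain R L D where RLD: "\<And>i. i < m \<Longrightarrow> R i > 0" "\<And>i. i < m \<Longrightarrow> ball (snd c p) (R i) \<subseteq> S"
    "\<And>i. i < m \<Longrightarrow> C11_bounds (ball (snd c p) (R i)) (L i) (Y i) (D i)"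
    by metis
  define R0 where "R0 = Min (R ` {..<m})"
  define L0 where "L0 = Max (L ` {..<m})"
  have ne: "R ` {..<m} \<noteq> {}" using assms(1) by (auto simp: lessThan_empty_iff)
  have R0: "R0 \<le> R i" "L i \<le> L0" if "i < m" for i
    using that by (auto simp: R0_def L0_def)
  have "R0 \<in> R ` {..<m}" unfolding R0_def by (rule Min_in[OF _ ne]) simp
  then have "0 < R0" using RLD(1) by auto
  have frame: "C11_frame (snd c p) R0 L0 m Y D"
  proof
    show "C11_bounds (ball (snd c p) R0) L0 (Y i) (D i)" if "i < m" for i
      by (rule C11_bounds_mono[OF RLD(3)[OF that] subset_ball R0(2)[OF that]]) (rule R0(1)[OF that])
  qed fact
  have "ball (snd c p) R0 \<subseteq> S" using RLD(2)[of 0] R0(1)[of 0] assms(1) by (auto simp: subset_ball)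
  have "Z 0 p c \<noteq> 0"
  proof
    assume "Z 0 p c = 0"
    moreover have "Z 0 p \<in> tangent_space A p"
      using CZ[of 0] W(2) assms(1) by (simp add: C11_vector_field_def)
    ultimately have "Z 0 p = 0" using tangent_vector_eq_0 c by blast
    moreover have "(0 :: ('a, 'e) tangent) \<in> \<Delta> p"
      using subspace_distribution[OF assms(2)] by (rule subspace_0)
    ultimately have "g p (Z 0 p) (Z 0 p) = 0"
      using inner_product_on_zero[OF subspace_distribution[OF assms(2)] metric_inner_product[OF assms(2)]] by simp
    then show False using onZ[OF W(2), of 0 0] assms(1) by simp
  qed
  then show ?thesis
    using that[of c W Z R0 L0 D] c W CZ spanZ onZ frame \<open>ball (snd c p) R0 \<subseteq> S\<close>
    by (simp add: Y_def S_def)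
qed

lemma length_minimizing_exists:
  assumes "1 \<le> m" "p \<in> topspace X"
  shows "\<exists>a b \<gamma>. \<exists>t0\<in>{a..b}. length_minimizing X A \<Delta> g a b \<gamma> \<and> \<gamma> t0 = p \<and> 0 < curve_length A g a b \<gamma>"
proof -
  obtain c W Z R L D where c: "c \<in> A" and p: "p \<in> fst c \<inter> W" and W: "openin X W"
    and CZ: "\<And>i. i < m \<Longrightarrow> C11_vector_field A W (Z i)"
    and spanZ: "\<And>q. q \<in> W \<Longrightarrow> \<Delta> q = span ((\<lambda>i. Z i q) ` {..<m})"
    and onZ: "\<And>q i j. q \<in> W \<Longrightarrow> i < m \<Longrightarrow> j < m \<Longrightarrow> g q (Z i q) (Z j q) = (if i = j then 1 else 0)"
    and ballW: "ball (snd c p) R \<subseteq> snd c ` (fst c \<inter> W)"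
    and frame: "C11_frame (snd c p) R L m (\<lambda>i z. Z i (chart_inv c z) c) D"
    and Z0: "Z 0 p c \<noteq> 0"
    using coordinate_frame[OF assms] by blast
  define x0 where "x0 = snd c p"
  define Y where "Y = (\<lambda>i z. Z i (chart_inv c z) c)"
  interpret C11_frame x0 R L m Y D using frame by (simp add: x0_def Y_def)
  have Wtop: "W \<subseteq> topspace X" using W openin_subset by blast
  have "Y 0 x0 \<noteq> 0" using Z0 chart_inv_chart[OF c] p by (simp add: Y_def x0_def)
  then obtain x \<xi> x' \<xi>' T M where ext: "normal_extremal x0 R L m Y D x \<xi> x' \<xi>' T M"
    using normal_extremal_exists[of 0] assms(1) by auto
  interpret normal_extremal x0 R L m Y D x \<xi> x' \<xi>' T M by (rule ext)
  obtain r S f f' B u where r: "0 < r" "r \<le> R" and S: "0 < S"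
    and curve: "\<And>t. t \<in> {0..S} \<Longrightarrow> x t \<in> ball x0 r"
      "\<And>t. t \<in> {0..S} \<Longrightarrow> (x has_vector_derivative (\<Sum>i<m. u i t *\<^sub>R Y i (x t))) (at t within {0..S})"
      "\<And>t. t \<in> {0..S} \<Longrightarrow> ((\<lambda>t. f (x t)) has_vector_derivative sqrt (\<Sum>i<m. (u i t)\<^sup>2)) (at t within {0..S})"
      "\<And>t. t \<in> {0..S} \<Longrightarrow> 0 < sqrt (\<Sum>i<m. (u i t)\<^sup>2)"
    and speed: "continuous_on {0..S} (\<lambda>t. sqrt (\<Sum>i<m. (u i t)\<^sup>2))"
    and lip: "B-lipschitz_on (ball x0 r) f"
    and calib: "\<And>z. z \<in> ball x0 r \<Longrightarrow> (f has_derivative f' z) (at z)"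
      "\<And>z. z \<in> ball x0 r \<Longrightarrow> (\<Sum>i<m. (f' z (Y i z))\<^sup>2) \<le> 1"
    using calibration by (elim exE conjE) blast
  have Yq: "Y i (snd c q) = Z i q c" if "q \<in> fst c" for i q
    using chart_inv_chart[OF c that] by (simp add: Y_def)
  have L0: "0 \<le> L" using bounds[of 0] assms(1) by (simp add: C11_bounds_def)
  have YL: "norm (Y i z) \<le> L" if "i < m" "z \<in> ball x0 R" for i z
    using bounds[OF that(1)] that(2) by (simp add: C11_bounds_def)
  have inW: "q \<in> fst c \<inter> W" if q: "q \<in> fst c" "snd c q \<in> ball x0 R" for q
  proof -
    have "snd c q \<in> snd c ` (fst c \<inter> W)" using ballW q(2) unfolding x0_def by blast
    then obtain q' where "q' \<in> fst c \<inter> W" "snd c q = snd c q'" by (elim imageE)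
    then show ?thesis using inj_onD[OF inj_on_chart[OF c], of q q'] q(1) by simp
  qed
  \<comment> \<open>A curve that leaves the ball of radius \<open>r / 2\<close> has length at least \<open>\<epsilon>\<close>.\<close>
  define Q where "Q = m * L + 1"
  define \<epsilon> where "\<epsilon> = (r / 2) / Q"
  have Q: "1 \<le> Q" "m * L\<^sup>2 \<le> Q\<^sup>2"
  proof -
    show "1 \<le> Q" using L0 by (simp add: Q_def)
    have "1 * (real m * L\<^sup>2) \<le> real m * (real m * L\<^sup>2)"
      using assms(1) by (intro mult_right_mono) auto
    then have "real m * L\<^sup>2 \<le> (real m * L)\<^sup>2"
      by (simp add: power2_eq_square mult_ac)
    also have "\<dots> \<le> Q\<^sup>2" using L0 by (intro power_mono) (auto simp: Q_def)
    finally show "m * L\<^sup>2 \<le> Q\<^sup>2" .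
  qed
  have \<epsilon>: "0 < \<epsilon>" using r Q by (simp add: \<epsilon>_def)
  have exit_long: "ennreal \<epsilon> \<le> curve_length A g a b \<eta>"
    if adm: "admissible X A \<Delta> a b \<eta>" and start: "\<eta> a = p"
      and leaves: "\<not> (\<forall>t\<in>{a..b}. \<eta> t \<in> fst c \<and> snd c (\<eta> t) \<in> ball x0 (r / 2))" for a b \<eta>
  proof -
    have ab: "a \<le> b" and cont: "continuous_map (top_of_set {a..b}) X \<eta>"
      using adm by (auto simp: admissible_def absolutely_continuous_curve_def)
    have cb: "cball x0 (r / 2) \<subseteq> ball x0 R" using r by auto
    then have "cball x0 (r / 2) \<subseteq> snd c ` fst c" using ballW by (fastforce simp: x0_def)
    then obtain s where s: "s \<in> {a..b}" "dist x0 (snd c (\<eta> s)) = r / 2"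
      and in_s: "\<And>t. t \<in> {a..s} \<Longrightarrow> \<eta> t \<in> fst c \<and> snd c (\<eta> t) \<in> cball x0 (r / 2)"
      using exit_time[OF c ab cont _ _ _ leaves] p start r by (auto simp: x0_def)
    \<comment> \<open>The linear function in the direction of the exit point, scaled by \<open>1 / Q\<close>, has differential of
      norm at most 1 on the distribution and increases by \<open>\<epsilon>\<close>.\<close>
    define w where "w = (1 / (r / 2)) *\<^sub>R (snd c (\<eta> s) - x0)"
    have w: "norm w = 1" using s(2) r by (simp add: w_def dist_norm norm_minus_commute)
    define \<phi> where "\<phi> = (\<lambda>z. (w \<bullet> z) / Q)"
    have d\<phi>: "(\<phi> has_derivative \<phi>) (at z)" for z
      unfolding \<phi>_def using Q(1) by (auto intro!: derivative_eq_intros)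
    have "ennreal (\<phi> (snd c (\<eta> s)) - \<phi> (snd c (\<eta> a))) \<le> curve_length A g a b \<eta>"
    proof (rule increment_le_length[OF adm _ _ c Wtop spanZ onZ, where G = "ball x0 R" and f' = "\<lambda>_. \<phi>" and B = 1])
      show "a \<le> s" "s \<le> b" using s by auto
      show "\<eta> t \<in> fst c \<inter> W \<and> snd c (\<eta> t) \<in> ball x0 R" if "t \<in> {a..s}" for t
        using in_s[OF that] cb inW by blast
      show "1-lipschitz_on (ball x0 R) \<phi>"
      proof (rule lipschitz_onI)
        fix z z' :: 'e
        have "\<bar>w \<bullet> (z - z')\<bar> \<le> norm w * norm (z - z')" by (rule Cauchy_Schwarz_ineq2)
        then have "\<bar>w \<bullet> (z - z')\<bar> / Q \<le> norm (z - z') / 1"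
          using Q w by (intro frac_le) auto
        then show "dist (\<phi> z) (\<phi> z') \<le> 1 * dist z z'"
          using Q by (simp add: \<phi>_def dist_norm inner_diff_right flip: diff_divide_distrib)
      qed simp
      show "(\<phi> has_derivative \<phi>) (at (snd c q))" for q by (rule d\<phi>)
      fix q assume q: "q \<in> fst c \<inter> W" "snd c q \<in> ball x0 R"
      have "(\<phi> (Z i q c))\<^sup>2 \<le> L\<^sup>2 / Q\<^sup>2" if "i < m" for i
      proof -
        have "\<bar>w \<bullet> Z i q c\<bar> \<le> norm w * norm (Z i q c)" by (rule Cauchy_Schwarz_ineq2)
        also have "\<dots> \<le> L" using YL[OF that q(2)] Yq q(1) w by simp
        finally have "\<bar>w \<bullet> Z i q c\<bar>\<^sup>2 \<le> L\<^sup>2" by (intro power_mono) auto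
        then show ?thesis using Q by (simp add: \<phi>_def power_divide divide_right_mono)
      qed
      then have "(\<Sum>i<m. (\<phi> (Z i q c))\<^sup>2) \<le> (\<Sum>i<m. L\<^sup>2 / Q\<^sup>2)" by (intro sum_mono) auto
      also have "\<dots> \<le> 1" using Q by (simp add: field_simps)
      finally show "(\<Sum>i<m. (\<phi> (Z i q c))\<^sup>2) \<le> 1" .
    qed
    moreover have "\<phi> (snd c (\<eta> s)) - \<phi> (snd c (\<eta> a)) = \<epsilon>"
    proof -
      have "w \<bullet> (snd c (\<eta> s) - x0) = (r / 2) * (w \<bullet> w)"
        using r by (simp add: w_def)
      also have "w \<bullet> w = 1" using w by (simp add: dot_square_norm)
      finally have wr: "w \<bullet> (snd c (\<eta> s) - x0) = r / 2" unfolding mult_1_right .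
      have "\<phi> (snd c (\<eta> s)) - \<phi> (snd c (\<eta> a)) = (w \<bullet> (snd c (\<eta> s) - x0)) / Q"
        by (simp add: \<phi>_def start x0_def inner_diff_right diff_divide_distrib)
      then show ?thesis unfolding wr \<epsilon>_def .
    qed
    ultimately show ?thesis by simp
  qed
  \<comment> \<open>The extremal is cut so short that its length is less than \<open>\<epsilon>\<close>.\<close>
  have "continuous (at 0 within {0..S}) (\<lambda>t. f (x t))"
    using has_vector_derivative_continuous[OF curve(3)[of 0]] S by simp
  then obtain d where d: "0 < d" "\<And>t. t \<in> {0..S} \<Longrightarrow> dist t 0 < d \<Longrightarrow> dist (f (x t)) (f (x 0)) < \<epsilon>"
    using \<epsilon> unfolding continuous_within_eps_delta by blast
  define S' where "S' = min S (d / 2)"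
  have S': "0 < S'" "S' \<le> S" using S d(1) by (auto simp: S'_def)
  have sub: "{0..S'} \<subseteq> {0..S}" using S' by auto
  have short: "f (x S') - f (x 0) < \<epsilon>"
  proof -
    have "S' \<in> {0..S}" "dist S' 0 < d" using S' d(1) by (auto simp: S'_def dist_real_def)
    then show ?thesis using d(2)[of S'] by (simp add: dist_real_def)
  qed
  define \<gamma> where "\<gamma> = chart_inv c \<circ> x"
  have x_in: "x t \<in> snd c ` (fst c \<inter> W)" if "t \<in> {0..S'}" for t
    using curve(1)[of t] sub that r(2) ballW by (fastforce simp: x0_def)
  have \<gamma>: "\<gamma> t \<in> fst c \<inter> W" "snd c (\<gamma> t) = x t" if "t \<in> {0..S'}" for t
    using chart_chart_inv[OF c x_in[OF that]] by (auto simp: \<gamma>_def)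
  have der': "(x has_vector_derivative (\<Sum>i<m. u i t *\<^sub>R Z i (chart_inv c (x t)) c)) (at t within {0..S'})"
    if "t \<in> {0..S'}" for t
    using has_vector_derivative_within_subset[OF curve(2) sub] that sub by (auto simp: Y_def)
  obtain U where U_all: "\<forall>t\<in>{0..S}. \<bar>sqrt (\<Sum>i<m. (u i t)\<^sup>2)\<bar> \<le> U"
    using compact_imp_bounded[OF compact_continuous_image[OF speed compact_Icc]] by (auto simp: bounded_iff)
  have bd: "norm (\<Sum>i<m. u i t *\<^sub>R Z i (chart_inv c (x t)) c) \<le> m * (U * L)" if "t \<in> {0..S'}" for t
  proof -
    have tS: "t \<in> {0..S}" using that sub by blast
    note U = U_all[THEN bspec, OF tS]
    have "norm (\<Sum>i<m. u i t *\<^sub>R Z i (chart_inv c (x t)) c) \<le> (\<Sum>i<m. \<bar>u i t\<bar> * norm (Y i (x t)))"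
      unfolding Y_def by (rule order_trans[OF norm_sum]) simp
    also have "\<dots> \<le> (\<Sum>i<m. U * L)"
    proof (intro sum_mono mult_mono)
      fix i assume i: "i \<in> {..<m}"
      have "sqrt ((u i t)\<^sup>2) \<le> sqrt (\<Sum>i<m. (u i t)\<^sup>2)"
        using i by (intro real_sqrt_le_mono member_le_sum) auto
      then show "\<bar>u i t\<bar> \<le> U" using U by simp
      show "norm (Y i (x t)) \<le> L" using YL[of i "x t"] i curve(1)[OF tS] r(2) by auto
      show "0 \<le> U" using U by simp
    qed auto
    finally show ?thesis by simp
  qed
  note \<gamma>_props = chart_curve_admissible[OF c Wtop S'(1) CZ spanZ onZ x_in der' bd, folded \<gamma>_def]
  have adm: "admissible X A \<Delta> 0 S' \<gamma>" by (rule \<gamma>_props(1))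
  have \<gamma>0: "\<gamma> 0 = p" using chart_inv_chart[OF c] p by (simp add: \<gamma>_def local.start x0_def)
  define s where "s = (\<lambda>t. sqrt (\<Sum>i<m. (u i t)\<^sup>2))"
  have len: "curve_length A g 0 S' \<gamma> = ennreal (f (x S') - f (x 0))"
  proof -
    have "curve_length A g 0 S' \<gamma> = (\<integral>\<^sup>+ t. ennreal (s t) \<partial>lebesgue_on {0..S'})"
      unfolding curve_length_def s_def using \<gamma>_props(2) by (intro nn_integral_cong) simp
    also have int: "integrable (lebesgue_on {0..S'}) s"
      unfolding s_def by (rule continuous_imp_integrable_real[OF continuous_on_subset[OF speed sub]])
    have "(\<integral>\<^sup>+ t. ennreal (s t) \<partial>lebesgue_on {0..S'}) = ennreal (integral\<^sup>L (lebesgue_on {0..S'}) s)"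
      by (rule nn_integral_eq_integral[OF int]) (simp add: s_def sum_nonneg)
    also have "integral\<^sup>L (lebesgue_on {0..S'}) s = f (x S') - f (x 0)"
    proof (rule has_integral_unique)
      show "(s has_integral integral\<^sup>L (lebesgue_on {0..S'}) s) {0..S'}"
        by (rule has_integral_integral_lebesgue_on[OF int]) simp
      show "(s has_integral (f (x S') - f (x 0))) {0..S'}"
      proof (rule fundamental_theorem_of_calculus)
        show "((\<lambda>t. f (x t)) has_vector_derivative s t) (at t within {0..S'})" if "t \<in> {0..S'}" for t
          unfolding s_def using has_vector_derivative_within_subset[OF curve(3) sub] that sub by blast
      qed (use S' in simp)
    qed
    finally show ?thesis .
  qed
  have pos: "f (x 0) < f (x S')"
  proof (rule DERIV_pos_imp_increasing_open[OF S'(1)])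
    show "continuous_on {0..S'} (\<lambda>t. f (x t))"
      unfolding continuous_on_eq_continuous_within
      using has_vector_derivative_continuous[OF has_vector_derivative_within_subset[OF curve(3) sub]] sub by blast
    fix t assume t: "0 < t" "t < S'"
    then have "t \<in> {0..S}" "t \<in> interior {0..S}" using S' by auto
    then have "((\<lambda>t. f (x t)) has_real_derivative s t) (at t)"
      using curve(3)[of t] at_within_interior[of t "{0..S}"]
      by (simp add: s_def has_real_derivative_iff_has_vector_derivative)
    then show "\<exists>y. ((\<lambda>t. f (x t)) has_real_derivative y) (at t) \<and> 0 < y"
      using curve(4)[OF \<open>t \<in> {0..S}\<close>] by (auto simp: s_def)
  qed
  have minimal: "curve_length A g 0 S' \<gamma> \<le> curve_length A g a b \<eta>"
    if \<eta>: "admissible X A \<Delta> a b \<eta>" "\<eta> a = \<gamma> 0" "\<eta> b = \<gamma> S'" for a b \<eta>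
  proof (cases "\<forall>t\<in>{a..b}. \<eta> t \<in> fst c \<and> snd c (\<eta> t) \<in> ball x0 (r / 2)")
    case True
    have ab: "a \<le> b" using \<eta>(1) by (simp add: admissible_def)
    have "ennreal (f (snd c (\<eta> b)) - f (snd c (\<eta> a))) \<le> curve_length A g a b \<eta>"
    proof (rule increment_le_length[OF \<eta>(1) ab order_refl c Wtop spanZ onZ _ lip])
      show "\<eta> t \<in> fst c \<inter> W \<and> snd c (\<eta> t) \<in> ball x0 r" if "t \<in> {a..b}" for t
      proof -
        have "\<eta> t \<in> fst c" "snd c (\<eta> t) \<in> ball x0 (r / 2)" using True that by auto
        then show ?thesis using inW[of "\<eta> t"] r by auto
      qed
      show "(f has_derivative f' (snd c q)) (at (snd c q))" if "snd c q \<in> ball x0 r" for q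
        using calib(1)[OF that] .
      show "(\<Sum>i<m. (f' (snd c q) (Z i q c))\<^sup>2) \<le> 1" if "q \<in> fst c \<inter> W" "snd c q \<in> ball x0 r" for q
        using calib(2)[OF that(2)] Yq[of q] that(1) by simp
    qed
    then show ?thesis unfolding len using \<eta>(2,3) \<gamma>(2) S'(1) by simp
  next
    case False
    have "ennreal (f (x S') - f (x 0)) \<le> ennreal \<epsilon>" using short by (intro ennreal_leI) simp
    also have "\<dots> \<le> curve_length A g a b \<eta>"
      using exit_long[OF \<eta>(1) _ False] \<eta>(2) \<gamma>0 by simp
    finally show ?thesis unfolding len .
  qed
  have "curve_length A g 0 S' \<gamma> = cc_dist X A \<Delta> g (\<gamma> 0) (\<gamma> S')"
  proof (rule antisym)
    show "curve_length A g 0 S' \<gamma> \<le> cc_dist X A \<Delta> g (\<gamma> 0) (\<gamma> S')"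
      unfolding cc_dist_def using minimal by (intro Inf_greatest) blast
    show "cc_dist X A \<Delta> g (\<gamma> 0) (\<gamma> S') \<le> curve_length A g 0 S' \<gamma>"
      unfolding cc_dist_def using adm by (intro Inf_lower) blast
  qed
  then have "length_minimizing X A \<Delta> g 0 S' \<gamma>" using adm by (simp add: length_minimizing_def)
  moreover have "0 < curve_length A g 0 S' \<gamma>" unfolding len using pos by simp
  ultimately show ?thesis using \<gamma>0 S'(1) by (intro exI bexI[of _ 0]) auto
qed

end

theorem corollary1p2:
  fixes X :: "'a topology" and A :: "('a, 'e::euclidean_space) chart set"
    and m :: nat
    and \<Delta> :: "'a \<Rightarrow> ('a, 'e) tangent set"
    and g :: "'a \<Rightarrow> ('a, 'e) tangent \<Rightarrow> ('a, 'e) tangent \<Rightarrow> real"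
    and p :: 'a
  assumes "C11_sub_Riemannian_manifold X A m \<Delta> g"
    and "m \<ge> 1"
    and "p \<in> topspace X"
  shows "\<exists>a b \<gamma>. \<exists>t\<^sub>0\<in>{a..b}. length_minimizing X A \<Delta> g a b \<gamma> \<and> \<gamma> t\<^sub>0 = p \<and>
           0 < curve_length A g a b \<gamma>"
  using C11_sub_Riemannian_manifold.length_minimizing_exists[OF assms] .

end
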